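(* Let $N\geq 2$, let $\lambda\in\mathbb{C}^N$ and let $\mathcal{J}_{\lambda}$ be the subcategory of modules in category $\mathcal{J}$ supported on $\lambda+\mathbb{Z}^N$ (i.e. all of whose weights lie in $\lambda+\mathbb{Z}^N$). There is a one-to-one correspondence (up to isomorphism) between the finite dimensional irreducible modules for $\mathfrak{sl}_N\oplus\mathfrak{a}_N$ and the irreducible modules in $\mathcal{J}_{\lambda}$. This correspondence maps a finite dimensional irreducible module $V$ for $\mathfrak{sl}_N\oplus\mathfrak{a}_N$ to $A_N\otimes V$. The action of $\mathcal{S}_N$ on $A_N\otimes V$ is given by $d_a(t^{s}\otimes u)=(s_a+\lambda_a)t^s\otimes u$ and $$d_{ab}(r)(t^{s}\otimes u)=\left(r_b(s_a+\mu_a)-r_a(s_b+\mu_b)\right)t^{r+s}\otimes u+t^{r+s}\otimes\Big(\sum_{\substack{i=1\\i\neq a}}^Nr_ir_b\varphi(E_{ia})u-\sum_{\substack{i=1\\i\neq b}}^Nr_ir_a\varphi(E_{ib})u+r_ar_b\varphi(E_{aa}-E_{bb})u\Big)$$ for $a,b\in\{1,\dots,N\}$, $r,s\in\mathbb{Z}^N$, $u\in V$, where $\mu_a,\mu_b\in\mathbb{C}$ are the scalars by which $C_a,C_b\in\mathfrak{a}_N$ act on $V$, and $\varphi$ is the representation of $\mathfrak{sl}_N$ on $V$.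
   Context: Let $N\ge 2$ and $A_N=\mathbb{C}[t_1^{\pm1},\dots,t_N^{\pm1}]$, with monomials $t^r=t_1^{r_1}\cdots t_N^{r_N}$, $r\in\mathbb{Z}^N$. Put $d_a=t_a\frac{\partial}{\partial t_a}$ and $d_{ab}(r)=r_bt^rd_a-r_at^rd_b$ for $a,b\in\{1,\dots,N\}$. The Lie algebra of divergence zero vector fields on the torus is $\mathcal{S}_N=\mathrm{Span}_{\mathbb{C}}\{d_a,d_{ab}(r)\mid a,b\in\{1,\dots,N\},\,r\in\mathbb{Z}^N\}$, a Lie subalgebra of $\mathrm{Der}(A_N)$. Category $\mathcal{J}$: an $\mathcal{S}_N$-module $J$ belongs to $\mathcal{J}$ if (J1) each $d_a$ acts diagonalizably on $J$; (J2) $J$ is a free $A_N$-module of finite rank; (J3) $X(fu)=(X(f))u+f(Xu)$ for all $X\in\mathcal{S}_N$, $f\in A_N$, $u\in J$. Submodules (hence irreducibility) and isomorphisms are with respect to both the $A_N$- and the $\mathcal{S}_N$-action. The weights of $J$ are the $\mu\in\mathbb{C}^N$ for which $\{u\in J\mid d_au=\mu_au\text{ for all }a\}$ is nonzero. On $A_N\otimes V$ (tensor product over $\mathbb{C}$), $A_N$ acts by multiplication on the first factor. $\mathfrak{sl}_N$ is the Lie algebra of $N\times N$ trace zero complex matrices, $E_{ij}$ are the matrix units, and $\mathfrak{a}_N=\mathrm{Span}_{\mathbb{C}}\{C_1,\dots,C_N\}$ is an $N$-dimensional abelian Lie algebra. *)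

theory Defs
  imports
    "HOL-Analysis.Analysis"
    "HOL-Library.Poly_Mapping"
    "HOL-Library.Function_Algebras"
begin

section \<open>Laurent polynomials and divergence zero vector fields\<close>

text \<open>
  The number of variables is \<open>N = CARD('n)\<close>, and the Laurent polynomial algebra is the group
  algebra of \<open>\<int>\<^sup>N\<close>: the product on \<open>poly_mapping\<close> is convolution, and
  \<open>t\<^sup>r\<close> is \<open>Poly_Mapping.single r 1\<close>.
\<close>

type_synonym 'n laurent = "(int ^ 'n) \<Rightarrow>\<^sub>0 complex"

definition lconst :: "complex \<Rightarrow> 'n::finite laurent" where
  "lconst c = Poly_Mapping.single 0 c"

definition tmon :: "int ^ 'n \<Rightarrow> 'n::finite laurent" where
  "tmon r = Poly_Mapping.single r 1"

text \<open>The degree derivation \<open>d\<^sub>a = t\<^sub>a \<partial>/\<partial>t\<^sub>a\<close> multiplies the coefficient of \<open>t\<^sup>r\<close> by \<open>r\<^sub>a\<close>.\<close>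

definition deg_der :: "'n \<Rightarrow> 'n::finite laurent \<Rightarrow> 'n laurent" where
  "deg_der a f = Poly_Mapping.mapp (\<lambda>r c. of_int (r $ a) * c) f"

definition div_der :: "'n \<Rightarrow> 'n \<Rightarrow> int ^ 'n \<Rightarrow> 'n::finite laurent \<Rightarrow> 'n laurent" where
  "div_der a b r f =
     lconst (of_int (r $ b)) * tmon r * deg_der a f - lconst (of_int (r $ a)) * tmon r * deg_der b f"

text \<open>
  Vector fields are operators on Laurent polynomials, added and scaled pointwise
  (addition is the one of \<open>HOL-Library.Function_Algebras\<close>), with the commutator as bracket.
\<close>

definition op_scale ::
    "complex \<Rightarrow> ('n::finite laurent \<Rightarrow> 'n laurent) \<Rightarrow> ('n laurent \<Rightarrow> 'n laurent)" where
  "op_scale c X = (\<lambda>f. lconst c * X f)"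

definition op_bracket ::
    "('n::finite laurent \<Rightarrow> 'n laurent) \<Rightarrow> ('n laurent \<Rightarrow> 'n laurent) \<Rightarrow> ('n laurent \<Rightarrow> 'n laurent)" where
  "op_bracket X Y = (\<lambda>f. X (Y f) - Y (X f))"

definition SN :: "('n::finite laurent \<Rightarrow> 'n laurent) set" where
  "SN = module.span op_scale (range deg_der \<union> {div_der a b r | a b r. True})"


section \<open>Modules over a complex Lie algebra\<close>

text \<open>
  Throughout, a module is a carrier subspace (submodule) of an ambient type that is itself a
  vector space (module).  Any module can be so presented, with the whole type as carrier; carriers
  are needed because the dimension of a module is not determined by a type.  The values of an
  action outside the carrier, or on elements outside the Lie algebra, are irrelevant.
\<close>

locale lie_module = vector_space sc
  for sc :: "complex \<Rightarrow> 'v::ab_group_add \<Rightarrow> 'v" +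
  fixes L :: "'g::ab_group_add set"
    and lscale :: "complex \<Rightarrow> 'g \<Rightarrow> 'g"
    and bracket :: "'g \<Rightarrow> 'g \<Rightarrow> 'g"
    and V :: "'v set"
    and act :: "'g \<Rightarrow> 'v \<Rightarrow> 'v"
  assumes carrier_subspace: "subspace V"
    and act_closed: "X \<in> L \<Longrightarrow> u \<in> V \<Longrightarrow> act X u \<in> V"
    and act_add_right: "X \<in> L \<Longrightarrow> u \<in> V \<Longrightarrow> v \<in> V \<Longrightarrow> act X (u + v) = act X u + act X v"
    and act_scale_right: "X \<in> L \<Longrightarrow> u \<in> V \<Longrightarrow> act X (sc c u) = sc c (act X u)"
    and act_add_left: "X \<in> L \<Longrightarrow> Y \<in> L \<Longrightarrow> u \<in> V \<Longrightarrow> act (X + Y) u = act X u + act Y u"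
    and act_scale_left: "X \<in> L \<Longrightarrow> u \<in> V \<Longrightarrow> act (lscale c X) u = sc c (act X u)"
    and act_bracket:
      "X \<in> L \<Longrightarrow> Y \<in> L \<Longrightarrow> u \<in> V \<Longrightarrow> act (bracket X Y) u = act X (act Y u) - act Y (act X u)"


section \<open>Finite-dimensional irreducible modules over the sum of sl(N) and an abelian algebra\<close>

text \<open>
  An element of the direct sum is a pair of a trace zero matrix and a vector; the abelian summand
  is \<open>\<complex>\<^sup>N\<close> with basis \<open>C\<^sub>a = axis a 1\<close>.
\<close>

type_synonym 'n sla = "(complex ^ 'n ^ 'n) \<times> (complex ^ 'n)"

definition sla_carrier :: "'n::finite sla set" where
  "sla_carrier = {(A, c). trace A = 0}"

definition sla_scale :: "complex \<Rightarrow> 'n::finite sla \<Rightarrow> 'n sla" where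
  "sla_scale k = (\<lambda>(A, c). (\<chi> i. k *s (A $ i), k *s c))"

definition sla_bracket :: "'n::finite sla \<Rightarrow> 'n sla \<Rightarrow> 'n sla" where
  "sla_bracket = (\<lambda>(A, c) (B, d). (A ** B - B ** A, 0))"

definition matrix_unit :: "'n \<Rightarrow> 'n \<Rightarrow> complex ^ 'n ^ 'n::finite" where
  "matrix_unit i j = (\<chi> k l. if k = i \<and> l = j then 1 else 0)"

definition C_elem :: "'n::finite \<Rightarrow> 'n sla" where
  "C_elem a = (0, axis a 1)"

record ('n::finite, 'v) sla_module =
  vcarrier :: "'v set"
  vscale :: "complex \<Rightarrow> 'v \<Rightarrow> 'v"
  vact :: "'n sla \<Rightarrow> 'v \<Rightarrow> 'v"

definition is_sla_module :: "('n::finite, 'v::ab_group_add) sla_module \<Rightarrow> bool" where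
  "is_sla_module V \<longleftrightarrow>
     lie_module (vscale V) sla_carrier sla_scale sla_bracket (vcarrier V) (vact V)"

definition sla_submodule :: "'v set \<Rightarrow> ('n::finite, 'v::ab_group_add) sla_module \<Rightarrow> bool" where
  "sla_submodule W V \<longleftrightarrow>
     W \<subseteq> vcarrier V \<and> module.subspace (vscale V) W \<and>
     (\<forall>X\<in>sla_carrier. \<forall>w\<in>W. vact V X w \<in> W)"

definition fd_irreducible_sla_module :: "('n::finite, 'v::ab_group_add) sla_module \<Rightarrow> bool" where
  "fd_irreducible_sla_module V \<longleftrightarrow>
     is_sla_module V \<and>
     (\<exists>B. finite B \<and> module.span (vscale V) B = vcarrier V) \<and>
     vcarrier V \<noteq> {0} \<and>
     (\<forall>W. sla_submodule W V \<longrightarrow> W = {0} \<or> W = vcarrier V)"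

definition sla_isomorphic ::
    "('n::finite, 'v::ab_group_add) sla_module \<Rightarrow> ('n, 'w::ab_group_add) sla_module \<Rightarrow> bool" where
  "sla_isomorphic V W \<longleftrightarrow>
     (\<exists>h. bij_betw h (vcarrier V) (vcarrier W) \<and>
          (\<forall>u\<in>vcarrier V. \<forall>v\<in>vcarrier V. h (u + v) = h u + h v) \<and>
          (\<forall>c. \<forall>u\<in>vcarrier V. h (vscale V c u) = vscale W c (h u)) \<and>
          (\<forall>X\<in>sla_carrier. \<forall>u\<in>vcarrier V. h (vact V X u) = vact W X (h u)))"


section \<open>The category J\<close>

record ('n::finite, 'j) AS_module =
  jcarrier :: "'j set"
  jmult :: "'n laurent \<Rightarrow> 'j \<Rightarrow> 'j"
  jact :: "('n laurent \<Rightarrow> 'n laurent) \<Rightarrow> 'j \<Rightarrow> 'j"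

text \<open>The complex vector space structure is restricted from the Laurent polynomials.\<close>

definition jscale :: "('n::finite, 'j::ab_group_add) AS_module \<Rightarrow> complex \<Rightarrow> 'j \<Rightarrow> 'j" where
  "jscale J c u = jmult J (lconst c) u"

definition SN_module :: "('n::finite, 'j::ab_group_add) AS_module \<Rightarrow> bool" where
  "SN_module J \<longleftrightarrow> lie_module (jscale J) SN op_scale op_bracket (jcarrier J) (jact J)"

definition diagonalizable_on ::
    "(complex \<Rightarrow> 'j::ab_group_add \<Rightarrow> 'j) \<Rightarrow> 'j set \<Rightarrow> ('j \<Rightarrow> 'j) \<Rightarrow> bool" where
  "diagonalizable_on sc U T \<longleftrightarrow>
     (\<exists>B. \<not> module.dependent sc B \<and> module.span sc B = U \<and>
          (\<forall>b\<in>B. \<exists>c. T b = sc c b))"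

definition category_J :: "('n::finite, 'j::ab_group_add) AS_module \<Rightarrow> bool" where
  "category_J J \<longleftrightarrow>
     module (jmult J) \<and> module.subspace (jmult J) (jcarrier J) \<and>
     SN_module J \<and>
     (\<forall>a. diagonalizable_on (jscale J) (jcarrier J) (jact J (deg_der a))) \<and>
     (\<exists>B. finite B \<and> \<not> module.dependent (jmult J) B \<and> module.span (jmult J) B = jcarrier J) \<and>
     (\<forall>X\<in>SN. \<forall>f. \<forall>u\<in>jcarrier J.
        jact J X (jmult J f u) = jmult J (X f) u + jmult J f (jact J X u))"

definition weights :: "('n::finite, 'j::ab_group_add) AS_module \<Rightarrow> (complex ^ 'n) set" where
  "weights J =
     {\<mu>. \<exists>u\<in>jcarrier J. u \<noteq> 0 \<and> (\<forall>a. jact J (deg_der a) u = jscale J (\<mu> $ a) u)}"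

definition category_J_at ::
    "complex ^ 'n \<Rightarrow> ('n::finite, 'j::ab_group_add) AS_module \<Rightarrow> bool" where
  "category_J_at lam J \<longleftrightarrow>
     category_J J \<and> weights J \<subseteq> {lam + (\<chi> a. of_int (r $ a)) | r :: int ^ 'n. True}"

definition AS_submodule :: "'j set \<Rightarrow> ('n::finite, 'j::ab_group_add) AS_module \<Rightarrow> bool" where
  "AS_submodule W J \<longleftrightarrow>
     W \<subseteq> jcarrier J \<and> module.subspace (jmult J) W \<and> (\<forall>X\<in>SN. \<forall>w\<in>W. jact J X w \<in> W)"

definition AS_irreducible :: "('n::finite, 'j::ab_group_add) AS_module \<Rightarrow> bool" where
  "AS_irreducible J \<longleftrightarrow>
     jcarrier J \<noteq> {0} \<and> (\<forall>W. AS_submodule W J \<longrightarrow> W = {0} \<or> W = jcarrier J)"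

definition AS_isomorphic ::
    "('n::finite, 'j::ab_group_add) AS_module \<Rightarrow> ('n, 'k::ab_group_add) AS_module \<Rightarrow> bool" where
  "AS_isomorphic J K \<longleftrightarrow>
     (\<exists>h. bij_betw h (jcarrier J) (jcarrier K) \<and>
          (\<forall>u\<in>jcarrier J. \<forall>v\<in>jcarrier J. h (u + v) = h u + h v) \<and>
          (\<forall>f. \<forall>u\<in>jcarrier J. h (jmult J f u) = jmult K f (h u)) \<and>
          (\<forall>X\<in>SN. \<forall>u\<in>jcarrier J. h (jact J X u) = jact K X (h u)))"


section \<open>The tensor modules\<close>

text \<open>
  The tensor product of the Laurent polynomials with \<open>V\<close> consists of the finitely supported
  functions from \<open>\<int>\<^sup>N\<close> to \<open>V\<close>, with \<open>t\<^sup>s \<otimes> u = Poly_Mapping.single s u\<close>.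
\<close>

definition tensor_carrier :: "'v::ab_group_add set \<Rightarrow> ((int ^ 'n::finite) \<Rightarrow>\<^sub>0 'v) set" where
  "tensor_carrier V = {p. \<forall>s. Poly_Mapping.lookup p s \<in> V}"

definition tensor_mult ::
    "(complex \<Rightarrow> 'v \<Rightarrow> 'v) \<Rightarrow> 'n::finite laurent \<Rightarrow> ((int ^ 'n) \<Rightarrow>\<^sub>0 'v::ab_group_add) \<Rightarrow> ((int ^ 'n) \<Rightarrow>\<^sub>0 'v)" where
  "tensor_mult sc f p =
     (\<Sum>r\<in>Poly_Mapping.keys f. \<Sum>s\<in>Poly_Mapping.keys p.
        Poly_Mapping.single (r + s) (sc (Poly_Mapping.lookup f r) (Poly_Mapping.lookup p s)))"

text \<open>
  Since \<open>SN\<close> is spanned by the \<open>d\<^sub>a\<close> and \<open>d\<^sub>a\<^sub>b(r)\<close>, and the tensor product by the \<open>t\<^sup>s \<otimes> u\<close>,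
  bilinearity and the two formulas below determine the action.  The generators satisfy linear
  relations, so that such an action exists is part of what has to be proved; hence a predicate.
\<close>

definition is_tensor_module ::
    "complex ^ 'n \<Rightarrow> ('n::finite, 'v::ab_group_add) sla_module \<Rightarrow> ('n, (int ^ 'n) \<Rightarrow>\<^sub>0 'v) AS_module \<Rightarrow> bool" where
  "is_tensor_module lam V M \<longleftrightarrow>
     jcarrier M = tensor_carrier (vcarrier V) \<and>
     jmult M = tensor_mult (vscale V) \<and>
     SN_module M \<and>
     (\<forall>a s. \<forall>u\<in>vcarrier V.
        jact M (deg_der a) (Poly_Mapping.single s u) =
        Poly_Mapping.single s (vscale V (of_int (s $ a) + lam $ a) u)) \<and>
     (\<exists>\<mu> :: complex ^ 'n.
        (\<forall>a. \<forall>u\<in>vcarrier V. vact V (C_elem a) u = vscale V (\<mu> $ a) u) \<and>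
        (let \<phi> = (\<lambda>A. vact V (A, 0)); \<iota> = (of_int :: int \<Rightarrow> complex) in
         \<forall>a b r s. \<forall>u\<in>vcarrier V.
           jact M (div_der a b r) (Poly_Mapping.single s u) =
           Poly_Mapping.single (r + s)
             (vscale V (\<iota> (r $ b) * (\<iota> (s $ a) + \<mu> $ a) - \<iota> (r $ a) * (\<iota> (s $ b) + \<mu> $ b)) u) +
           Poly_Mapping.single (r + s)
             ((\<Sum>i\<in>UNIV - {a}. vscale V (\<iota> (r $ i) * \<iota> (r $ b)) (\<phi> (matrix_unit i a) u))
              - (\<Sum>i\<in>UNIV - {b}. vscale V (\<iota> (r $ i) * \<iota> (r $ a)) (\<phi> (matrix_unit i b) u))
              + vscale V (\<iota> (r $ a) * \<iota> (r $ b)) (\<phi> (matrix_unit a a - matrix_unit b b) u))))"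

end

theory Submission
  imports Defs "HOL-Computational_Algebra.Fundamental_Theorem_Algebra"
begin

text \<open>
  A divergence zero field of degree \<open>r\<close> is \<open>t\<^sup>r (u \<cdot> d)\<close> with \<open>u \<cdot> r
  = 0\<close>. On an object \<open>J\<close> of the category with weight space \<open>U\<close> at \<open>lam\<close>
  one has \<open>J = \<Oplus> t\<^sup>s U\<close>, and by the Leibniz rule the whole action of the vector fields is
  encoded in the operators \<open>T(r, u)\<close> on \<open>U\<close> by which \<open>t\<^sup>r (u \<cdot> d)\<close>
  acts on \<open>U\<close> followed by \<open>t\<^sup>-\<^sup>r\<close>. Their commutation relations are those of the
  fields \<open>(t\<^sup>r - 1) (u \<cdot> d)\<close>, the divergence zero fields that vanish at the point \<open>t =
  1\<close>: \<open>[T(r, u), T(s, v)] = T(r + s, x) - (u \<cdot> s) T(s, v) + (v \<cdot> r) T(r, u)\<close> with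
  \<open>x = (u \<cdot> s) v - (v \<cdot> r) u\<close>. The space \<open>U\<close> has finite dimension, since
  generators of \<open>J\<close> over the Laurent polynomials become generators of \<open>U\<close> when all their
  components are moved to degree zero; it is irreducible under the operators \<open>T(r, u)\<close> when
  \<open>J\<close> is.

  The theorem says that \<open>T(r, u) = \<mu> \<cdot> u + \<phi>(r u\<^sup>T)\<close> for a vector
  \<open>\<mu>\<close> of scalars and a representation \<open>\<phi>\<close> of the trace zero matrices: only the
  linear part of a field at \<open>t = 1\<close> acts, up to scalars. The main step is that \<open>T(k s, v)\<close>
  is a polynomial of degree at most one in \<open>k \<noteq> 0\<close>.

  Polynomiality (\<open>ray_polynomial\<close>). In a plane spanned by \<open>(s, v)\<close> and a companion
  \<open>(r, a)\<close>, the vectors \<open>G(i, j) = T(i r + j s, i a + j v)\<close> satisfy \<open>[G(p), G(q)] =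
  \<kappa> det(p, q) (G(p + q) - G(p) - G(q))\<close>. They lie in a space of finite dimension, so there is a linear
  relation between the vectors on a ray, and bracketing it with the rows \<open>j \<mapsto> G(i, j)\<close> with
  \<open>i \<noteq> 0\<close> gives one polynomial in the shift \<open>j \<mapsto> j + 1\<close> that annihilates all
  of these rows. The brackets inside a row contain the factor \<open>j\<close>, which differentiates polynomials in
  the shift: with \<open>P\<close>, also \<open>(x - 1)\<^sup>2 P'\<close> annihilates
  (\<open>kills_derivative\<close>). Repeated differentiation leaves a power of \<open>x - 1\<close>, and sequences
  annihilated by it are polynomial.

  Linearity (\<open>linear_expansion\<close>). As \<open>G(0, k) = k T(k s, v)\<close>, the expansion of \<open>T(k s,
  v)\<close> may contain a term in \<open>1 / k\<close>. Its coefficient commutes with all operators and is a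
  commutator of one of them; by the Kleinecke argument (\<open>commutator_nilpotent\<close>) it is nilpotent, and by
  irreducibility it is zero. The same comparison shows that the constant term is central. If the degree
  \<open>K\<close> is at least two, the top coefficients span an abelian ideal. An abelian ideal of an irreducible
  algebra of matrices is central (\<open>abelian_ideal_central\<close>), again because its commutators with the
  algebra are commuting nilpotent matrices. In a plane, central top coefficients give a homogeneous function whose
  derivative at \<open>s\<close> is zero in two independent directions, and Euler's formula shows that its value at
  \<open>s\<close> vanishes.

  Structure (\<open>structure_theorem\<close>). The constant term is \<open>\<mu> \<cdot> u\<close> with central,
  hence scalar, coefficients. The linear term is determined by its values \<open>\<epsilon>\<^sub>i\<^sub>a\<close> at
  \<open>r = e\<^sub>i\<close>, \<open>u = e\<^sub>a\<close>, which play the part of the matrix units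
  \<open>E\<^sub>i\<^sub>a\<close>, and since trace zero matrices of rank one span all trace zero matrices it extends
  to a representation.

  For the converse, the formulas define an action because \<open>r u\<^sup>T\<close> satisfies the bracket relation
  above. Homogeneous fields whose degrees add up to zero commute, which is why fields of degree zero may act through
  \<open>lam\<close> while all other fields act through \<open>\<mu>\<close>. A submodule of the tensor module is
  graded with equal components, and its component of degree zero is a submodule of \<open>V\<close>. An isomorphism of
  tensor modules restricts to the weight spaces at \<open>lam\<close>; it commutes with \<open>\<phi>\<close>, and the
  scalars \<open>\<mu>\<close> are recovered from fields of opposite degrees.
\<close>

section \<open>Difference operators on sequences of vectors\<close>

locale complex_space = vector_space sc
  for sc :: "complex \<Rightarrow> 'g::ab_group_add \<Rightarrow> 'g" (infixr "\<cdot>" 75)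
begin

text \<open>The polynomial \<open>P\<close> evaluated at the shift operator \<open>Y \<mapsto> (\<lambda>j. Y (j + 1))\<close>, so that products of
  polynomials act as compositions.\<close>

definition pact :: "complex poly \<Rightarrow> ('i::comm_semiring_1 \<Rightarrow> 'g) \<Rightarrow> 'i \<Rightarrow> 'g" where
  "pact P Y j = (\<Sum>i\<le>degree P. coeff P i \<cdot> Y (j + of_nat i))"

lemma pact_bound:
  assumes "degree P \<le> n"
  shows "pact P Y j = (\<Sum>i\<le>n. coeff P i \<cdot> Y (j + of_nat i))"
  unfolding pact_def using assms by (intro sum.mono_neutral_left) (auto simp: coeff_eq_0)

lemma pact_0 [simp]: "pact 0 Y j = 0"
  by (simp add: pact_def)

lemma pact_pCons [simp]: "pact (pCons a P) Y j = a \<cdot> Y j + pact P Y (j + 1)"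
proof -
  have "pact (pCons a P) Y j = (\<Sum>i\<le>Suc (degree P). coeff (pCons a P) i \<cdot> Y (j + of_nat i))"
    by (rule pact_bound) (simp add: degree_pCons_le)
  also have "\<dots> = a \<cdot> Y j + pact P Y (j + 1)"
    by (subst sum.atMost_Suc_shift) (simp add: pact_def add.assoc)
  finally show ?thesis .
qed

lemma pact_add: "pact (P + Q) Y j = pact P Y j + pact Q Y j"
proof -
  define n where "n = max (degree P) (degree Q)"
  have "degree (P + Q) \<le> n" "degree P \<le> n" "degree Q \<le> n"
    by (auto simp: n_def intro: degree_add_le)
  then show ?thesis
    by (simp add: pact_bound scale_left_distrib sum.distrib)
qed

lemma pact_smult: "pact (smult c P) Y j = c \<cdot> pact P Y j"
proof -
  have "degree (smult c P) \<le> degree P" by (rule degree_smult_le)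
  then show ?thesis
    by (simp add: pact_bound[OF order_refl] pact_bound scale_sum_right)
qed

lemma pact_mult: "pact (P * Q) Y j = pact P (pact Q Y) j"
  by (induction P arbitrary: j) (simp_all add: pact_add pact_smult)

lemma pact_fun_diff: "pact P (\<lambda>j. f j - g j) j = pact P f j - pact P g j"
  by (simp add: pact_def scale_right_diff_distrib sum_subtractf)

lemma pact_fun_scale: "pact P (\<lambda>j. c \<cdot> f j) j = c \<cdot> pact P f j"
  by (simp add: pact_def scale_sum_right mult.commute)

lemma pact_const: "pact P (\<lambda>j. x) j = poly P 1 \<cdot> x"
  by (induction P arbitrary: j) (simp_all add: scale_left_distrib)

lemma pact_shift: "pact P (\<lambda>j. Y (j + 1)) j = pact P Y (j + 1)"
  by (simp add: pact_def algebra_simps)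

text \<open>Multiplication by the index is a derivation of the shift: it commutes with the polynomial
  \<open>P\<close> in the shift up to \<open>x P'(x)\<close>.\<close>

lemma pact_index_mult:
  fixes Y :: "int \<Rightarrow> 'g"
  shows "pact P (\<lambda>j. of_int j \<cdot> Y j) j
    = of_int j \<cdot> pact P Y j + pact (pCons 0 (pderiv P)) Y j"
proof (induction P arbitrary: j)
  case 0
  then show ?case by (simp add: pact_def)
next
  case (pCons a P)
  have "pact (pderiv (pCons a P)) Y (j + 1)
      = pact P Y (j + 1) + pact (pCons 0 (pderiv P)) Y (j + 1)"
    by (simp only: pderiv_pCons pact_add)
  then show ?case
    using pCons.IH[of "j + 1"] by (simp add: scale_right_distrib scale_left_distrib mult.commute)
qed

abbreviation kills :: "complex poly \<Rightarrow> (int \<Rightarrow> 'g) \<Rightarrow> bool" where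
  "kills P Y \<equiv> \<forall>j. pact P Y j = 0"

lemma kills_mult: "kills P Y \<Longrightarrow> kills (Q * P) Y"
proof -
  assume "kills P Y"
  then have "pact P Y = (\<lambda>_. 0)" by auto
  then show ?thesis by (simp add: pact_mult pact_const)
qed

lemma kills_diff: "kills P Y \<Longrightarrow> kills Q Y \<Longrightarrow> kills (P - Q) Y"
  using pact_add[of "P - Q" Q Y] by simp

text \<open>The two hypotheses on \<open>A0\<close> and \<open>A1\<close> compare a row \<open>Y\<close> with another row \<open>Z\<close> twice, with
  a relative shift by one.  Applying \<open>P\<close> and eliminating \<open>Z\<close> leaves \<open>x P'(x)\<close> acting on the
  difference of \<open>Y\<close> and its shift, up to a constant.\<close>

lemma kills_derivative:
  assumes "\<kappa> \<noteq> 0" and P: "kills P Y" "kills P Z" "poly P 1 = 0"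
    and A0: "\<And>j. A0 j = (\<kappa> * of_int (- j)) \<cdot> (Z j - Y j - W0)" "kills P A0"
    and A1: "\<And>j. A1 j = (\<kappa> * of_int (1 - j)) \<cdot> (Z (j + 1) - Y j - W1)" "kills P A1"
  shows "kills ([:-1, 1:] ^ 2 * pderiv P) Y"
proof -
  let ?Q = "pCons 0 (pderiv P)"
  have Q0: "pact ?Q Z j - pact ?Q Y j = poly ?Q 1 \<cdot> W0" for j
  proof -
    define f where "f = (\<lambda>j. Z j - Y j - W0)"
    have Pf: "pact P f j = 0" for j
      using P by (simp add: f_def pact_fun_diff pact_const)
    have "A0 = (\<lambda>j. (- \<kappa>) \<cdot> (of_int j \<cdot> f j))"
      by (auto simp: A0 f_def)
    then have "(- \<kappa>) \<cdot> pact P (\<lambda>j. of_int j \<cdot> f j) j = 0"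
      using A0(2) by (simp only: pact_fun_scale)
    then have "pact P (\<lambda>j. of_int j \<cdot> f j) j = 0"
      using \<open>\<kappa> \<noteq> 0\<close> by simp
    then have "pact ?Q f j = 0"
      by (simp only: pact_index_mult Pf) simp
    then show ?thesis
      unfolding f_def pact_fun_diff pact_const by simp
  qed
  have Q1: "pact ?Q Z (j + 1) - pact ?Q Y j = poly ?Q 1 \<cdot> W1" for j
  proof -
    define f where "f = (\<lambda>j. Z (j + 1) - Y j - W1)"
    have Pf: "pact P f j = 0" for j
      using P by (simp add: f_def pact_fun_diff pact_const pact_shift)
    have "A1 = (\<lambda>j. \<kappa> \<cdot> (f j - of_int j \<cdot> f j))"
      by (auto simp: A1 f_def algebra_simps)
    then have "\<kappa> \<cdot> pact P (\<lambda>j. f j - of_int j \<cdot> f j) j = 0"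
      using A1(2) by (simp only: pact_fun_scale)
    then have "pact P (\<lambda>j. of_int j \<cdot> f j) j = 0"
      using \<open>\<kappa> \<noteq> 0\<close> Pf by (simp add: pact_fun_diff)
    then have "pact ?Q f j = 0"
      by (simp only: pact_index_mult Pf) simp
    then show ?thesis
      unfolding f_def pact_fun_diff pact_const pact_shift by simp
  qed
  have step: "pact ?Q Y (j + 1) - pact ?Q Y j = poly ?Q 1 \<cdot> W1 - poly ?Q 1 \<cdot> W0" for j
    using Q0[of "j + 1"] Q1[of j] by (simp add: algebra_simps)
  have "pact ([:-1, 1:] ^ 2 * ?Q) Y j = 0" for j
  proof -
    have "pact [:-1, 1:] (pact ?Q Y) = (\<lambda>j. pact ?Q Y (j + 1) - pact ?Q Y j)"
      by (auto simp del: pact_pCons simp: pact_pCons[of _ "[:1:]"] pact_pCons[of _ 0])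
    also have "\<dots> = (\<lambda>j. poly ?Q 1 \<cdot> W1 - poly ?Q 1 \<cdot> W0)"
      by (simp only: step)
    finally show ?thesis
      by (simp add: power2_eq_square pact_mult pact_const del: mult_pCons_left mult_pCons_right)
  qed
  moreover have "[:-1, 1:] ^ 2 * ?Q = pCons 0 ([:-1, 1:] ^ 2 * pderiv P)"
    by simp
  ultimately have "pact (pCons 0 ([:-1, 1:] ^ 2 * pderiv P)) Y j = 0" for j
    by (simp only:)
  then have shifted: "pact ([:-1, 1:] ^ 2 * pderiv P) Y (j + 1) = 0" for j
    by (simp only: pact_pCons) simp
  show ?thesis
    using shifted[of "_ - 1"] by (simp only: diff_add_cancel) simp
qed

text \<open>A family of rows that is closed under \<open>P \<mapsto> (x - 1)\<^sup>2 P'\<close> on annihilators is annihilated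
  by a power of \<open>x - 1\<close>: differentiating lowers the degree of the cofactor until it is constant.\<close>

lemma unipotent_annihilator:
  assumes closed: "\<And>P. (\<forall>Y\<in>R. kills P Y) \<Longrightarrow> poly P 1 = 0
      \<Longrightarrow> (\<forall>Y\<in>R. kills ([:-1, 1:] ^ 2 * pderiv P) Y)"
    and P: "P \<noteq> 0" "\<forall>Y\<in>R. kills ([:-1, 1:] ^ Suc m * P) Y"
  shows "\<forall>Y\<in>R. kills ([:-1, 1:] ^ (Suc m + 2 * degree P)) Y"
  using P
proof (induction "degree P" arbitrary: P m)
  case 0
  then obtain c where c: "P = [:c:]" "c \<noteq> 0"
    by (metis degree_eq_zeroE pCons_0_0)
  have "[:-1, 1:] ^ Suc m = smult (1 / c) ([:-1, 1:] ^ Suc m * P)"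
    using c by (simp only: mult.commute[of _ P]) simp
  then have "kills ([:-1, 1:] ^ Suc m) Y" if "Y \<in> R" for Y
  proof -
    have "pact (smult (1 / c) ([:-1, 1:] ^ Suc m * P)) Y j = 0" for j
      using 0(3) that by (simp only: pact_smult) simp
    then show ?thesis using \<open>[:-1, 1:] ^ Suc m = _\<close> by (simp only:) simp
  qed
  then show ?case using 0(1) by simp
next
  case (Suc d)
  let ?L = "[:-1, 1:] :: complex poly"
  have dP: "degree (pderiv P) = d"
    using Suc(2) by (simp add: degree_pderiv)
  have P': "pderiv P \<noteq> 0"
    using Suc(2) by (metis degree_pderiv pderiv_eq_0_iff nat.distinct(1))
  have k: "\<forall>Y\<in>R. kills (?L ^ 2 * pderiv (?L ^ Suc m * P)) Y"
    by (rule closed[OF Suc(4)]) simp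
  have ring: "x ^ 2 * (x * y * d + c * y * p) - c * x * (x * y * p) = x * (x * (x * y)) * d"
    for x y d c p :: "complex poly"
    by (simp add: algebra_simps power2_eq_square)
  have "pderiv (?L ^ Suc m) = [:of_nat (Suc m):] * ?L ^ m"
    by (subst pderiv_power_Suc) (simp add: pderiv_pCons)
  then have "pderiv (?L ^ Suc m * P) = ?L * ?L ^ m * pderiv P + [:of_nat (Suc m):] * ?L ^ m * P"
    by (simp only: pderiv_mult[of "?L ^ Suc m" P] mult.commute[of P]) (simp only: power_Suc)
  then have "?L ^ 2 * pderiv (?L ^ Suc m * P) - [:of_nat (Suc m):] * ?L * (?L ^ Suc m * P)
      = ?L ^ Suc (Suc (Suc m)) * pderiv P"
    using ring[of ?L "?L ^ m" "pderiv P" "[:of_nat (Suc m):]" P] by (simp only: power_Suc)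
  then have "\<forall>Y\<in>R. kills (?L ^ Suc (Suc (Suc m)) * pderiv P) Y"
  proof -
    assume eq: "?L ^ 2 * pderiv (?L ^ Suc m * P) - [:of_nat (Suc m):] * ?L * (?L ^ Suc m * P)
      = ?L ^ Suc (Suc (Suc m)) * pderiv P"
    have "kills (?L ^ 2 * pderiv (?L ^ Suc m * P) - [:of_nat (Suc m):] * ?L * (?L ^ Suc m * P)) Y"
      if "Y \<in> R" for Y
      by (rule kills_diff[OF bspec[OF k that] kills_mult[OF bspec[OF Suc(4) that]]])
    then show ?thesis unfolding eq by blast
  qed
  then have "\<forall>Y\<in>R. kills (?L ^ (Suc (Suc (Suc m)) + 2 * degree (pderiv P))) Y"
    using Suc(1)[of "pderiv P"] dP P' by blast
  moreover have "Suc (Suc (Suc m)) + 2 * degree (pderiv P) = Suc m + 2 * degree P"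
    using Suc(2) dP by simp
  ultimately show ?case by (simp only:)
qed


section \<open>Polynomial sequences\<close>

definition polyseq :: "nat \<Rightarrow> (int \<Rightarrow> 'g) \<Rightarrow> bool" where
  "polyseq n f \<longleftrightarrow> (\<exists>c. \<forall>k. f k = (\<Sum>m<n. of_int k ^ m \<cdot> c m))"

lemma polyseqI: "(\<And>k. f k = (\<Sum>m<n. of_int k ^ m \<cdot> c m)) \<Longrightarrow> polyseq n f"
  by (auto simp: polyseq_def)

lemma polyseq_mono:
  assumes "polyseq n f" "n \<le> n'"
  shows "polyseq n' f"
proof -
  obtain c where c: "\<And>k. f k = (\<Sum>m<n. of_int k ^ m \<cdot> c m)"
    using assms(1) by (auto simp: polyseq_def)
  have "f k = (\<Sum>m<n'. of_int k ^ m \<cdot> (if m < n then c m else 0))" for k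
    unfolding c using assms(2) by (intro sum.mono_neutral_cong_left) auto
  then show ?thesis by (rule polyseqI)
qed

lemma polyseq_add:
  assumes "polyseq n f" "polyseq n g"
  shows "polyseq n (\<lambda>k. f k + g k)"
proof -
  obtain c d where "\<And>k. f k = (\<Sum>m<n. of_int k ^ m \<cdot> c m)" "\<And>k. g k = (\<Sum>m<n. of_int k ^ m \<cdot> d m)"
    using assms unfolding polyseq_def by blast
  then have "f k + g k = (\<Sum>m<n. of_int k ^ m \<cdot> (c m + d m))" for k
    by (simp add: sum.distrib scale_right_distrib)
  then show ?thesis by (rule polyseqI)
qed

lemma polyseq_scale:
  assumes "polyseq n f"
  shows "polyseq n (\<lambda>k. a \<cdot> f k)"
proof -
  obtain c where "\<And>k. f k = (\<Sum>m<n. of_int k ^ m \<cdot> c m)"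
    using assms unfolding polyseq_def by blast
  then have "a \<cdot> f k = (\<Sum>m<n. of_int k ^ m \<cdot> (a \<cdot> c m))" for k
    by (simp add: scale_sum_right mult.commute)
  then show ?thesis by (rule polyseqI)
qed

lemma polyseq_const: "polyseq (Suc n) (\<lambda>k. x)"
  by (rule polyseqI[where c = "\<lambda>m. if m = 0 then x else 0"]) (simp add: sum.lessThan_Suc_shift del: sum.lessThan_Suc)

lemma polyseq_index_mult:
  assumes "polyseq n f"
  shows "polyseq (Suc n) (\<lambda>k. of_int k \<cdot> f k)"
proof -
  obtain c where "\<And>k. f k = (\<Sum>m<n. of_int k ^ m \<cdot> c m)"
    using assms unfolding polyseq_def by blast
  then have "of_int k \<cdot> f k = (\<Sum>m<Suc n. of_int k ^ m \<cdot> (case m of 0 \<Rightarrow> 0 | Suc m \<Rightarrow> c m))" for k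
    by (simp add: scale_sum_right sum.lessThan_Suc_shift del: sum.lessThan_Suc)
  then show ?thesis by (rule polyseqI)
qed

lemma polyseq_antidifference:
  assumes "polyseq n (\<lambda>k. f (k + 1) - f k)"
  shows "polyseq (Suc n) f"
  using assms
proof (induction n arbitrary: f)
  case 0
  then have "f (k + 1) = f k" for k
    by (simp add: polyseq_def)
  then have "f k = f 0" for k
    by (induction k rule: int_induct[where k = 0]) (simp, simp, metis diff_add_cancel)
  then have "f = (\<lambda>k. f 0)" by blast
  then show ?case using polyseq_const[of 0 "f 0"] by metis
next
  case (Suc n)
  obtain c where c: "\<And>k. f (k + 1) - f k = (\<Sum>m<Suc n. of_int k ^ m \<cdot> c m)"
    using Suc(2) by (auto simp: polyseq_def)
  define x where "x = (1 / of_nat (Suc n)) \<cdot> c n"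
  have cn: "c n = of_nat (Suc n) \<cdot> x"
    by (simp add: x_def del: of_nat_Suc)
  define g where "g = (\<lambda>k. f k - of_int k ^ Suc n \<cdot> x)"
  have binom: "(of_int (k + 1) :: complex) ^ Suc n - of_int k ^ Suc n
      = (\<Sum>i<n. of_nat (Suc n choose i) * of_int k ^ i) + of_nat (Suc n) * of_int k ^ n" for k
  proof -
    have "(of_int (k + 1) :: complex) ^ Suc n
        = (\<Sum>i\<le>Suc n. of_nat (Suc n choose i) * of_int k ^ i)"
      using binomial_ring[of "of_int k :: complex" 1 "Suc n"] by (simp add: add.commute)
    then show ?thesis
      by (simp add: lessThan_Suc_atMost[symmetric] del: power_Suc binomial_Suc_Suc)
  qed
  have "g (k + 1) - g k = (\<Sum>m<n. of_int k ^ m \<cdot> (c m - of_nat (Suc n choose m) \<cdot> x))" for k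
  proof -
    have "g (k + 1) - g k
        = (f (k + 1) - f k) - (of_int (k + 1) ^ Suc n - of_int k ^ Suc n) \<cdot> x"
      by (simp add: g_def scale_left_diff_distrib algebra_simps del: power_Suc)
    also have "\<dots> = (\<Sum>m<n. of_int k ^ m \<cdot> c m) - (\<Sum>i<n. of_nat (Suc n choose i) * of_int k ^ i) \<cdot> x"
      unfolding c binom
      by (simp add: scale_left_distrib cn mult.commute del: of_nat_Suc)
    also have "\<dots> = (\<Sum>m<n. of_int k ^ m \<cdot> (c m - of_nat (Suc n choose m) \<cdot> x))"
      by (simp add: scale_sum_left scale_right_diff_distrib sum_subtractf mult.commute del: binomial_Suc_Suc)
    finally show ?thesis .
  qed
  then have "polyseq n (\<lambda>k. g (k + 1) - g k)"
    by (rule polyseqI)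
  then have "polyseq (Suc n) g"
    by (rule Suc(1))
  then have g: "polyseq (Suc (Suc n)) g"
    by (rule polyseq_mono) simp
  have "polyseq (Suc (Suc n)) (\<lambda>k. of_int k ^ Suc n \<cdot> x)"
    by (rule polyseqI[where c = "\<lambda>m. if m = Suc n then x else 0"])
       (simp add: if_distrib[of "\<lambda>y. _ \<cdot> y"] cong: if_cong)
  from polyseq_add[OF g this] show ?case
    by (simp add: g_def)
qed

text \<open>The factor \<open>x - 1\<close> acts as the difference operator, and each antidifference raises the degree by one.\<close>

lemma kills_unipotent_polyseq: "kills ([:-1, 1:] ^ n) Y \<Longrightarrow> polyseq n Y"
proof (induction n arbitrary: Y)
  case 0
  then have "Y j = 0" for j by (simp add: one_pCons)
  then show ?case by (simp add: polyseq_def)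
next
  case (Suc n)
  have "pact [:-1, 1:] Y = (\<lambda>j. Y (j + 1) - Y j)"
    by auto
  then have "kills ([:-1, 1:] ^ n) (\<lambda>j. Y (j + 1) - Y j)"
    using Suc(2) pact_mult[of "[:-1, 1:] ^ n" "[:-1, 1:]" Y]
    by (metis power_Suc2)
  then show ?case
    using Suc(1) polyseq_antidifference by blast
qed

text \<open>Doubling the argument multiplies the coefficients of a polynomial by distinct powers of two,
  so \<open>f(2k) - 2\<^sup>n f(k)\<close> removes the top coefficient without leaving the subspace.\<close>

lemma coeffs_in_subspace:
  assumes "subspace S" "\<And>k::nat. k \<ge> 1 \<Longrightarrow> (\<Sum>m<n. of_nat k ^ m \<cdot> c m) \<in> S" "m < n"
  shows "c m \<in> S"
  using assms(2,3)
proof (induction n arbitrary: c m)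
  case 0
  then show ?case by simp
next
  case (Suc n)
  have below: "c m \<in> S" if "m < n" for m
  proof -
    have "(\<Sum>m<n. of_nat k ^ m \<cdot> ((2 ^ m - 2 ^ n) \<cdot> c m)) \<in> S" if "k \<ge> 1" for k
    proof -
      have "(\<Sum>m<Suc n. of_nat (2 * k) ^ m \<cdot> c m) - 2 ^ n \<cdot> (\<Sum>m<Suc n. of_nat k ^ m \<cdot> c m) \<in> S"
        using that by (intro subspace_diff[OF assms(1)] subspace_scale[OF assms(1)] Suc(2)) simp_all
      also have "(\<Sum>m<Suc n. of_nat (2 * k) ^ m \<cdot> c m) - 2 ^ n \<cdot> (\<Sum>m<Suc n. of_nat k ^ m \<cdot> c m)
          = (\<Sum>m<n. of_nat k ^ m \<cdot> ((2 ^ m - 2 ^ n) \<cdot> c m))"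
        by (simp add: scale_sum_right scale_right_distrib sum_subtractf power_mult_distrib
            scale_left_diff_distrib scale_right_diff_distrib right_diff_distrib mult.commute)
      finally show ?thesis .
    qed
    then have *: "(2 ^ m - 2 ^ n) \<cdot> c m \<in> S"
      using Suc(1)[of "\<lambda>m. (2 ^ m - 2 ^ n) \<cdot> c m" m] \<open>m < n\<close> by blast
    have "(2::complex) ^ m - 2 ^ n \<noteq> 0"
    proof
      assume "(2::complex) ^ m - 2 ^ n = 0"
      then have "(of_nat (2 ^ m) :: complex) = of_nat (2 ^ n)" by simp
      then have "(2::nat) ^ m = 2 ^ n" by (simp only: of_nat_eq_iff)
      then show False using \<open>m < n\<close> by simp
    qed
    then show ?thesis
      using subspace_scale[OF assms(1) *, of "1 / (2 ^ m - 2 ^ n)"] by simp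
  qed
  show ?case
  proof (cases "m < n")
    case False
    then have "m = n" using Suc(3) by simp
    have "(\<Sum>m<n. c m) \<in> S"
      using below by (intro subspace_sum[OF assms(1)]) auto
    from subspace_diff[OF assms(1) Suc(2)[of 1] this]
    have "(\<Sum>m<Suc n. of_nat 1 ^ m \<cdot> c m) - (\<Sum>m<n. c m) \<in> S"
      by simp
    then show ?thesis using \<open>m = n\<close> by simp
  qed (rule below)
qed

lemma grouped_coeffs_in_subspace:
  assumes S: "subspace S" and "finite F"
    and in_S: "\<And>k::nat. k \<ge> 1 \<Longrightarrow> (\<Sum>x\<in>F. of_nat k ^ e x \<cdot> c x) \<in> S"
  shows "(\<Sum>x\<in>{x\<in>F. e x = M}. c x) \<in> S"
proof -
  define n where "n = Suc (Max (insert M (e ` F)))"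
  have lt: "M < n" "\<And>x. x \<in> F \<Longrightarrow> e x < n"
    using \<open>finite F\<close> by (auto simp: n_def less_Suc_eq_le)
  have "(\<Sum>m<n. of_nat k ^ m \<cdot> (\<Sum>x\<in>{x\<in>F. e x = m}. c x)) \<in> S" if "k \<ge> 1" for k :: nat
  proof -
    have "(\<Sum>m<n. of_nat k ^ m \<cdot> (\<Sum>x\<in>{x\<in>F. e x = m}. c x))
        = (\<Sum>m<n. \<Sum>x\<in>{x\<in>F. e x = m}. of_nat k ^ e x \<cdot> c x)"
      by (simp add: scale_sum_right)
    also have "\<dots> = (\<Sum>x\<in>F. of_nat k ^ e x \<cdot> c x)"
      using lt \<open>finite F\<close> by (intro sum.group) auto
    finally show ?thesis using in_S[OF that] by (simp only:)
  qed
  then show ?thesis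
    by (rule coeffs_in_subspace[OF S _ lt(1)])
qed

text \<open>Comparison of coefficients for polynomials that are given by families of monomials in which exponents may repeat.\<close>

lemma coeffs_compare:
  assumes "finite F" "finite G"
    and eq: "\<And>k::nat. k \<ge> 1 \<Longrightarrow>
      (\<Sum>x\<in>F. of_nat k ^ e x \<cdot> c x) = (\<Sum>y\<in>G. of_nat k ^ f y \<cdot> d y)"
  shows "(\<Sum>x\<in>{x\<in>F. e x = M}. c x) = (\<Sum>y\<in>{y\<in>G. f y = M}. d y)"
proof -
  let ?e = "case_sum e f" and ?c = "case_sum c (\<lambda>y. - d y)"
  have "(\<Sum>x\<in>F <+> G. of_nat k ^ ?e x \<cdot> ?c x) \<in> {0}" if "k \<ge> 1" for k :: nat
    using assms(1,2) eq[OF that] by (simp add: sum.Plus sum_negf)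
  from grouped_coeffs_in_subspace[OF subspace_single_0 _ this, of M] assms(1,2)
  have "(\<Sum>x\<in>{x\<in>F <+> G. ?e x = M}. ?c x) = 0" by simp
  moreover have "{x\<in>F <+> G. ?e x = M} = {x\<in>F. e x = M} <+> {y\<in>G. f y = M}"
    by auto
  ultimately show ?thesis
    using assms(1,2) by (simp add: sum.Plus sum_negf)
qed

end

section \<open>The plane relation\<close>

text \<open>Indexing the relation by positions rather than by vectors covers families with repetitions.\<close>

lemma (in vector_space) linear_relation:
  assumes "finite B" "\<And>k::nat. f k \<in> span B"
  obtains \<beta> k where "k \<le> card B" "\<beta> k \<noteq> 0" "(\<Sum>k\<le>card B. scale (\<beta> k) (f k)) = 0"
proof (cases "inj_on f {..card B}")
  case False
  then obtain k l where kl: "k \<le> card B" "l \<le> card B" "k \<noteq> l" "f k = f l"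
    by (auto simp: inj_on_def)
  define \<beta> where "\<beta> i = (if i = k then 1 else if i = l then - 1 else 0 :: 'a)" for i
  have "(\<Sum>i\<le>card B. scale (\<beta> i) (f i)) = (\<Sum>i\<in>{k, l}. scale (\<beta> i) (f i))"
    using kl by (intro sum.mono_neutral_right) (auto simp: \<beta>_def)
  also have "\<dots> = 0" using kl by (simp add: \<beta>_def)
  finally show thesis using that[of k \<beta>] kl by (simp add: \<beta>_def)
next
  case True
  let ?S = "f ` {..card B}"
  have "card ?S = Suc (card B)"
    by (simp add: card_image True)
  then have "dependent ?S"
    using independent_span_bound[OF assms(1), of ?S] assms(2) by auto
  then obtain u where u: "\<exists>v\<in>?S. u v \<noteq> 0" "(\<Sum>v\<in>?S. scale (u v) v) = 0"
    by (auto simp: dependent_finite)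
  then obtain k where "k \<le> card B" "u (f k) \<noteq> 0" by auto
  with that[of k "\<lambda>k. u (f k)"] u(2) show thesis
    by (simp add: sum.reindex[OF True])
qed

locale bracket_space = complex_space sc
  for sc :: "complex \<Rightarrow> 'g::ab_group_add \<Rightarrow> 'g" (infixr "\<cdot>" 75) +
  fixes br :: "'g \<Rightarrow> 'g \<Rightarrow> 'g"
  assumes br_add_left: "br (x + y) z = br x z + br y z"
    and br_scale_left: "br (c \<cdot> x) z = c \<cdot> br x z"
    and br_antisym: "br y x = - br x y"
begin

lemma br_add_right: "br x (y + z) = br x y + br x z"
  using br_add_left[of y z x] br_antisym[of x] by (metis minus_add_distrib)

lemma br_scale_right: "br x (c \<cdot> z) = c \<cdot> br x z"
  using br_scale_left[of c z x] br_antisym[of x] by (metis scale_minus_right)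

lemma br_zero [simp]: "br 0 x = 0" "br x 0 = 0"
  using br_scale_left[of 0 0 x] br_scale_right[of x 0 0] by simp_all

lemma br_minus: "br (- x) y = - br x y" "br x (- y) = - br x y"
  using br_scale_left[of "-1" x y] br_scale_right[of x "-1" y] by simp_all

lemma br_diff: "br (x - y) z = br x z - br y z" "br x (y - z) = br x y - br x z"
  using br_add_left[of x "- y" z] br_add_right[of x y "- z"] by (simp_all add: br_minus)

lemma br_sum: "br (sum f A) x = (\<Sum>a\<in>A. br (f a) x)" "br x (sum f A) = (\<Sum>a\<in>A. br x (f a))"
  by (induction A rule: infinite_finite_induct) (simp_all add: br_add_left br_add_right)

lemma pact_br: "pact P (\<lambda>j. br (Y j) x) j = br (pact P Y j) x"
  by (simp add: pact_def br_sum br_scale_left)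

lemma polyseq_br:
  assumes "polyseq n f"
  shows "polyseq n (\<lambda>k. br x (f k))"
proof -
  obtain c where "\<And>k. f k = (\<Sum>m<n. of_int k ^ m \<cdot> c m)"
    using assms unfolding polyseq_def by blast
  then have "br x (f k) = (\<Sum>m<n. of_int k ^ m \<cdot> br x (c m))" for k
    by (simp add: br_sum br_scale_right)
  then show ?thesis by (rule polyseqI)
qed

lemma pact_sum: "finite A \<Longrightarrow> pact (\<Sum>a\<in>A. P a) Y j = (\<Sum>a\<in>A. pact (P a) Y j)"
  by (induction A rule: finite_induct) (simp_all add: pact_add)

lemma pact_monom: "pact (monom 1 k) Y j = Y (j + of_nat k)"
proof -
  have "pact (monom 1 k) Y j = (\<Sum>i\<le>k. coeff (monom 1 k) i \<cdot> Y (j + of_nat i))"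
    by (rule pact_bound) (rule degree_monom_le)
  also have "\<dots> = (\<Sum>i\<le>k. if i = k then Y (j + of_nat k) else 0)"
    by (intro sum.cong) auto
  also have "\<dots> = Y (j + of_nat k)" by simp
  finally show ?thesis .
qed

end

text \<open>These are the relations of the Hamiltonian fields of the functions \<open>t\<^sup>p - log t\<^sup>p\<close> on a symplectic torus of dimension two.  The
  functions are critical at \<open>t = 1\<close>, so the fields vanish there.\<close>

locale plane_system = bracket_space sc br
  for sc :: "complex \<Rightarrow> 'g::ab_group_add \<Rightarrow> 'g" (infixr "\<cdot>" 75) and br +
  fixes G :: "int \<Rightarrow> int \<Rightarrow> 'g" and \<kappa> :: complex and B :: "'g set"
  assumes kappa: "\<kappa> \<noteq> 0"
    and rel: "br (G i j) (G i' j') = (\<kappa> * of_int (i * j' - j * i')) \<cdot> (G (i + i') (j + j') - G i j - G i' j')"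
    and fin: "finite B" and in_span: "G i j \<in> span B"
begin

text \<open>A linear relation between the vectors on the ray \<open>i = 0\<close>, bracketed with a row, gives an
  annihilator that is common to all rows; \<open>kills_derivative\<close> then applies to the rows
  \<open>i\<close> and \<open>2i\<close>.\<close>

lemma row_polyseq:
  assumes "i \<noteq> 0"
  shows "polyseq (2 * card B + 3) (G i)"
proof -
  let ?L = "[:-1, 1:] :: complex poly"
  define R where "R = {G i | i. i \<noteq> 0}"
  obtain \<beta> k0 where \<beta>: "k0 \<le> card B" "\<beta> k0 \<noteq> 0"
    "(\<Sum>k\<le>card B. \<beta> k \<cdot> G 0 (int (Suc k))) = 0"
    using linear_relation[OF fin in_span, of "\<lambda>k. 0" "\<lambda>k. int (Suc k)"] by metis
  \<comment> \<open>The coefficients are \<open>\<beta>\<^sub>k\<close> times the factor \<open>k + 1\<close> of the determinant.  The relation runs over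
    positive indices, so this factor does not vanish and \<open>P\<close> is not zero.\<close>
  define P where "P = (\<Sum>k\<le>card B. smult (\<beta> k * of_nat (Suc k)) (monom 1 (Suc k) - 1))"
  define C where "C = (\<Sum>k\<le>card B. (\<beta> k * of_nat (Suc k)) \<cdot> G 0 (int (Suc k)))"
  have degP: "degree P \<le> Suc (card B)"
    unfolding P_def
    by (intro degree_sum_le degree_diff_le order_trans[OF degree_smult_le])
       (auto intro: order_trans[OF degree_monom_le])
  have "coeff P (Suc k0) = (\<Sum>k\<le>card B. if k = k0 then \<beta> k0 * of_nat (Suc k0) else 0)"
    unfolding P_def coeff_sum by (intro sum.cong) (auto simp: coeff_1 simp del: of_nat_Suc)
  also have "\<dots> \<noteq> 0" using \<beta>(1,2) by (simp del: of_nat_Suc)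
  finally have "P \<noteq> 0" by auto
  have PY: "pact P (G i) j = C" if "i \<noteq> 0" for i j
  proof -
    have "0 = br (\<Sum>k\<le>card B. \<beta> k \<cdot> G 0 (int (Suc k))) (G i j)"
      by (simp only: \<beta>(3) br_zero)
    also have "\<dots> = (\<Sum>k\<le>card B. (- (\<kappa> * of_int i)) \<cdot>
        (\<beta> k * of_nat (Suc k)) \<cdot> (G i (j + int (Suc k)) - G i j - G 0 (int (Suc k))))"
      unfolding br_sum br_scale_left rel by (intro sum.cong) (simp_all add: scale_right_diff_distrib scale_right_distrib mult_ac add_ac)
    also have "\<dots> = (- (\<kappa> * of_int i)) \<cdot> (pact P (G i) j - C)"
    proof -
      have "pact P (G i) j = (\<Sum>k\<le>card B. (\<beta> k * of_nat (Suc k)) \<cdot> (G i (j + int (Suc k)) - G i j))"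
        unfolding P_def using pact_add[of "monom 1 _ - 1" 1 "G i" j] pact_const
        by (simp add: pact_sum pact_smult pact_monom eq_diff_eq one_pCons del: of_nat_Suc)
      then show ?thesis
        by (simp only: C_def scale_sum_right sum_subtractf scale_right_diff_distrib)
    qed
    finally have "pact P (G i) j - C = 0"
      using kappa that by simp
    then show ?thesis by simp
  qed
  \<comment> \<open>The value \<open>C\<close> does not depend on the row or on \<open>j\<close>, so \<open>x - 1\<close> removes it.\<close>
  have start: "\<forall>Y\<in>R. kills (?L ^ Suc 0 * P) Y"
  proof -
    have "pact (?L * P) (G i) j = 0" if "i \<noteq> 0" for i j
      by (simp add: pact_mult PY[OF that] del: mult_pCons_left)
    then show ?thesis unfolding R_def by (auto simp del: mult_pCons_left)
  qed
  have closed: "\<forall>Y\<in>R. kills (?L ^ 2 * pderiv P) Y"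
    if "\<forall>Y\<in>R. kills P Y" "poly P 1 = 0" for P
  proof
    fix Y assume "Y \<in> R"
    then obtain i where i: "i \<noteq> 0" "Y = G i" by (auto simp: R_def)
    have "i + i \<noteq> 0" using i(1) by simp
    then have Y: "kills P (G i)" and Z: "kills P (G (i + i))"
      using that(1) i(1) unfolding R_def by blast+
    have k: "kills P (\<lambda>j. br (G i j) x)" for x
      using Y by (simp add: pact_br)
    show "kills (?L ^ 2 * pderiv P) Y"
      unfolding i(2)
    proof (rule kills_derivative[OF _ Y Z that(2) _ k _ k])
      show "\<kappa> * of_int i \<noteq> 0" using kappa i by simp
      show "br (G i j) (G i 0) = (\<kappa> * of_int i * of_int (- j)) \<cdot> (G (i + i) j - G i j - G i 0)" for j
        by (simp add: rel mult_ac)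
      show "br (G i j) (G i 1) = (\<kappa> * of_int i * of_int (1 - j)) \<cdot> (G (i + i) (j + 1) - G i j - G i 1)" for j
        by (simp add: rel algebra_simps)
    qed
  qed
  have "\<forall>Y\<in>R. kills (?L ^ (Suc 0 + 2 * degree P)) Y"
    by (rule unipotent_annihilator[OF closed \<open>P \<noteq> 0\<close> start])
  then have "polyseq (Suc 0 + 2 * degree P) (G i)"
    using assms by (intro kills_unipotent_polyseq) (auto simp: R_def)
  then show ?thesis
    by (rule polyseq_mono) (use degP in simp)
qed

text \<open>The ray itself is reached as the sum of two rows on opposite sides of it.\<close>

lemma ray_polynomial:
  obtains c where "\<And>j. j \<noteq> 0 \<Longrightarrow> G 0 j = (\<Sum>m<2 * card B + 3. of_int j ^ m \<cdot> c m)"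
proof -
  let ?n = "2 * card B + 3"
  have row: "polyseq ?n (G (- 1))"
    by (rule row_polyseq) simp
  \<comment> \<open>The bracket of \<open>G(1, 0)\<close> and \<open>G(-1, j)\<close> is \<open>\<kappa> j (G(0, j) - G(1, 0) - G(-1, j))\<close>.\<close>
  have "of_int j \<cdot> G 0 j = (of_int j \<cdot> G 1 0 + of_int j \<cdot> G (- 1) j) + (1 / \<kappa>) \<cdot> br (G 1 0) (G (- 1) j)" for j
    using kappa by (simp add: rel scale_right_diff_distrib)
  moreover have "polyseq (Suc ?n)
      (\<lambda>j. (of_int j \<cdot> G 1 0 + of_int j \<cdot> G (- 1) j) + (1 / \<kappa>) \<cdot> br (G 1 0) (G (- 1) j))"
  proof -
    have 1: "polyseq ?n (\<lambda>j. G 1 0)" 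
      using polyseq_const[of "?n - 1"] by (simp add: numeral_eq_Suc)
    have 2: "polyseq (Suc ?n) (\<lambda>j. (1 / \<kappa>) \<cdot> br (G 1 0) (G (- 1) j))"
      by (rule polyseq_mono[OF polyseq_scale[OF polyseq_br[OF row]]]) simp
    show ?thesis
      by (rule polyseq_add[OF polyseq_add[OF polyseq_index_mult[OF 1] polyseq_index_mult[OF row]] 2])
  qed
  ultimately have "polyseq (Suc ?n) (\<lambda>j. of_int j \<cdot> G 0 j)"
    by (simp only:)
  then obtain c where c: "\<And>j. of_int j \<cdot> G 0 j = (\<Sum>m<Suc ?n. of_int j ^ m \<cdot> c m)"
    unfolding polyseq_def by blast
  have c': "of_int j \<cdot> G 0 j = c 0 + of_int j \<cdot> (\<Sum>m<?n. of_int j ^ m \<cdot> c (Suc m))" for j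
    unfolding c sum.lessThan_Suc_shift by (simp add: scale_sum_right)
  have "c 0 = 0" using c'[of 0] by simp
  show thesis
  proof
    fix j :: int assume "j \<noteq> 0"
    then have j: "(of_int j :: complex) \<noteq> 0" by simp
    have "of_int j \<cdot> G 0 j = of_int j \<cdot> (\<Sum>m<?n. of_int j ^ m \<cdot> c (Suc m))"
      using c'[of j] \<open>c 0 = 0\<close> by simp
    then show "G 0 j = (\<Sum>m<?n. of_int j ^ m \<cdot> c (Suc m))"
      using j by (simp only: scale_cancel_left) simp
  qed
qed

end

section \<open>The Lie algebra of the isotropy fields\<close>

definition dot :: "complex ^ 'n \<Rightarrow> int ^ 'n::finite \<Rightarrow> complex" where
  "dot u r = (\<Sum>a\<in>UNIV. u $ a * of_int (r $ a))"

lemma dot_add: "dot (u + v) r = dot u r + dot v r" "dot u (r + s) = dot u r + dot u s"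
  by (simp_all add: dot_def algebra_simps sum.distrib)

lemma dot_diff: "dot (u - v) r = dot u r - dot v r" "dot u (r - s) = dot u r - dot u s"
  by (simp_all add: dot_def algebra_simps sum_subtractf)

lemma dot_scale: "dot (c *s u) r = c * dot u r" "dot u (k *s r) = of_int k * dot u r"
  by (simp_all add: dot_def sum_distrib_left mult_ac)

lemma dot_zero [simp]: "dot 0 r = 0" "dot u 0 = 0"
  by (simp_all add: dot_def)

lemma dot_axis [simp]: "dot (axis a c) r = c * of_int (r $ a)" "dot u (axis a k) = u $ a * of_int k"
proof -
  have "dot (axis a c) r = (\<Sum>b\<in>UNIV. if b = a then c * of_int (r $ a) else 0)"
    unfolding dot_def by (intro sum.cong) (auto simp: axis_def)
  then show "dot (axis a c) r = c * of_int (r $ a)" by simp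
  have "dot u (axis a k) = (\<Sum>b\<in>UNIV. if b = a then u $ a * of_int k else 0)"
    unfolding dot_def by (intro sum.cong) (auto simp: axis_def)
  then show "dot u (axis a k) = u $ a * of_int k" by simp
qed

lemma dot_minus: "dot (- u) r = - dot u r"
  by (simp add: dot_def sum_negf)

lemmas dot_simps = dot_add dot_diff dot_scale dot_minus

lemma axis_component [simp]: "axis i x $ j = (if j = i then x else 0)"
  by (simp add: axis_def)

text \<open>The pairs for which \<open>t\<^sup>r (u \<cdot> d)\<close> is divergence free.  For \<open>r = 0\<close> the field \<open>(t\<^sup>r - 1) (u \<cdot> d)\<close> is zero, so only
  \<open>u = 0\<close> is admitted; this keeps the operators \<open>T(r, u)\<close> apart from the degree derivations.\<close>

definition adm :: "int ^ 'n::finite \<Rightarrow> complex ^ 'n \<Rightarrow> bool" where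
  "adm r u \<longleftrightarrow> dot u r = 0 \<and> (r = 0 \<longrightarrow> u = 0)"

lemma adm_0 [simp]: "adm r 0" by (simp add: adm_def)

lemma adm_add: "adm r u \<Longrightarrow> adm r v \<Longrightarrow> adm r (u + v)"
  by (simp add: adm_def dot_simps)

lemma adm_scale: "adm r u \<Longrightarrow> adm r (c *s u)"
  by (auto simp: adm_def dot_simps)

lemma vector_scale_eq_0: "(k::int) *s (r :: int ^ 'n) = 0 \<longleftrightarrow> k = 0 \<or> r = 0"
  by (auto simp: vec_eq_iff)

lemma adm_scale_lattice: "adm r u \<Longrightarrow> k \<noteq> 0 \<Longrightarrow> adm (k *s r) u"
  by (auto simp: adm_def dot_simps vector_scale_eq_0)

lemma other_coordinate:
  assumes "dot v s = 0" "s \<noteq> 0" "v $ i \<noteq> 0"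
  obtains j where "j \<noteq> i" "s $ j \<noteq> 0"
proof -
  have "\<exists>j. j \<noteq> i \<and> s $ j \<noteq> 0"
  proof (rule ccontr)
    assume no: "\<not> ?thesis"
    then have "dot v s = (\<Sum>a\<in>UNIV. if a = i then v $ i * of_int (s $ i) else 0)"
      unfolding dot_def by (intro sum.cong) auto
    then have "v $ i * of_int (s $ i) = 0" using assms(1) by simp
    then have "s $ i = 0" using assms(3) by simp
    then have "s = 0" using no by (metis vec_eq_iff zero_index)
    then show False using assms(2) by simp
  qed
  then show thesis using that by blast
qed

text \<open>Every nonzero \<open>v\<close> orthogonal to \<open>s\<close> belongs to a plane on which the bracket is the
  Poisson bracket of a symplectic form.\<close>

lemma companion:
  assumes "adm s v" "v \<noteq> 0"
  obtains r a c where "dot a r = 0" "dot v r = c" "dot a s = - c" "c \<noteq> 0"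
proof -
  have s: "dot v s = 0" "s \<noteq> 0" using assms by (auto simp: adm_def)
  obtain i where i: "v $ i \<noteq> 0" using assms(2) by (auto simp: vec_eq_iff)
  obtain j where j: "j \<noteq> i" "s $ j \<noteq> 0"
    using other_coordinate[OF s i] by blast
  show thesis
    by (rule that[of "axis j (- (v $ i) / of_int (s $ j))" "axis i 1" "v $ i"])
       (use i j in simp_all)
qed

text \<open>The operators \<open>T(r, u)\<close> satisfy the relations of the fields \<open>(t\<^sup>r - 1) (u \<cdot> d)\<close>.  The
  last two assumptions are the consequences of irreducibility that are used: a central commutator vanishes, and an
  abelian ideal is central.\<close>

locale torus_lie = bracket_space sc br
  for sc :: "complex \<Rightarrow> 'g::ab_group_add \<Rightarrow> 'g" (infixr "\<cdot>" 75) and br +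
  fixes T :: "int ^ 'n::finite \<Rightarrow> complex ^ 'n \<Rightarrow> 'g"
  assumes jacobi: "br x (br y z) = br (br x y) z + br y (br x z)"
    and T_add: "adm r u \<Longrightarrow> adm r v \<Longrightarrow> T r (u + v) = T r u + T r v"
    and T_scale: "adm r u \<Longrightarrow> T r (c *s u) = c \<cdot> T r u"
    and T_br: "adm r u \<Longrightarrow> adm s v \<Longrightarrow>
      br (T r u) (T s v) = T (r + s) (dot u s *s v - dot v r *s u) - dot u s \<cdot> T s v + dot v r \<cdot> T r u"
    and finite_span: "\<exists>B. finite B \<and> (\<forall>r u. adm r u \<longrightarrow> T r u \<in> span B)"
    and central_commutator: "adm r u \<Longrightarrow> (\<And>q w. adm q w \<Longrightarrow> br z (T q w) = 0) \<Longrightarrow> z = br (T r u) y \<Longrightarrow> z = 0"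
    and abelian_ideal: "subspace Z \<Longrightarrow> (\<And>z z'. z \<in> Z \<Longrightarrow> z' \<in> Z \<Longrightarrow> br z z' = 0) \<Longrightarrow>
      (\<And>q w z. adm q w \<Longrightarrow> z \<in> Z \<Longrightarrow> br (T q w) z \<in> Z) \<Longrightarrow> adm r u \<Longrightarrow> z \<in> Z \<Longrightarrow> br (T r u) z = 0"
begin

lemma T_zero [simp]: "T r 0 = 0"
  using T_scale[of r 0 0] by simp

lemma plane_adm:
  assumes "dot v s = 0" "dot a r = 0" "dot v r = c" "dot a s = - c" "c \<noteq> 0"
  shows "adm (i *s r + j *s s) (of_int i *s a + of_int j *s v)"
proof -
  have "i = 0 \<and> j = 0" if "i *s r + j *s s = 0"
  proof -
    have "dot v (i *s r + j *s s) = of_int i * c" "dot a (i *s r + j *s s) = of_int j * (- c)"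
      using assms by (simp_all add: dot_simps)
    from this[unfolded that] show ?thesis using \<open>c \<noteq> 0\<close> by simp
  qed
  moreover have "dot (of_int i *s a + of_int j *s v) (i *s r + j *s s) = 0"
    using assms by (simp add: dot_simps)
  ultimately show ?thesis by (auto simp: adm_def)
qed

lemma plane_system_T:
  assumes pl: "dot v s = 0" "dot a r = 0" "dot v r = c" "dot a s = - c" "c \<noteq> 0"
    and B: "finite B" "\<And>r u. adm r u \<Longrightarrow> T r u \<in> span B"
  shows "plane_system sc br (\<lambda>i j. T (i *s r + j *s s) (of_int i *s a + of_int j *s v)) (- c) B"
proof
  note ad = plane_adm[OF pl]
  show "- c \<noteq> 0" using pl(5) by simp
  show "finite B" by (rule B(1))
  fix i j :: int
  show "T (i *s r + j *s s) (of_int i *s a + of_int j *s v) \<in> span B"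
    by (rule B(2)[OF ad])
  fix i' j' :: int
  let ?\<kappa> = "- c * of_int (i * j' - j * i')"
  let ?p = "i *s r + j *s s" and ?q = "i' *s r + j' *s s"
  let ?u = "of_int i *s a + of_int j *s v" and ?w = "of_int i' *s a + of_int j' *s v"
  have d: "dot ?u ?q = ?\<kappa>" "dot ?w ?p = - ?\<kappa>"
    using pl by (simp_all add: dot_simps algebra_simps)
  have e: "?\<kappa> *s ?w - (- ?\<kappa>) *s ?u = ?\<kappa> *s (of_int (i + i') *s a + of_int (j + j') *s v)"
    by (simp add: vec_eq_iff algebra_simps)
  have pq: "?p + ?q = (i + i') *s r + (j + j') *s s"
    by (simp add: vec_eq_iff algebra_simps)
  show "br (T ?p ?u) (T ?q ?w) = ?\<kappa> \<cdot> (T ((i + i') *s r + (j + j') *s s)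
      (of_int (i + i') *s a + of_int (j + j') *s v) - T ?p ?u - T ?q ?w)"
    unfolding T_br[OF ad ad] d e pq T_scale[OF ad]
    by (simp only: scale_right_diff_distrib scale_minus_left) simp
qed

lemma ray_coefficients:
  obtains n and H :: "int ^ 'n \<Rightarrow> complex ^ 'n \<Rightarrow> nat \<Rightarrow> 'g" and B where
    "finite B" "\<And>r u. adm r u \<Longrightarrow> T r u \<in> span B" "n = 2 * card B + 3"
    "\<And>s v k. adm s v \<Longrightarrow> v \<noteq> 0 \<Longrightarrow> k \<noteq> 0 \<Longrightarrow>
      of_int k \<cdot> T (k *s s) v = (\<Sum>m<n. of_int k ^ m \<cdot> H s v m)"
proof -
  obtain B where B: "finite B" "\<And>r u. adm r u \<Longrightarrow> T r u \<in> span B"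
    using finite_span by blast
  let ?n = "2 * card B + 3"
  have "\<exists>H. \<forall>k. k \<noteq> 0 \<longrightarrow> of_int k \<cdot> T (k *s s) v = (\<Sum>m<?n. of_int k ^ m \<cdot> H m)"
    if sv: "adm s v" "v \<noteq> 0" for s v
  proof -
    obtain r a c where pl: "dot a r = 0" "dot v r = c" "dot a s = - c" "c \<noteq> 0"
      using companion[OF sv] by blast
    have "dot v s = 0" using sv by (simp add: adm_def)
    then interpret plane_system sc br "\<lambda>i j. T (i *s r + j *s s) (of_int i *s a + of_int j *s v)" "- c" B
      by (rule plane_system_T[OF _ pl B])
    obtain H where H: "\<And>j. j \<noteq> 0 \<Longrightarrow>
        T (0 *s r + j *s s) (of_int 0 *s a + of_int j *s v) = (\<Sum>m<?n. of_int j ^ m \<cdot> H m)"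
      by (rule ray_polynomial) blast
    have "of_int j \<cdot> T (j *s s) v = (\<Sum>m<?n. of_int j ^ m \<cdot> H m)" if "j \<noteq> 0" for j
      using H[OF that] T_scale[OF adm_scale_lattice[OF sv(1) that]] by simp
    then show ?thesis by blast
  qed
  then obtain H where "\<And>s v k. adm s v \<Longrightarrow> v \<noteq> 0 \<Longrightarrow> k \<noteq> 0 \<Longrightarrow>
      of_int k \<cdot> T (k *s s) v = (\<Sum>m<?n. of_int k ^ m \<cdot> H s v m)"
    by metis
  with B show thesis by (intro that) auto
qed

text \<open>In the bracket of \<open>k T(k s, v)\<close> with \<open>T(r, a)\<close> the plane relation has a factor \<open>k\<close>, and the row through
  \<open>(r, a)\<close> has the value \<open>T(r, a)\<close> at zero, so its constant term cancels.  The claims are the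
  coefficients of \<open>k\<^sup>0\<close> and \<open>k\<^sup>1\<close>.\<close>

lemma low_coefficient_brackets:
  assumes B: "finite B" "\<And>r u. adm r u \<Longrightarrow> T r u \<in> span B" "n = 2 * card B + 3"
    and H: "\<And>k. k \<noteq> 0 \<Longrightarrow> of_int k \<cdot> T (k *s s) v = (\<Sum>m<n. of_int k ^ m \<cdot> H m)"
    and pl: "adm s v" "dot a r = 0" "dot v r = c" "dot a s = - c" "c \<noteq> 0"
  shows "br (H 0) (T r a) = 0" "br (H 1) (T r a) = - (c \<cdot> H 0)"
proof -
  have vs: "dot v s = 0" using pl by (simp add: adm_def)
  let ?G = "\<lambda>i j. T (i *s r + j *s s) (of_int i *s a + of_int j *s v)"
  interpret plane_system sc br ?G "- c" B
    by (rule plane_system_T[OF vs pl(2-5) B(1,2)])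
  have "polyseq n (?G 1)"
    using row_polyseq[of 1] B(3) by simp
  then obtain Y where Y: "\<And>k. ?G 1 k = (\<Sum>m<n. of_int k ^ m \<cdot> Y m)"
    unfolding polyseq_def by blast
  have n: "n = Suc (n - 1)" using B(3) by simp
  have Y0: "Y 0 = T r a"
    using Y[of 0] by (subst (asm) n) (simp add: sum.lessThan_Suc_shift del: sum.lessThan_Suc)
  have G0: "?G 0 k = (\<Sum>m<n. of_int k ^ m \<cdot> H m)" if "k \<noteq> 0" for k
    using H[OF that] T_scale[OF adm_scale_lattice[OF pl(1) that]] by simp
  define d where "d m = c \<cdot> ((if m = 0 then 0 else Y m) - H m)" for m
  have eq: "(\<Sum>m<n. of_nat k ^ m \<cdot> br (H m) (T r a)) = (\<Sum>m<n. of_nat k ^ Suc m \<cdot> d m)"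
    if "k \<ge> 1" for k :: nat
  proof -
    have k: "int k \<noteq> 0" using that by simp
    have "(\<Sum>m<n. of_nat k ^ m \<cdot> br (H m) (T r a)) = br (?G 0 (int k)) (?G 1 0)"
      unfolding G0[OF k] by (simp add: br_sum br_scale_left)
    also have "\<dots> = (c * of_nat k) \<cdot> (?G 1 (int k) - ?G 1 0 - ?G 0 (int k))"
      unfolding rel by (simp add: algebra_simps)
    also have "?G 1 (int k) - ?G 1 0 = (\<Sum>m<n. of_nat k ^ m \<cdot> (if m = 0 then 0 else Y m))"
      unfolding Y[of "int k"]
      by (subst (1 2) n, simp only: sum.lessThan_Suc_shift) (simp add: Y0)
    also have "(c * of_nat k) \<cdot> (\<dots> - ?G 0 (int k)) = (\<Sum>m<n. of_nat k ^ Suc m \<cdot> d m)"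
      unfolding G0[OF k] 
      by (simp add: sum_subtractf[symmetric] scale_right_diff_distrib[symmetric] scale_sum_right d_def mult_ac)
    finally show ?thesis .
  qed
  have "0 < n" "1 < n" using B(3) by auto
  then have "{m \<in> {..<n}. m = 0} = {0}" "{m \<in> {..<n}. Suc m = 0} = {}"
    "{m \<in> {..<n}. m = 1} = {1}" "{m \<in> {..<n}. Suc m = 1} = {0}" by auto
  with coeffs_compare[OF _ _ eq, of 0] coeffs_compare[OF _ _ eq, of 1]
  show "br (H 0) (T r a) = 0" "br (H 1) (T r a) = - (c \<cdot> H 0)"
    by (simp_all add: d_def)
qed

text \<open>The pairs \<open>(r, a)\<close> that complete \<open>(s, v)\<close> to a plane generate all others: a vector \<open>a\<close> with \<open>a \<cdot> s = 0\<close> is a difference of two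
  vectors without this property, and for \<open>v \<cdot> r = 0\<close> the operator \<open>T(r, a)\<close> occurs in a bracket of two operators that are
  transverse to \<open>v\<close>; the Jacobi identity finishes the proof.\<close>

lemma commutes_with_all:
  assumes sv: "adm s v" "v \<noteq> 0"
    and z: "\<And>r a. dot a r = 0 \<Longrightarrow> dot v r \<noteq> 0 \<Longrightarrow> dot a s \<noteq> 0 \<Longrightarrow> br z (T r a) = 0"
    and ra: "adm r a"
  shows "br z (T r a) = 0"
proof -
  have s: "dot v s = 0" "s \<noteq> 0" using sv by (auto simp: adm_def)
  have transverse: "br z (T r a) = 0" if r: "dot v r \<noteq> 0" and a: "dot a r = 0" for r a
  proof (cases "dot a s = 0")
    case True
    have "r \<noteq> 0" using r by auto
    have "\<exists>i j. r $ i * s $ j \<noteq> r $ j * s $ i"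
    proof (rule ccontr)
      assume no: "\<not> ?thesis"
      have "dot v r * of_int (s $ j) = dot v s * of_int (r $ j)" for j
      proof -
        have "of_int (r $ i) * of_int (s $ j) = (of_int (r $ j) * of_int (s $ i) :: complex)" for i
          using no by (metis of_int_mult)
        then show ?thesis
          unfolding dot_def sum_distrib_right by (intro sum.cong) (simp_all add: mult_ac)
      qed
      then have "s $ j = 0" for j using r s(1) by simp
      then have "s = 0" by (simp add: vec_eq_iff)
      then show False using s(2) by simp
    qed
    then obtain i j where ij: "r $ i * s $ j \<noteq> r $ j * s $ i" by blast
    define b where "b = axis i (of_int (r $ j)) - axis j (of_int (r $ i) :: complex)"
    have b: "dot b r = 0" "dot b s \<noteq> 0"
    proof -
      show "dot b r = 0" by (simp add: b_def dot_simps)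
      have "dot b s = of_int (r $ j * s $ i - r $ i * s $ j)" by (simp add: b_def dot_simps)
      then show "dot b s \<noteq> 0" using ij by (simp only: of_int_eq_0_iff)
    qed
    have ad: "adm r a" "adm r b" using a b \<open>r \<noteq> 0\<close> by (simp_all add: adm_def)
    have "br z (T r (a + b)) = 0" "br z (T r b) = 0"
      using z[of "a + b" r] z[of b r] a b r True by (simp_all add: dot_simps)
    then show ?thesis by (simp add: T_add[OF ad] br_add_right)
  qed (use z a r in blast)
  show ?thesis
  proof (cases "r = 0 \<or> dot v r \<noteq> 0")
    case True
    then show ?thesis using ra transverse by (auto simp: adm_def)
  next
    case False
    then have r: "r \<noteq> 0" "dot v r = 0" by auto
    \<comment> \<open>\<open>T(r, a)\<close> is generated by fields at \<open>p = e\<^sub>i\<close> and \<open>r - p\<close>, both transverse to \<open>v\<close>.\<close>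
    obtain i where i: "v $ i \<noteq> 0" using sv(2) by (auto simp: vec_eq_iff)
    obtain j where j: "j \<noteq> i" "r $ j \<noteq> 0" using other_coordinate[OF r(2,1) i] by blast
    define p :: "int ^ 'n" where "p = axis i 1"
    define x :: "complex ^ 'n" where "x = axis j (1 / of_int (r $ j))"
    define y where "y = a + dot a p *s x"
    have ar: "dot a r = 0" using ra by (simp add: adm_def)
    have xp: "dot x p = 0" using j by (simp add: x_def p_def)
    have xr: "dot x r = 1" using j by (simp add: x_def)
    have vp: "dot v p \<noteq> 0" "dot v (r - p) \<noteq> 0" using i r(2) by (simp_all add: p_def dot_simps)
    then have "p \<noteq> 0" "r - p \<noteq> 0" by auto
    have yrp: "dot y (r - p) = 0" by (simp add: y_def dot_simps xp xr ar)
    have yp: "dot y p = dot a p" by (simp add: y_def dot_simps xp)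
    have ad: "adm p x" "adm (r - p) y"
      using xp yrp \<open>p \<noteq> 0\<close> \<open>r - p \<noteq> 0\<close> by (simp_all add: adm_def)
    have "br (T p x) (T (r - p) y) = T r a - T (r - p) y + dot a p \<cdot> T p x"
      unfolding T_br[OF ad] by (simp add: dot_simps xr xp yp y_def)
    then have "T r a = br (T p x) (T (r - p) y) + T (r - p) y - dot a p \<cdot> T p x"
      by simp
    moreover have "br z (T p x) = 0" "br z (T (r - p) y) = 0"
      using transverse vp xp yrp by blast+
    ultimately show ?thesis
      by (simp add: br_add_right br_diff br_scale_right jacobi[of z])
  qed
qed

text \<open>\<open>K\<close> bounds the degrees of the operators \<open>T(k s, v)\<close> as polynomials in \<open>k \<noteq> 0\<close>.\<close>

definition expands :: "(nat \<Rightarrow> int ^ 'n \<Rightarrow> complex ^ 'n \<Rightarrow> 'g) \<Rightarrow> nat \<Rightarrow> bool" where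
  "expands \<tau> K \<longleftrightarrow> (\<forall>s v k. adm s v \<longrightarrow> k \<noteq> 0 \<longrightarrow>
     T (k *s s) v = (\<Sum>m\<le>K. of_int k ^ m \<cdot> \<tau> m s v)) \<and>
     (\<forall>s v r u. adm s v \<longrightarrow> adm r u \<longrightarrow> br (\<tau> 0 s v) (T r u) = 0)"

text \<open>The coefficient \<open>H\<^sub>0\<close> of \<open>1 / k\<close> is central and is a multiple of the bracket of \<open>H\<^sub>1\<close> with some \<open>T(r, a)\<close>, so it is
  zero.  But then all these brackets are zero, so that \<open>H\<^sub>1\<close>, the constant term, is central.\<close>

lemma ray_expansion: obtains \<tau> K where "expands \<tau> K"
proof -
  obtain n H B where B: "finite B" "\<And>r u. adm r u \<Longrightarrow> T r u \<in> span B" "n = 2 * card B + 3"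
    and H: "\<And>s v k. adm s v \<Longrightarrow> v \<noteq> 0 \<Longrightarrow> k \<noteq> 0 \<Longrightarrow>
      of_int k \<cdot> T (k *s s) v = (\<Sum>m<n. of_int k ^ m \<cdot> H s v m)"
    by (rule ray_coefficients) blast
  define \<tau> where "\<tau> m s v = (if v = 0 then 0 else H s v (Suc m))" for m s and v :: "complex ^ 'n"
  have H0: "H s v 0 = 0" and H1: "\<And>r u. adm r u \<Longrightarrow> br (H s v 1) (T r u) = 0"
    if sv: "adm s v" "v \<noteq> 0" for s v
  proof -
    have low: "br (H s v 0) (T r a) = 0" "br (H s v 1) (T r a) = - (c \<cdot> H s v 0)"
      if "dot a r = 0" "dot v r = c" "dot a s = - c" "c \<noteq> 0" for r a c
      using low_coefficient_brackets[OF B(1) _ B(3) _ sv(1) that] B(2) H[OF sv] by blast+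
    have low': "br (H s v 0) (T r a) = 0" "H s v 0 = (1 / dot a s) \<cdot> br (H s v 1) (T r a)"
      if ra: "dot a r = 0" "dot v r \<noteq> 0" "dot a s \<noteq> 0" for r a
    proof -
      have "adm r a" using ra by (auto simp: adm_def)
      let ?t = "- dot v r / dot a s"
      have p: "dot (?t *s a) r = 0" "dot v r = dot v r" "dot (?t *s a) s = - dot v r"
        using ra by (simp_all add: dot_simps)
      have t: "?t \<noteq> 0" using ra by simp
      have l: "?t \<cdot> br (H s v 0) (T r a) = 0" "?t \<cdot> br (H s v 1) (T r a) = - (dot v r \<cdot> H s v 0)"
        using low[OF p ra(2)] by (simp_all only: T_scale[OF \<open>adm r a\<close>] br_scale_right)
      show "br (H s v 0) (T r a) = 0" using l(1) t by (simp only: scale_eq_0_iff) simp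
      have "(- 1 / dot v r) \<cdot> ?t \<cdot> br (H s v 1) (T r a) = H s v 0"
        unfolding l(2) using ra by simp
      moreover have "(- 1 / dot v r) * ?t = 1 / dot a s" using ra by simp
      ultimately show "H s v 0 = (1 / dot a s) \<cdot> br (H s v 1) (T r a)"
        by (simp only: scale_scale)
    qed
    have central: "br (H s v 0) (T r u) = 0" if "adm r u" for r u
      by (rule commutes_with_all[OF sv low'(1) that])
    obtain r a c where ra: "dot a r = 0" "dot v r = c" "dot a s = - c" "c \<noteq> 0"
      by (rule companion[OF sv])
    have "adm r a" using ra by (auto simp: adm_def)
    have "H s v 0 = br (T r a) ((1 / c) \<cdot> H s v 1)"
      using low'(2)[of a r] ra br_antisym[of "H s v 1" "T r a"] by (simp add: br_scale_right)
    from central_commutator[OF \<open>adm r a\<close> central this] show "H s v 0 = 0" .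
    then have "br (H s v 1) (T r a) = 0" if "dot a r = 0" "dot v r \<noteq> 0" "dot a s \<noteq> 0" for r a
      using low'(2)[OF that] that by simp
    then show "br (H s v 1) (T r u) = 0" if "adm r u" for r u
      by (rule commutes_with_all[OF sv _ that])
  qed
  define K where "K = n - 2"
  have n: "n = Suc (Suc K)" using B(3) by (simp add: K_def)
  have "expands \<tau> K"
    unfolding expands_def
  proof (intro conjI allI impI)
    fix s :: "int ^ 'n" and v and k :: int assume sv: "adm s v" and k: "k \<noteq> 0"
    show "T (k *s s) v = (\<Sum>m\<le>K. of_int k ^ m \<cdot> \<tau> m s v)"
    proof (cases "v = 0")
      case False
      have "of_int k \<cdot> T (k *s s) v = of_int k \<cdot> (\<Sum>m\<le>K. of_int k ^ m \<cdot> \<tau> m s v)"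
        unfolding H[OF sv False k] n
        by (subst sum.lessThan_Suc_shift)
           (simp add: H0[OF sv False] \<tau>_def False scale_sum_right lessThan_Suc_atMost del: sum.lessThan_Suc)
      then show ?thesis using k by (simp only: scale_cancel_left) simp
    qed (simp add: \<tau>_def)
  next
    fix s r :: "int ^ 'n" and v u assume "adm s v" "adm r u"
    then show "br (\<tau> 0 s v) (T r u) = 0"
      using H1 by (auto simp: \<tau>_def)
  qed
  then show thesis by (rule that)
qed

end

section \<open>The operators are linear along rays\<close>

context torus_lie
begin

lemma expandsD:
  "expands \<tau> K \<Longrightarrow> adm s v \<Longrightarrow> k \<noteq> 0 \<Longrightarrow> T (k *s s) v = (\<Sum>m\<le>K. of_int k ^ m \<cdot> \<tau> m s v)"
  "expands \<tau> K \<Longrightarrow> adm s v \<Longrightarrow> adm r u \<Longrightarrow> br (\<tau> 0 s v) (T r u) = 0"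
  by (simp_all add: expands_def)

lemma expands_1: "expands \<tau> K \<Longrightarrow> adm s v \<Longrightarrow> T s v = (\<Sum>m\<le>K. \<tau> m s v)"
  using expandsD(1)[of \<tau> K s v 1] by simp

lemma coeff_scale:
  assumes \<tau>: "expands \<tau> K" and "adm s v" "m \<le> K"
  shows "\<tau> m s (c *s v) = c \<cdot> \<tau> m s v"
proof -
  have "(\<Sum>m\<le>K. of_nat k ^ m \<cdot> \<tau> m s (c *s v)) = (\<Sum>m\<le>K. of_nat k ^ m \<cdot> c \<cdot> \<tau> m s v)"
    if "k \<ge> 1" for k :: nat
  proof -
    have k: "int k \<noteq> 0" using that by simp
    have "T (int k *s s) (c *s v) = c \<cdot> T (int k *s s) v"
      by (rule T_scale[OF adm_scale_lattice[OF assms(2) k]])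
    then show ?thesis
      unfolding expandsD(1)[OF \<tau> adm_scale[OF assms(2)] k] expandsD(1)[OF \<tau> assms(2) k]
      by (simp add: scale_sum_right mult.commute)
  qed
  from coeffs_compare[OF _ _ this, of m] assms(3) show ?thesis
    by (simp add: conj_commute cong: conj_cong)
qed

lemma coeff_add:
  assumes \<tau>: "expands \<tau> K" and "adm s v" "adm s w" "m \<le> K"
  shows "\<tau> m s (v + w) = \<tau> m s v + \<tau> m s w"
proof -
  have "(\<Sum>m\<le>K. of_nat k ^ m \<cdot> \<tau> m s (v + w)) = (\<Sum>m\<le>K. of_nat k ^ m \<cdot> (\<tau> m s v + \<tau> m s w))"
    if "k \<ge> 1" for k :: nat
  proof -
    have k: "int k \<noteq> 0" using that by simp
    note ad = assms(2,3)[THEN adm_scale_lattice[OF _ k]]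
    show ?thesis
      using T_add[OF ad] unfolding expandsD(1)[OF \<tau> adm_add[OF assms(2,3)] k]
        expandsD(1)[OF \<tau> assms(2) k] expandsD(1)[OF \<tau> assms(3) k]
      by (simp add: sum.distrib scale_right_distrib)
  qed
  from coeffs_compare[OF _ _ this, of m] assms(4) show ?thesis
    by (simp add: conj_commute cong: conj_cong)
qed

lemma coeff_homogeneous:
  assumes \<tau>: "expands \<tau> K" and "adm s v" "l \<noteq> 0" "m \<le> K"
  shows "\<tau> m (l *s s) v = of_int l ^ m \<cdot> \<tau> m s v"
proof -
  have "(\<Sum>m\<le>K. of_nat k ^ m \<cdot> \<tau> m (l *s s) v) = (\<Sum>m\<le>K. of_nat k ^ m \<cdot> of_int l ^ m \<cdot> \<tau> m s v)"
    if "k \<ge> 1" for k :: nat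
  proof -
    have k: "int k \<noteq> 0" "int k * l \<noteq> 0" using that assms(3) by simp_all
    show ?thesis
      using expandsD(1)[OF \<tau> adm_scale_lattice[OF assms(2,3)] k(1)] expandsD(1)[OF \<tau> assms(2) k(2)]
      by (simp add: power_mult_distrib)
  qed
  from coeffs_compare[OF _ _ this, of m] assms(4) show ?thesis
    by (simp add: conj_commute cong: conj_cong)
qed

lemma central_coeff:
  assumes \<tau>: "expands \<tau> K" and "adm s v" "m \<le> K"
    and z: "\<And>r u. adm r u \<Longrightarrow> br z (T r u) = 0"
  shows "br z (\<tau> m s v) = 0"
proof -
  have "(\<Sum>m\<le>K. of_nat k ^ m \<cdot> br z (\<tau> m s v)) = (\<Sum>m\<in>{}. of_nat k ^ (m::nat) \<cdot> 0)"
    if "k \<ge> 1" for k :: nat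
  proof -
    have k: "int k \<noteq> 0" using that by simp
    have "br z (T (int k *s s) v) = 0"
      by (rule z[OF adm_scale_lattice[OF assms(2) k]])
    then show ?thesis
      unfolding expandsD(1)[OF \<tau> assms(2) k] by (simp add: br_sum br_scale_right)
  qed
  from coeffs_compare[OF _ _ this, of m] assms(3) show ?thesis
    by (simp add: conj_commute cong: conj_cong)
qed

lemma adm_bracket:
  assumes "adm r u" "adm s v" "j \<noteq> 0" "k \<noteq> 0"
  shows "adm (j *s r + k *s s) ((of_int k * dot u s) *s v - (of_int j * dot v r) *s u)"
proof -
  have "dot u s = 0 \<and> dot v r = 0" if "j *s r + k *s s = 0"
  proof -
    have "dot u (j *s r + k *s s) = of_int k * dot u s" "dot v (j *s r + k *s s) = of_int j * dot v r"
      using assms(1,2) by (simp_all add: adm_def dot_simps)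
    from this[unfolded that] show ?thesis using assms(3,4) by simp
  qed
  then show ?thesis
    using assms(1,2) by (auto simp: adm_def dot_simps)
qed

text \<open>Replacing \<open>(r, s)\<close> by \<open>(l r, l s)\<close> in the bracket relation and comparing powers of \<open>l\<close>
  splits it into homogeneous components.\<close>

lemma graded_bracket:
  assumes \<tau>: "expands \<tau> K" and ru: "adm r u" and sv: "adm s v" and jk: "j \<ge> 1" "k \<ge> (1::nat)"
  defines "p \<equiv> int j *s r + int k *s s"
    and "x \<equiv> (of_nat k * dot u s) *s v - (of_nat j * dot v r) *s u"
  shows "(\<Sum>(m, n)\<in>{(m, n). m \<le> K \<and> n \<le> K \<and> m + n = M}.
            (of_nat j ^ m * of_nat k ^ n) \<cdot> br (\<tau> m r u) (\<tau> n s v))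
       = (\<Sum>m\<in>{m. m \<le> K \<and> Suc m = M}.
            \<tau> m p x - (of_nat k ^ Suc m * dot u s) \<cdot> \<tau> m s v + (of_nat j ^ Suc m * dot v r) \<cdot> \<tau> m r u)"
proof -
  define c where "c = (\<lambda>(m, n). (of_nat j ^ m * of_nat k ^ n) \<cdot> br (\<tau> m r u) (\<tau> n s v))"
  define d where "d m = \<tau> m p x - (of_nat k ^ Suc m * dot u s) \<cdot> \<tau> m s v
      + (of_nat j ^ Suc m * dot v r) \<cdot> \<tau> m r u" for m
  have adx: "adm p x"
    using adm_bracket[OF ru sv, of "int j" "int k"] jk by (simp add: p_def x_def)
  have "(\<Sum>y\<in>{..K} \<times> {..K}. of_nat l ^ (fst y + snd y) \<cdot> c y) = (\<Sum>m\<le>K. of_nat l ^ Suc m \<cdot> d m)"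
    if "l \<ge> 1" for l :: nat
  proof -
    have nz: "int (l * j) \<noteq> 0" "int (l * k) \<noteq> 0" "int l \<noteq> 0" using that jk by simp_all
    note ad = adm_scale_lattice[OF ru nz(1)] adm_scale_lattice[OF sv nz(2)]
    have "(\<Sum>y\<in>{..K} \<times> {..K}. of_nat l ^ (fst y + snd y) \<cdot> c y)
        = (\<Sum>m\<le>K. \<Sum>n\<le>K. of_nat l ^ (m + n) \<cdot> c (m, n))"
      by (simp add: sum.cartesian_product case_prod_beta)
    also have "\<dots> = br (T (int (l * j) *s r) u) (T (int (l * k) *s s) v)"
      unfolding expandsD(1)[OF \<tau> ru nz(1)] expandsD(1)[OF \<tau> sv nz(2)]
      by (subst sum.swap) (simp add: br_sum br_scale_left br_scale_right c_def power_mult_distrib power_add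
          scale_sum_right mult_ac)
    also have "\<dots> = of_nat l \<cdot> (T (int l *s p) x - (of_nat k * dot u s) \<cdot> T (int (l * k) *s s) v
        + (of_nat j * dot v r) \<cdot> T (int (l * j) *s r) u)"
    proof -
      have e1: "int (l * j) *s r + int (l * k) *s s = int l *s p"
        by (simp add: p_def vec_eq_iff algebra_simps)
      have e2: "dot u (int (l * k) *s s) *s v - dot v (int (l * j) *s r) *s u = of_nat l *s x"
        by (simp add: x_def vec_eq_iff algebra_simps dot_simps)
      show ?thesis
        unfolding T_br[OF ad] e1 e2 T_scale[OF adm_scale_lattice[OF adx nz(3)]]
        by (simp add: dot_simps scale_right_diff_distrib scale_right_distrib mult_ac)
    qed
    also have "\<dots> = (\<Sum>m\<le>K. of_nat l ^ Suc m \<cdot> d m)"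
      unfolding expandsD(1)[OF \<tau> ru nz(1)] expandsD(1)[OF \<tau> sv nz(2)] expandsD(1)[OF \<tau> adx nz(3)] d_def
      by (simp add: scale_sum_right scale_right_distrib scale_right_diff_distrib sum.distrib
          sum_subtractf power_mult_distrib mult_ac)
    finally show ?thesis .
  qed
  from coeffs_compare[OF _ _ this, of M]
  have "(\<Sum>y\<in>{y \<in> {..K} \<times> {..K}. fst y + snd y = M}. c y) = (\<Sum>m\<in>{m \<in> {..K}. Suc m = M}. d m)"
    by simp
  moreover have "{y \<in> {..K} \<times> {..K}. fst y + snd y = M} = {(m, n). m \<le> K \<and> n \<le> K \<and> m + n = M}"
    by auto
  ultimately show ?thesis
    by (simp add: c_def d_def)
qed

lemma finite_pairs [simp]: "finite {(m::nat, n::nat). m \<le> K \<and> n \<le> K \<and> m + n = M}"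
  by (rule finite_subset[of _ "{..K} \<times> {..K}"]) auto

text \<open>A bracket of components of degrees \<open>m\<close> and \<open>n\<close> has degree \<open>m + n - 1\<close>, because the bracket of fields involves one derivative.
  There is nothing above degree \<open>K\<close>.\<close>

lemma high_brackets_vanish:
  assumes \<tau>: "expands \<tau> K" and ru: "adm r u" and sv: "adm s v"
    and mn: "m \<le> K" "n \<le> K" "m + n > Suc K"
  shows "br (\<tau> m r u) (\<tau> n s v) = 0"
proof -
  let ?S = "{(m', n'). m' \<le> K \<and> n' \<le> K \<and> m' + n' = m + n}"
  define c where "c = (\<lambda>(m, n). br (\<tau> m r u) (\<tau> n s v))"
  have "(\<Sum>y\<in>?S. of_nat j ^ fst y \<cdot> c y) = (\<Sum>y\<in>{}. of_nat j ^ (y::nat) \<cdot> 0)" if "j \<ge> 1" for j :: nat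
  proof -
    have "{m'. m' \<le> K \<and> Suc m' = m + n} = {}" using mn(3) by auto
    from graded_bracket[OF \<tau> ru sv that, of 1 "m + n", unfolded this]
    have "(\<Sum>(m, n)\<in>?S. (of_nat j ^ m * of_nat 1 ^ n) \<cdot> br (\<tau> m r u) (\<tau> n s v)) = 0"
      by simp
    then show ?thesis by (simp add: c_def case_prod_beta)
  qed
  from coeffs_compare[OF finite_pairs finite.emptyI this, of m]
  have "sum c {y \<in> ?S. fst y = m} = 0" by simp
  moreover have "{y \<in> ?S. fst y = m} = {(m, n)}" using mn by auto
  ultimately show ?thesis by (simp only: c_def) simp
qed

text \<open>The span of the top coefficients is an abelian ideal: brackets with components of degree at least two vanish
  for reasons of degree, \<open>\<tau>\<^sub>0\<close> is central, and brackets with \<open>\<tau>\<^sub>1\<close> preserve the degree \<open>K\<close>.\<close>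

lemma top_coefficient_central:
  assumes \<tau>: "expands \<tau> K" and K: "K \<ge> 2" and sv: "adm s v" and ru: "adm r u"
  shows "br (T r u) (\<tau> K s v) = 0"
proof -
  define Z where "Z = span {\<tau> K s v | s v. adm s v}"
  have Z_gen: "\<tau> K s v \<in> Z" if "adm s v" for s v
    unfolding Z_def using that by (intro span_base) blast
  have subZ: "subspace Z" by (simp add: Z_def)
  have in_Z: "br (T r u) z \<in> Z" if ru: "adm r u" and "z \<in> Z" for r u z
    using that(2) unfolding Z_def
  proof (induction rule: span_induct_alt)
    case base
    then show ?case by (simp add: subspace_0[OF subZ, unfolded Z_def])
  next
    case (step c z y)
    then obtain s v where sv: "adm s v" "z = \<tau> K s v" by blast
    let ?S = "{(m, n). m \<le> K \<and> n \<le> K \<and> m + n = Suc K}"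
    define X where "X = (\<lambda>(m, n). br (\<tau> m r u) (\<tau> n s v))"
    have "(\<Sum>y\<in>?S. of_nat j ^ fst y \<cdot> X y) \<in> Z" if "j \<ge> 1" for j :: nat
    proof -
      let ?p = "int j *s r + int 1 *s s" and ?x = "(of_nat 1 * dot u s) *s v - (of_nat j * dot v r) *s u"
      have "adm ?p ?x"
        using adm_bracket[OF ru sv(1), of "int j" 1] that by simp
      moreover have "(\<Sum>y\<in>?S. of_nat j ^ fst y \<cdot> X y) = \<tau> K ?p ?x - (of_nat 1 ^ Suc K * dot u s) \<cdot> \<tau> K s v
          + (of_nat j ^ Suc K * dot v r) \<cdot> \<tau> K r u"
        using graded_bracket[OF \<tau> ru sv(1) that, of 1 "Suc K"]
        by (simp add: X_def case_prod_beta conj_commute cong: conj_cong)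
      ultimately show ?thesis
        using subZ Z_gen ru sv(1) by (simp only: subspace_add subspace_diff subspace_scale)
    qed
    from grouped_coeffs_in_subspace[OF subZ finite_pairs this, of 1]
    have "sum X {y \<in> ?S. fst y = 1} \<in> Z" .
    also have "{y \<in> ?S. fst y = 1} = {(1, K)}"
      using K by auto
    finally have X1: "br (\<tau> 1 r u) (\<tau> K s v) \<in> Z"
      by (simp add: X_def)
    have "br (\<tau> m r u) (\<tau> K s v) \<in> Z" if "m \<le> K" for m
    proof -
      consider "m = 0" | "m = 1" | "m \<ge> 2" by linarith
      then show ?thesis
      proof cases
        case 1
        then show ?thesis
          using central_coeff[OF \<tau> sv(1) order_refl expandsD(2)[OF \<tau> ru]] subspace_0[OF subZ] by simp
      next
        case 3
        then show ?thesis
          using high_brackets_vanish[OF \<tau> ru sv(1) that order_refl] subspace_0[OF subZ] by simp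
      qed (use X1 in simp)
    qed
    then have "br (T r u) z \<in> Z"
      unfolding sv(2) expands_1[OF \<tau> ru] br_sum by (intro subspace_sum[OF subZ]) simp
    then show ?case
      using step(2) subZ unfolding br_add_right br_scale_right Z_def[symmetric]
      by (intro subspace_add subspace_scale)
  qed
  have comm: "br z z' = 0" if "z \<in> Z" "z' \<in> Z" for z z'
  proof -
    have "br (\<tau> K s v) z' = 0" if sv: "adm s v" for s v
      using \<open>z' \<in> Z\<close> unfolding Z_def
    proof (induction rule: span_induct_alt)
      case (step c x y)
      then show ?case
        using high_brackets_vanish[OF \<tau> sv, of _ _ K K] K by (auto simp: br_add_right br_scale_right)
    qed simp
    with \<open>z \<in> Z\<close>[unfolded Z_def] show ?thesis
      by (induction rule: span_induct_alt) (auto simp: br_add_left br_scale_left)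
  qed
  show ?thesis
    by (rule abelian_ideal[OF subZ comm in_Z ru Z_gen[OF sv]])
qed

text \<open>On a plane the top component is a homogeneous function of \<open>(j, k)\<close> of degree \<open>K + 1\<close>.  The coefficient \<open>b 1\<close>,
  its derivative at \<open>s\<close> in the direction of \<open>r\<close>, is a multiple of the bracket of \<open>\<tau>\<^sub>1(r, a)\<close> and \<open>\<tau>\<^sub>K(s, v)\<close>, and the latter
  is central.\<close>

lemma top_coefficient_on_plane:
  assumes \<tau>: "expands \<tau> K" and K: "K \<ge> 2"
    and pl: "dot v s = 0" "dot a r = 0" "dot v r = c" "dot a s = - c" "c \<noteq> 0"
  obtains b where "b 0 = \<tau> K s v" "b 1 = 0"
    "\<And>j k. j \<ge> 1 \<Longrightarrow> k \<ge> 1 \<Longrightarrow> \<tau> K (int j *s r + int k *s s) (of_nat j *s a + of_nat k *s v)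
        = (\<Sum>m\<le>Suc K. (of_nat j ^ m * of_nat k ^ (Suc K - m)) \<cdot> b m)"
proof -
  have ra: "adm r a" and sv: "adm s v"
    using plane_adm[OF pl, of 1 0] plane_adm[OF pl, of 0 1] by simp_all
  define X where "X = (\<lambda>m. br (\<tau> m r a) (\<tau> (Suc K - m) s v))"
  define b where "b m = (if m = 0 then \<tau> K s v else if m = Suc K then \<tau> K r a else (- 1 / c) \<cdot> X m)" for m
  have "br (\<tau> K s v) (\<tau> 1 r a) = 0"
  proof (rule central_coeff[OF \<tau> ra])
    show "br (\<tau> K s v) (T r u) = 0" if "adm r u" for r u
      using top_coefficient_central[OF \<tau> K sv that] br_antisym[of "T r u" "\<tau> K s v"] by simp
  qed (use K in simp)
  then have X1: "X 1 = 0"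
    using br_antisym[of "\<tau> K s v" "\<tau> 1 r a"] by (simp add: X_def)
  show thesis
  proof (rule that[of b])
    show "b 0 = \<tau> K s v" by (simp add: b_def)
    show "b 1 = 0" using K X1 by (simp add: b_def)
    fix j k :: nat assume jk: "j \<ge> 1" "k \<ge> 1"
    let ?p = "int j *s r + int k *s s" and ?y = "of_nat j *s a + of_nat k *s v"
    let ?S = "{(m, n). m \<le> K \<and> n \<le> K \<and> m + n = Suc K}"
    have ady: "adm ?p ?y" using plane_adm[OF pl, of "int j" "int k"] by simp
    have x: "(of_nat k * dot a s) *s v - (of_nat j * dot v r) *s a = (- c) *s ?y"
      using pl by (simp add: vec_eq_iff algebra_simps)
    have "(\<Sum>(m, n)\<in>?S. (of_nat j ^ m * of_nat k ^ n) \<cdot> br (\<tau> m r a) (\<tau> n s v))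
        = \<tau> K ?p ((- c) *s ?y) - (of_nat k ^ Suc K * (- c)) \<cdot> \<tau> K s v + (of_nat j ^ Suc K * c) \<cdot> \<tau> K r a"
    proof -
      have "{m. m \<le> K \<and> Suc m = Suc K} = {K}" by auto
      from graded_bracket[OF \<tau> ra sv jk, of "Suc K", unfolded x this] show ?thesis
        by (simp add: pl)
    qed
    moreover have "(\<Sum>(m, n)\<in>?S. (of_nat j ^ m * of_nat k ^ n) \<cdot> br (\<tau> m r a) (\<tau> n s v))
        = (\<Sum>m\<in>{1..K}. (of_nat j ^ m * of_nat k ^ (Suc K - m)) \<cdot> X m)"
      by (rule sum.reindex_bij_witness[of _ "\<lambda>m. (m, Suc K - m)" fst])
         (auto simp: X_def, metis add_diff_cancel_left')
    ultimately have "c \<cdot> \<tau> K ?p ?y = (of_nat k ^ Suc K * c) \<cdot> \<tau> K s v + (of_nat j ^ Suc K * c) \<cdot> \<tau> K r a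
        - (\<Sum>m\<in>{1..K}. (of_nat j ^ m * of_nat k ^ (Suc K - m)) \<cdot> X m)"
      unfolding coeff_scale[OF \<tau> ady order_refl] by (simp add: algebra_simps)
    then have "(1 / c) \<cdot> c \<cdot> \<tau> K ?p ?y = of_nat k ^ Suc K \<cdot> \<tau> K s v + of_nat j ^ Suc K \<cdot> \<tau> K r a
        - (\<Sum>m\<in>{1..K}. (of_nat j ^ m * of_nat k ^ (Suc K - m)) \<cdot> (1 / c) \<cdot> X m)"
      using pl(5) by (simp add: scale_right_diff_distrib scale_right_distrib scale_sum_right mult_ac)
    also have "\<dots> = of_nat k ^ Suc K \<cdot> b 0 + of_nat j ^ Suc K \<cdot> b (Suc K)
        + (\<Sum>m\<in>{1..K}. (of_nat j ^ m * of_nat k ^ (Suc K - m)) \<cdot> b m)"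
    proof -
      have "(\<Sum>m\<in>{1..K}. (of_nat j ^ m * of_nat k ^ (Suc K - m)) \<cdot> b m)
          = - (\<Sum>m\<in>{1..K}. (of_nat j ^ m * of_nat k ^ (Suc K - m)) \<cdot> (1 / c) \<cdot> X m)"
        unfolding sum_negf[symmetric] by (intro sum.cong) (auto simp: b_def)
      then show ?thesis by (simp add: b_def)
    qed
    also have "\<dots> = (\<Sum>m\<le>Suc K. (of_nat j ^ m * of_nat k ^ (Suc K - m)) \<cdot> b m)"
    proof -
      have "{..Suc K} = insert 0 (insert (Suc K) {1..K})" by auto
      then show ?thesis by (simp add: add.assoc del: power_Suc)
    qed
    finally show "\<tau> K ?p ?y = (\<Sum>m\<le>Suc K. (of_nat j ^ m * of_nat k ^ (Suc K - m)) \<cdot> b m)"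
      using pl(5) by simp
  qed
qed

text \<open>The directions \<open>r\<close> and \<open>r + s\<close> both give a zero derivative at \<open>s\<close>; by Euler's formula for the
  difference, \<open>K + 1\<close> times the value at \<open>s\<close> is zero.\<close>

lemma top_coefficient_zero:
  assumes \<tau>: "expands \<tau> K" and K: "K \<ge> 2" and sv: "adm s v"
  shows "\<tau> K s v = 0"
proof (cases "v = 0")
  case True
  then show ?thesis using coeff_scale[OF \<tau> sv order_refl, of 0] by simp
next
  case False
  have vs: "dot v s = 0" using sv by (simp add: adm_def)
  obtain r a c where pl: "dot a r = 0" "dot v r = c" "dot a s = - c" "c \<noteq> 0"
    by (rule companion[OF sv False])
  have pl': "dot (a + v) (r + s) = 0" "dot v (r + s) = c" "dot (a + v) s = - c"
    using pl vs by (simp_all add: dot_simps)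
  obtain b where b: "b 0 = \<tau> K s v" "b 1 = 0"
    "\<And>j k. j \<ge> 1 \<Longrightarrow> k \<ge> 1 \<Longrightarrow> \<tau> K (int j *s r + int k *s s) (of_nat j *s a + of_nat k *s v)
        = (\<Sum>m\<le>Suc K. (of_nat j ^ m * of_nat k ^ (Suc K - m)) \<cdot> b m)"
    by (rule top_coefficient_on_plane[OF \<tau> K vs pl]) blast
  obtain b' where b': "b' 1 = 0"
    "\<And>j k. j \<ge> 1 \<Longrightarrow> k \<ge> 1 \<Longrightarrow> \<tau> K (int j *s (r + s) + int k *s s) (of_nat j *s (a + v) + of_nat k *s v)
        = (\<Sum>m\<le>Suc K. (of_nat j ^ m * of_nat k ^ (Suc K - m)) \<cdot> b' m)"
    by (rule top_coefficient_on_plane[OF \<tau> K vs pl' pl(4)]) blast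
  let ?F = "SIGMA m:{..Suc K}. {..Suc K - m}"
  have eq: "(\<Sum>m\<le>Suc K. of_nat j ^ m \<cdot> b' m)
      = (\<Sum>y\<in>?F. of_nat j ^ (fst y + snd y) \<cdot> of_nat ((Suc K - fst y) choose snd y) \<cdot> b (fst y))"
    if j: "j \<ge> 1" for j :: nat
  proof -
    have "(\<Sum>m\<le>Suc K. of_nat j ^ m \<cdot> b' m)
        = \<tau> K (int j *s (r + s) + int 1 *s s) (of_nat j *s (a + v) + of_nat 1 *s v)"
      using b'(2)[OF j order_refl] by simp
    also have "int j *s (r + s) + int 1 *s s = int j *s r + int (Suc j) *s s"
      by (simp add: vec_eq_iff algebra_simps)
    also have "of_nat j *s (a + v) + of_nat 1 *s v = of_nat j *s a + of_nat (Suc j) *s v"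
      by (simp add: vec_eq_iff algebra_simps)
    also have "\<tau> K (int j *s r + int (Suc j) *s s) \<dots>
        = (\<Sum>m\<le>Suc K. (of_nat j ^ m * of_nat (Suc j) ^ (Suc K - m)) \<cdot> b m)"
      by (rule b(3)[OF j]) simp
    also have "\<dots> = (\<Sum>m\<le>Suc K. \<Sum>i\<le>Suc K - m. of_nat j ^ (m + i) \<cdot> of_nat ((Suc K - m) choose i) \<cdot> b m)"
    proof (intro sum.cong refl)
      fix m
      have "(of_nat (Suc j) :: complex) ^ (Suc K - m) = (\<Sum>i\<le>Suc K - m. of_nat ((Suc K - m) choose i) * of_nat j ^ i)"
        using binomial_ring[of "of_nat j :: complex" 1 "Suc K - m"] by (simp add: add.commute)
      then show "(of_nat j ^ m * of_nat (Suc j) ^ (Suc K - m)) \<cdot> b m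
          = (\<Sum>i\<le>Suc K - m. of_nat j ^ (m + i) \<cdot> of_nat ((Suc K - m) choose i) \<cdot> b m)"
        by (simp only:) (simp add: sum_distrib_left scale_sum_left power_add mult_ac)
    qed
    also have "\<dots> = (\<Sum>y\<in>?F. of_nat j ^ (fst y + snd y) \<cdot> of_nat ((Suc K - fst y) choose snd y) \<cdot> b (fst y))"
      by (subst sum.Sigma) (auto simp: case_prod_beta)
    finally show ?thesis .
  qed
  have "{y \<in> ?F. fst y + snd y = 1} = {(0, 1), (1, 0)}" by auto
  moreover have "{m \<in> {..Suc K}. m = 1} = {1}" by auto
  ultimately have "b' 1 = of_nat (Suc K) \<cdot> b 0 + b 1"
    using coeffs_compare[OF _ _ eq, of 1] by (simp del: of_nat_Suc) simp
  then have "of_nat (Suc K) \<cdot> \<tau> K s v = 0"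
    using b(1,2) b'(1) by (simp del: of_nat_Suc)
  then show ?thesis by (simp del: of_nat_Suc)
qed

lemma linear_expansion:
  obtains \<tau> where "expands \<tau> 1"
proof -
  obtain \<tau> K where \<tau>: "expands \<tau> K" by (rule ray_expansion)
  \<comment> \<open>Padding by a zero coefficient provides a bound that is at least one.\<close>
  define \<tau>' where "\<tau>' m = (if m \<le> K then \<tau> m else (\<lambda>s v. 0))" for m
  have "expands \<tau>' (Suc K)"
    using \<tau> unfolding expands_def \<tau>'_def by simp
  moreover have "expands \<tau>' (Suc n) \<Longrightarrow> expands \<tau>' 1" for n
  proof (induction n)
    case (Suc n)
    have "expands \<tau>' (Suc n)"
      using Suc(2) top_coefficient_zero[OF Suc(2)] unfolding expands_def by simp
    then show ?case by (rule Suc(1))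
  qed simp
  ultimately show thesis using that by blast
qed

end

section \<open>Trace zero matrices of rank one\<close>

text \<open>The matrix \<open>r u\<^sup>T\<close>; it is the linear part at \<open>t = 1\<close> of the field \<open>(t\<^sup>r - 1) (u \<cdot> d)\<close>.\<close>

definition outer :: "int ^ 'n \<Rightarrow> complex ^ 'n \<Rightarrow> complex ^ 'n ^ 'n" where
  "outer r u = (\<chi> i j. of_int (r $ i) * u $ j)"

definition mscale :: "complex \<Rightarrow> complex ^ 'n ^ 'm \<Rightarrow> complex ^ 'n ^ 'm" where
  "mscale c A = (\<chi> i. c *s (A $ i))"

text \<open>The direction of the field \<open>d\<^sub>a\<^sub>b(r) = t\<^sup>r (r\<^sub>b d\<^sub>a - r\<^sub>a d\<^sub>b)\<close>.\<close>

definition dab :: "'n \<Rightarrow> 'n \<Rightarrow> int ^ 'n::finite \<Rightarrow> complex ^ 'n" where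
  "dab a b r = of_int (r $ b) *s axis a 1 - of_int (r $ a) *s axis b 1"

lemma dab_component: "dab a b r $ i = (if i = a then of_int (r $ b) else 0) - (if i = b then of_int (r $ a) else 0)"
  by (simp add: dab_def)

lemma dot_dab: "dot (dab a b r) s = of_int (r $ b * s $ a - r $ a * s $ b)"
  by (simp add: dab_def dot_simps)

lemma adm_dab [simp]: "adm r (dab a b r)"
  by (simp add: adm_def dot_dab) (simp add: dab_def)

lemma trace_outer: "trace (outer r u) = dot u r"
  by (simp add: trace_def outer_def dot_def mult.commute)

lemma outer_mult: "outer r u ** outer s v = mscale (dot u s) (outer r v)"
  by (simp add: vec_eq_iff matrix_matrix_mult_def outer_def mscale_def dot_def sum_distrib_left sum_distrib_right mult_ac)

text \<open>If \<open>r\<^sub>b \<noteq> 0\<close>, then a vector \<open>u\<close> orthogonal to \<open>r\<close> is the combination of the directions of \<open>d\<^sub>a\<^sub>b(r)\<close> with coefficients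
  \<open>u\<^sub>a / r\<^sub>b\<close>.\<close>

lemma adm_induct [consumes 1, case_names gen add scale]:
  assumes "adm r u"
    and gen: "\<And>a b. a \<noteq> b \<Longrightarrow> P (dab a b r)"
    and add: "\<And>u v. adm r u \<Longrightarrow> adm r v \<Longrightarrow> P u \<Longrightarrow> P v \<Longrightarrow> P (u + v)"
    and scale: "\<And>c u. adm r u \<Longrightarrow> P u \<Longrightarrow> P (c *s u)"
    and two: "\<exists>a b :: 'n::finite. a \<noteq> b"
  shows "P (u :: complex ^ 'n)"
proof -
  obtain a0 b0 :: 'n where "a0 \<noteq> b0" using two by blast
  have zero: "P 0" using scale[OF _ gen[OF \<open>a0 \<noteq> b0\<close>], of 0] by simp
  show ?thesis
  proof (cases "r = 0")
    case True
    then show ?thesis using assms(1) zero by (simp add: adm_def)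
  next
    case False
    then obtain b where b: "r $ b \<noteq> 0" by (auto simp: vec_eq_iff)
    have sums: "adm r (\<Sum>a\<in>A. (u $ a / of_int (r $ b)) *s dab a b r) \<and>
        P (\<Sum>a\<in>A. (u $ a / of_int (r $ b)) *s dab a b r)" if "finite A" for A
      using that
    proof (induction A rule: finite_induct)
      case (insert a A)
      have "P (dab a b r)"
        by (cases "a = b") (use gen zero in \<open>simp_all add: dab_def\<close>)
      then have "adm r ((u $ a / of_int (r $ b)) *s dab a b r)" "P ((u $ a / of_int (r $ b)) *s dab a b r)"
        by (auto intro!: adm_scale scale)
      then show ?case
        using insert by (auto intro!: adm_add add simp del: vector_scalar_mult_def)
    qed (simp add: zero)
    have "(\<Sum>a\<in>UNIV. (u $ a / of_int (r $ b)) *s dab a b r) $ i = u $ i" for i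
    proof -
      have "(\<Sum>a\<in>UNIV. (u $ a / of_int (r $ b)) *s dab a b r) $ i
          = (\<Sum>a\<in>UNIV. if a = i then u $ i else 0)
            - (\<Sum>a\<in>UNIV. if i = b then u $ a * of_int (r $ a) / of_int (r $ b) else 0)"
        using b unfolding sum_subtractf[symmetric]
        by (simp add: dab_component) (intro sum.cong, auto simp: field_simps)
      also have "(\<Sum>a\<in>UNIV. if i = b then u $ a * of_int (r $ a) / of_int (r $ b) else 0) = 0"
        by (cases "i = b") (use assms(1) in \<open>auto simp: adm_def dot_def sum_divide_distrib[symmetric]\<close>)
      finally show ?thesis by simp
    qed
    then have "u = (\<Sum>a\<in>UNIV. (u $ a / of_int (r $ b)) *s dab a b r)"
      by (simp add: vec_eq_iff)
    then show ?thesis using sums[of UNIV] by (metis finite)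
  qed
qed

text \<open>Trace zero matrices are spanned by matrices \<open>r u\<^sup>T\<close> with \<open>u \<cdot> r = 0\<close>: an off-diagonal unit is \<open>e\<^sub>i e\<^sub>j\<^sup>T\<close>, and
  \<open>(e\<^sub>i + e\<^sub>o) (e\<^sub>i - e\<^sub>o)\<^sup>T\<close> is the difference of two diagonal units up to off-diagonal ones.\<close>

lemma trace_zero_induct [consumes 1, case_names gen add scale]:
  assumes "trace A = 0"
    and gen: "\<And>r a b. P (outer r (dab a b r))"
    and add: "\<And>A B. trace A = 0 \<Longrightarrow> trace B = 0 \<Longrightarrow> P A \<Longrightarrow> P B \<Longrightarrow> P (A + B)"
    and scale: "\<And>c A. trace A = 0 \<Longrightarrow> P A \<Longrightarrow> P (mscale c A)"
  shows "P (A :: complex ^ 'n ^ 'n::finite)"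
proof -
  define Q where "Q A \<longleftrightarrow> trace A = 0 \<and> P A" for A :: "complex ^ 'n ^ 'n"
  have Q_gen: "Q (outer r (dab a b r))" for r a b
    by (simp add: Q_def gen trace_outer dot_dab)
  have Q_add: "Q A \<Longrightarrow> Q B \<Longrightarrow> Q (A + B)" for A B
    by (simp add: Q_def add trace_add)
  have trs: "trace (mscale c A) = c * trace A" for c and A :: "complex ^ 'n ^ 'n"
    by (simp add: trace_def mscale_def sum_distrib_left)
  have Q_scale: "Q A \<Longrightarrow> Q (mscale c A)" for c A
    by (simp add: Q_def scale trs)
  have "mscale 0 A = 0" for A :: "complex ^ 'n ^ 'n" by (simp add: mscale_def vec_eq_iff)
  then have Q0: "Q 0" using Q_scale[OF Q_gen, of 0] by simp
  have Q_sum: "(\<And>i. i \<in> S \<Longrightarrow> Q (f i)) \<Longrightarrow> Q (sum f S)" for f :: "'n \<Rightarrow> complex ^ 'n ^ 'n" and S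
    by (induction S rule: infinite_finite_induct) (auto simp: Q0 Q_add)
  define o' :: 'n where "o' = undefined"
  define E where "E i j = (outer (axis i 1) (dab j i (axis i 1)) :: complex ^ 'n ^ 'n)" for i j :: 'n
  define D where "D i = outer (axis i 1 + axis o' 1) (dab i o' (axis i 1 + axis o' 1)) + (E i o' + mscale (- 1) (E o' i))"
    for i
  have QE: "Q (E i j)" for i j by (simp add: E_def Q_gen)
  have QD: "Q (D i)" for i by (simp add: D_def Q_gen QE Q_add Q_scale)
  have E: "E i j $ k $ l = (if k = i \<and> l = j then 1 else 0)" if "i \<noteq> j" for i j k l
    using that by (simp add: E_def outer_def dab_component)
  have D: "D i $ k $ l = (if k = l then (if k = i then 1 else 0) - (if k = o' then 1 else 0) else 0)"
    if "i \<noteq> o'" for i k l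
    using that by (simp add: D_def E mscale_def) (auto simp: outer_def dab_component)
  define R where "R = (\<Sum>i\<in>UNIV. \<Sum>j\<in>UNIV - {i}. mscale (A $ i $ j) (E i j)) + (\<Sum>i\<in>UNIV - {o'}. mscale (A $ i $ i) (D i))"
  have "Q R" unfolding R_def by (intro Q_add Q_sum Q_scale QE QD)
  moreover have "R $ k $ l = A $ k $ l" for k l
  proof -
    have "(\<Sum>i\<in>UNIV. \<Sum>j\<in>UNIV - {i}. mscale (A $ i $ j) (E i j)) $ k $ l
        = (\<Sum>i\<in>UNIV. \<Sum>j\<in>UNIV - {i}. if k = i \<and> l = j then A $ k $ l else 0)"
      by (simp add: mscale_def) (intro sum.cong refl, auto simp: E)
    also have "\<dots> = (\<Sum>i\<in>UNIV. if k = i then (if l \<noteq> k then A $ k $ l else 0) else 0)"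
      by (intro sum.cong) auto
    also have "\<dots> = (if k \<noteq> l then A $ k $ l else 0)" by simp
    finally have 1: "(\<Sum>i\<in>UNIV. \<Sum>j\<in>UNIV - {i}. mscale (A $ i $ j) (E i j)) $ k $ l
        = (if k \<noteq> l then A $ k $ l else 0)" .
    have comp: "mscale (A $ i $ i) (D i) $ k $ l
        = (if k = l then (if i = k then A $ k $ k else 0) - (if k = o' then A $ i $ i else 0) else 0)"
      if "i \<in> UNIV - {o'}" for i
      using that by (auto simp: mscale_def D)
    have "(\<Sum>i\<in>UNIV - {o'}. mscale (A $ i $ i) (D i)) $ k $ l
        = (\<Sum>i\<in>UNIV - {o'}. if k = l then (if i = k then A $ k $ k else 0) - (if k = o' then A $ i $ i else 0) else 0)"
      unfolding sum_component by (intro sum.cong refl comp)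
    also have "\<dots> = (if k = l then (\<Sum>i\<in>UNIV - {o'}. (if i = k then A $ k $ k else 0) - (if k = o' then A $ i $ i else 0)) else 0)"
      by simp
    also have "\<dots> = (if k = l then A $ k $ k else 0)"
    proof (cases "k = o'")
      case True
      have "A $ o' $ o' + (\<Sum>i\<in>UNIV - {o'}. A $ i $ i) = 0"
        using assms(1) by (simp add: trace_def sum.remove[of UNIV o'])
      then have "A $ o' $ o' = - (\<Sum>i\<in>UNIV - {o'}. A $ i $ i)"
        by (simp add: eq_neg_iff_add_eq_0)
      then show ?thesis using True
        by (auto simp: sum_subtractf sum_negf)
    qed (simp add: sum_subtractf)
    finally show ?thesis using 1 by (simp add: R_def)
  qed
  then have "R = A" by (simp add: vec_eq_iff)
  ultimately show ?thesis by (simp add: Q_def)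
qed


section \<open>The representation of the trace zero matrices\<close>

context torus_lie
begin

text \<open>In degree one only brackets of a constant with a linear term occur, and these vanish because \<open>\<tau>\<^sub>0\<close> is central; in degree two
  only the bracket of the linear terms is left.\<close>

lemma linear_brackets:
  assumes \<tau>: "expands \<tau> 1" and ru: "adm r u" and sv: "adm s v"
  shows "\<tau> 0 (r + s) (dot u s *s v - dot v r *s u) = dot u s \<cdot> \<tau> 0 s v - dot v r \<cdot> \<tau> 0 r u"
    and "br (\<tau> 1 r u) (\<tau> 1 s v)
      = \<tau> 1 (r + s) (dot u s *s v - dot v r *s u) - dot u s \<cdot> \<tau> 1 s v + dot v r \<cdot> \<tau> 1 r u"
proof -
  have c: "br (\<tau> 0 r u) (\<tau> 1 s v) = 0" "br (\<tau> 0 s v) (\<tau> 1 r u) = 0"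
    using central_coeff[OF \<tau> sv order_refl expandsD(2)[OF \<tau> ru]]
      central_coeff[OF \<tau> ru order_refl expandsD(2)[OF \<tau> sv]] by simp_all
  have "{(m, n). m \<le> 1 \<and> n \<le> 1 \<and> m + n = (1::nat)} = {(0, 1), (1, 0)}"
    "{m. m \<le> 1 \<and> Suc m = 1} = {0}" by auto
  from graded_bracket[OF \<tau> ru sv, of 1 1 1, unfolded this]
  have "br (\<tau> 0 r u) (\<tau> 1 s v) + br (\<tau> 1 r u) (\<tau> 0 s v)
      = \<tau> 0 (r + s) (dot u s *s v - dot v r *s u) - dot u s \<cdot> \<tau> 0 s v + dot v r \<cdot> \<tau> 0 r u"
    by simp
  then show "\<tau> 0 (r + s) (dot u s *s v - dot v r *s u) = dot u s \<cdot> \<tau> 0 s v - dot v r \<cdot> \<tau> 0 r u"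
    using c br_antisym[of "\<tau> 0 s v" "\<tau> 1 r u"] by (simp add: algebra_simps)
  have "{(m, n). m \<le> 1 \<and> n \<le> 1 \<and> m + n = (2::nat)} = {(1, 1)}"
    "{m. m \<le> 1 \<and> Suc m = 2} = {1}" by auto
  from graded_bracket[OF \<tau> ru sv, of 1 1 2, unfolded this]
  show "br (\<tau> 1 r u) (\<tau> 1 s v)
      = \<tau> 1 (r + s) (dot u s *s v - dot v r *s u) - dot u s \<cdot> \<tau> 1 s v + dot v r \<cdot> \<tau> 1 r u"
    by simp
qed

text \<open>Both sides of the computation expand \<open>\<tau>\<^sub>1(2r + s, u)\<close>, once around \<open>r\<close> and once around \<open>s\<close>.\<close>

lemma coeff_lattice_add:
  assumes \<tau>: "expands \<tau> 1" and ru: "adm r u" and su: "adm s u"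
    and ij: "r $ i * s $ j \<noteq> r $ j * s $ i"
  shows "\<tau> 0 (r + s) u = \<tau> 0 r u" "\<tau> 1 (r + s) u = \<tau> 1 r u + \<tau> 1 s u"
proof -
  have key: "\<tau> 0 (p + q) u = \<tau> 0 p u"
    "\<tau> 1 (p + q) u - \<tau> 1 p u = (- 1 / dot v p) \<cdot> br (\<tau> 1 p u) (\<tau> 1 q v)"
    if "adm p u" "adm q u" "adm q v" "dot v p \<noteq> 0" for p q v
  proof -
    have uq: "dot u q = 0" using that(2) by (simp add: adm_def)
    have nz: "p + q \<noteq> 0" using that(3,4) dot_add(2)[of v p q] by (auto simp: adm_def)
    have ad: "adm (p + q) u" using that(1) uq nz by (simp add: adm_def dot_simps)
    have l: "(- dot v p) *s u = dot u q *s v - dot v p *s u" by (simp add: uq)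
    have "(- dot v p) \<cdot> \<tau> 0 (p + q) u = (- dot v p) \<cdot> \<tau> 0 p u"
      using linear_brackets(1)[OF \<tau> that(1,3)]
      unfolding l[symmetric] coeff_scale[OF \<tau> ad zero_le_one] by (simp add: uq)
    then show "\<tau> 0 (p + q) u = \<tau> 0 p u"
      using that(4) by (simp only: scale_cancel_left) simp
    have "br (\<tau> 1 p u) (\<tau> 1 q v) = (- dot v p) \<cdot> (\<tau> 1 (p + q) u - \<tau> 1 p u)"
      using linear_brackets(2)[OF \<tau> that(1,3)]
      unfolding l[symmetric] coeff_scale[OF \<tau> ad order_refl] by (simp add: uq algebra_simps)
    then show "\<tau> 1 (p + q) u - \<tau> 1 p u = (- 1 / dot v p) \<cdot> br (\<tau> 1 p u) (\<tau> 1 q v)"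
      using that(4) by simp
  qed
  define v where "v = dab i j s"
  define w where "w = dab i j r"
  have ad: "adm s v" "adm r w" by (simp_all add: v_def w_def)
  have d: "dot v r \<noteq> 0" "dot w s \<noteq> 0"
    unfolding v_def w_def dot_dab of_int_eq_0_iff using ij by (simp_all add: mult.commute)
  have two: "(2::int) \<noteq> 0" by simp
  note h = coeff_homogeneous[OF \<tau> _ two order_refl, simplified]
  have double: "2 \<cdot> x = x + x" for x using scale_left_distrib[of 1 1 x] by simp
  have around_r: "\<tau> 1 (2 *s r + s) u - (\<tau> 1 r u + \<tau> 1 r u) = \<tau> 1 (r + s) u - \<tau> 1 r u"
    using key(2)[OF ru su ad(1) d(1)] key(2)[OF adm_scale_lattice[OF ru two] su ad(1)] d(1)
    by (simp add: h[OF ru] dot_simps br_scale_left double[symmetric])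
  have "\<tau> 1 (s + 2 *s r) u - \<tau> 1 s u = 2 \<cdot> (\<tau> 1 (s + r) u - \<tau> 1 s u)"
    using key(2)[OF su ru ad(2) d(2)]
      key(2)[OF su adm_scale_lattice[OF ru two] adm_scale_lattice[OF ad(2) two] d(2)]
    by (simp add: h[OF ad(2)] br_scale_right mult.commute)
  then have around_s: "\<tau> 1 (2 *s r + s) u - \<tau> 1 s u
      = (\<tau> 1 (r + s) u - \<tau> 1 s u) + (\<tau> 1 (r + s) u - \<tau> 1 s u)"
    by (simp only: add.commute[of s] double)
  have eliminate: "C = A + B" if "D - (A + A) = C - A" "D - B = (C - B) + (C - B)" for A B C D :: 'g
  proof -
    have "D = C + A" using that(1) by (simp add: algebra_simps)
    then have "C + (A + B) = C + C" using that(2) by (simp add: algebra_simps)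
    then show ?thesis by simp
  qed
  show "\<tau> 1 (r + s) u = \<tau> 1 r u + \<tau> 1 s u"
    by (rule eliminate[OF around_r around_s])
  show "\<tau> 0 (r + s) u = \<tau> 0 r u"
    by (rule key(1)[OF ru su ad(1) d(1)])
qed

text \<open>Along independent directions \<open>\<tau>\<^sub>1\<close> is additive in \<open>r\<close>, while \<open>\<tau>\<^sub>0\<close> does not change; the vector \<open>r\<close> is built up one coordinate at a time.\<close>

lemma coeff_axis:
  assumes \<tau>: "expands \<tau> 1" and r: "r $ a = 0" "r \<noteq> 0" and b: "b \<noteq> a"
  shows "\<tau> 0 r (axis a 1) = \<tau> 0 (axis b 1) (axis a 1)"
    and "\<tau> 1 r (axis a 1) = (\<Sum>i\<in>UNIV - {a}. of_int (r $ i) \<cdot> \<tau> 1 (axis i 1) (axis a 1))"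
proof -
  let ?e = "axis a 1 :: complex ^ 'n"
  have adm_axis: "adm (axis i 1) ?e" if "i \<noteq> a" for i
    using that by (auto simp: adm_def axis_eq_0_iff)
  have indep: "\<tau> 0 (axis i 1) ?e = \<tau> 0 (axis b 1) ?e" if i: "i \<noteq> a" for i
  proof (cases "i = b")
    case False
    have "\<tau> 0 (axis i 1 + axis b 1) ?e = \<tau> 0 (axis i 1) ?e"
      by (rule coeff_lattice_add(1)[OF \<tau> adm_axis[OF i] adm_axis[OF b], of i b]) (use False in simp)
    moreover have "\<tau> 0 (axis b 1 + axis i 1) ?e = \<tau> 0 (axis b 1) ?e"
      by (rule coeff_lattice_add(1)[OF \<tau> adm_axis[OF b] adm_axis[OF i], of i b]) (use False in simp)
    ultimately show ?thesis by (simp add: add.commute)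
  qed simp
  define rs :: "'n set \<Rightarrow> int ^ 'n" where "rs F = (\<chi> i. if i \<in> F then r $ i else 0)" for F
  have "(rs F \<noteq> 0 \<longrightarrow> \<tau> 0 (rs F) ?e = \<tau> 0 (axis b 1) ?e \<and>
      \<tau> 1 (rs F) ?e = (\<Sum>i\<in>F. of_int (r $ i) \<cdot> \<tau> 1 (axis i 1) ?e))" if "finite F" "a \<notin> F" for F
    using that
  proof (induction F rule: finite_induct)
    case empty
    then show ?case by (simp add: rs_def vec_eq_iff)
  next
    case (insert i F)
    have i: "i \<noteq> a" using insert(4) by auto
    have rs: "rs (insert i F) = rs F + r $ i *s axis i 1"
      using insert(2) by (simp add: rs_def vec_eq_iff)
    consider "r $ i = 0" | "r $ i \<noteq> 0" "rs F = 0" | "r $ i \<noteq> 0" "rs F \<noteq> 0" by blast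
    then show ?case
    proof cases
      case 1
      then have "rs (insert i F) = rs F" using rs by simp
      then show ?thesis using insert 1 by simp
    next
      case 2
      then have "r $ j = 0" if "j \<in> F" for j
        using that by (auto simp: rs_def vec_eq_iff split: if_splits)
      then have "(\<Sum>j\<in>F. of_int (r $ j) \<cdot> \<tau> 1 (axis j 1) ?e) = 0" by simp
      moreover have "rs (insert i F) = r $ i *s axis i 1" using rs 2 by simp
      ultimately show ?thesis
        using coeff_homogeneous[OF \<tau> adm_axis[OF i] 2(1), of 0] coeff_homogeneous[OF \<tau> adm_axis[OF i] 2(1), of 1]
          indep[OF i] insert(1,2) by simp
    next
      case 3
      then obtain j where j: "j \<in> F" "r $ j \<noteq> 0" by (auto simp: rs_def vec_eq_iff split: if_splits)
      have ad: "adm (rs F) ?e" "adm (r $ i *s axis i 1) ?e"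
        using 3 insert(4) adm_scale_lattice[OF adm_axis[OF i] 3(1)] by (simp_all add: adm_def rs_def)
      have "rs F $ i * (r $ i *s axis i 1 :: int ^ 'n) $ j \<noteq> rs F $ j * (r $ i *s axis i 1 :: int ^ 'n) $ i"
        using j 3(1) insert(2) by (auto simp: rs_def)
      note add = coeff_lattice_add[OF \<tau> ad this]
      show ?thesis
        unfolding rs add using 3 insert coeff_homogeneous[OF \<tau> adm_axis[OF i] 3(1), of 1]
        by (simp add: add.commute)
    qed
  qed
  note claim = this[of "UNIV - {a}"]
  have "rs (UNIV - {a}) = r"
    using r(1) by (auto simp: rs_def vec_eq_iff)
  with claim r(2) show "\<tau> 0 r ?e = \<tau> 0 (axis b 1) ?e"
    "\<tau> 1 r ?e = (\<Sum>i\<in>UNIV - {a}. of_int (r $ i) \<cdot> \<tau> 1 (axis i 1) ?e)"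
    by simp_all
qed

text \<open>The elements \<open>\<epsilon> i a = \<tau>\<^sub>1(e\<^sub>i, e\<^sub>a)\<close> are the images of the off-diagonal units \<open>E\<^sub>i\<^sub>a\<close>, and \<open>h a b\<close> is the image of
  \<open>E\<^sub>a\<^sub>a - E\<^sub>b\<^sub>b = [E\<^sub>a\<^sub>b, E\<^sub>b\<^sub>a]\<close>.  Splitting the coordinate \<open>r\<^sub>a\<close> off from \<open>r\<close> computes \<open>\<tau>\<^sub>1\<close> on the directions of \<open>d\<^sub>a\<^sub>b(r)\<close> in
  terms of these; by linearity this determines \<open>\<tau>\<^sub>1\<close> everywhere.\<close>

lemma structure_theorem:
  assumes card: "CARD('n) \<ge> 2"
  obtains M and \<phi> :: "complex ^ 'n ^ 'n \<Rightarrow> 'g" where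
    "\<And>a r u. adm r u \<Longrightarrow> br (M a) (T r u) = 0"
    "\<And>A B. \<phi> (A + B) = \<phi> A + \<phi> B" "\<And>c A. \<phi> (mscale c A) = c \<cdot> \<phi> A"
    "\<And>A B. trace A = 0 \<Longrightarrow> trace B = 0 \<Longrightarrow> \<phi> (A ** B - B ** A) = br (\<phi> A) (\<phi> B)"
    "\<And>r u. adm r u \<Longrightarrow> T r u = (\<Sum>a\<in>UNIV. u $ a \<cdot> M a) + \<phi> (outer r u)"
proof -
  have two: "\<exists>b. b \<noteq> a" for a :: 'n
  proof (rule ccontr)
    assume "\<nexists>b. b \<noteq> a"
    then have "UNIV = {a}" by auto
    then have "CARD('n) = card {a}" by (simp only:)
    then show False using card by simp
  qed
  then have two': "\<exists>a b :: 'n. a \<noteq> b" by metis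
  obtain \<tau> where \<tau>: "expands \<tau> 1" by (rule linear_expansion)
  obtain \<beta> where \<beta>: "\<And>a::'n. \<beta> a \<noteq> a" using two by metis
  define M where "M a = \<tau> 0 (axis (\<beta> a) 1) (axis a 1)" for a
  define \<epsilon> where "\<epsilon> i a = \<tau> 1 (axis i 1) (axis a 1)" for i a
  define S where "S a r = (\<Sum>i\<in>UNIV - {a}. of_int (r $ i) \<cdot> \<epsilon> i a)" for a and r :: "int ^ 'n"
  define h where "h a b = br (\<epsilon> a b) (\<epsilon> b a)" for a b
  note axis0 = coeff_axis(1)[OF \<tau> _ _ \<beta>, folded M_def]
  note axis1 = coeff_axis(2)[OF \<tau> _ _ \<beta>, folded \<epsilon>_def, folded S_def]
  have adm_axis: "adm r (axis a 1)" if "r $ a = 0" "r \<noteq> 0" for r a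
    using that by (simp add: adm_def)
  have zero: "\<tau> m r 0 = 0" if "m \<le> 1" for m r
    using coeff_scale[OF \<tau> adm_0 that, of r 0] by simp
  have \<epsilon>_br: "br (\<epsilon> a b) (\<epsilon> i a) = - \<epsilon> i b" if "i \<noteq> a" "i \<noteq> b" "a \<noteq> b" for a b i
  proof -
    have ad: "adm (axis a 1) (axis b 1)" "adm (axis i 1) (axis a 1)" "adm (axis i 1) (axis b 1)"
      using that by (simp_all add: adm_def axis_eq_0_iff)
    have nz: "axis a 1 + axis i 1 \<noteq> (0 :: int ^ 'n)"
      using that by (auto simp: vec_eq_iff dest: spec[of _ a])
    have ad': "adm (axis a 1 + axis i 1) (axis b 1)"
      using that nz by (simp add: adm_def dot_simps)
    have "\<tau> 1 (axis a 1 + axis i 1) (axis b 1) = \<epsilon> a b + \<epsilon> i b"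
      unfolding \<epsilon>_def by (rule coeff_lattice_add(2)[OF \<tau> ad(1,3), of a i]) (use that in simp)
    moreover have "br (\<epsilon> a b) (\<epsilon> i a) = \<tau> 1 (axis a 1 + axis i 1) ((- 1) *s axis b 1) + \<epsilon> a b"
      using linear_brackets(2)[OF \<tau> ad(1,2)] that by (simp add: \<epsilon>_def)
    ultimately show ?thesis
      unfolding coeff_scale[OF \<tau> ad' order_refl] by simp
  qed
  have tau_dab: "\<tau> 0 r (dab a b r) = of_int (r $ b) \<cdot> M a - of_int (r $ a) \<cdot> M b \<and>
      \<tau> 1 r (dab a b r) = of_int (r $ b) \<cdot> S a r - of_int (r $ a) \<cdot> S b r + of_int (r $ a * r $ b) \<cdot> h a b"
    if ab: "a \<noteq> b" for a b r
  proof -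
    consider "r $ a = 0" "r $ b = 0" | "r $ a = 0" "r $ b \<noteq> 0" | "r $ a \<noteq> 0" "r $ b = 0"
      | "r $ a \<noteq> 0" "r $ b \<noteq> 0" by blast
    then show ?thesis
    proof cases
      case 1
      then show ?thesis by (simp add: dab_def zero)
    next
      case 2
      then have "r \<noteq> 0" by auto
      have "dab a b r = of_int (r $ b) *s axis a 1" using 2 by (simp add: dab_def)
      then show ?thesis
        using 2 coeff_scale[OF \<tau> adm_axis[OF 2(1) \<open>r \<noteq> 0\<close>]] axis0[OF 2(1) \<open>r \<noteq> 0\<close>] axis1[OF 2(1) \<open>r \<noteq> 0\<close>]
        by simp
    next
      case 3
      then have "r \<noteq> 0" by auto
      have "dab a b r = (- of_int (r $ a)) *s axis b 1" using 3 by (simp add: dab_def)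
      then show ?thesis
        using 3 coeff_scale[OF \<tau> adm_axis[OF 3(2) \<open>r \<noteq> 0\<close>], of _ "- of_int (r $ a)"]
          axis0[OF 3(2) \<open>r \<noteq> 0\<close>] axis1[OF 3(2) \<open>r \<noteq> 0\<close>]
        by simp
    next
      case 4
      define p :: "int ^ 'n" where "p = r $ a *s axis a 1"
      define q where "q = r - p"
      have qc: "q $ i = (if i = a then 0 else r $ i)" for i by (simp add: q_def p_def)
      have "q $ b \<noteq> 0" using qc[of b] ab 4 by simp
      then have "q \<noteq> 0" by auto
      have "p $ a \<noteq> 0" using 4 by (simp add: p_def)
      then have "p \<noteq> 0" by auto
      have adp: "adm p (axis b 1)" and adq: "adm q (axis a 1)"
        using ab \<open>p \<noteq> 0\<close> \<open>q \<noteq> 0\<close> by (simp_all add: adm_axis p_def qc)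
      have pq: "p + q = r" by (simp add: q_def)
      have d: "dot (axis b 1) q = of_int (r $ b)" "dot (axis a 1) p = of_int (r $ a)"
        using ab by (simp_all add: qc p_def)
      have "\<tau> 0 p (axis b 1) = M b" "\<tau> 0 q (axis a 1) = M a"
        using axis0 ab \<open>p \<noteq> 0\<close> \<open>q \<noteq> 0\<close> by (simp_all add: p_def qc)
      then have t0: "\<tau> 0 r (dab a b r) = of_int (r $ b) \<cdot> M a - of_int (r $ a) \<cdot> M b"
        using linear_brackets(1)[OF \<tau> adp adq] unfolding d pq by (simp add: dab_def)
      have Sq: "\<tau> 1 q (axis a 1) = S a r"
        using axis1[OF _ \<open>q \<noteq> 0\<close>] by (simp add: qc S_def)
      have Sp: "\<tau> 1 p (axis b 1) = of_int (r $ a) \<cdot> \<epsilon> a b"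
      proof -
        have "adm (axis a 1) (axis b 1)" using ab by (simp add: adm_def axis_eq_0_iff)
        from coeff_homogeneous[OF \<tau> this 4(1), of 1] show ?thesis by (simp add: p_def \<epsilon>_def)
      qed
      have "br (\<epsilon> a b) (S a r) = of_int (r $ b) \<cdot> h a b - (S b r - of_int (r $ a) \<cdot> \<epsilon> a b)"
      proof -
        have "br (\<epsilon> a b) (S a r) = of_int (r $ b) \<cdot> h a b
            + (\<Sum>i\<in>UNIV - {a} - {b}. of_int (r $ i) \<cdot> br (\<epsilon> a b) (\<epsilon> i a))"
          unfolding S_def br_sum br_scale_right h_def using ab by (subst sum.remove[of _ b]) auto
        also have "(\<Sum>i\<in>UNIV - {a} - {b}. of_int (r $ i) \<cdot> br (\<epsilon> a b) (\<epsilon> i a))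
            = - (\<Sum>i\<in>UNIV - {b} - {a}. of_int (r $ i) \<cdot> \<epsilon> i b)"
          unfolding sum_negf[symmetric] using ab by (intro sum.cong) (auto simp: \<epsilon>_br)
        also have "(\<Sum>i\<in>UNIV - {b} - {a}. of_int (r $ i) \<cdot> \<epsilon> i b) = S b r - of_int (r $ a) \<cdot> \<epsilon> a b"
          unfolding S_def using ab by (subst sum.remove[of "UNIV - {b}" a]) auto
        finally show ?thesis by simp
      qed
      moreover have "\<tau> 1 r (dab a b r) = br (\<tau> 1 p (axis b 1)) (\<tau> 1 q (axis a 1))
          + of_int (r $ b) \<cdot> \<tau> 1 q (axis a 1) - of_int (r $ a) \<cdot> \<tau> 1 p (axis b 1)"
        using linear_brackets(2)[OF \<tau> adp adq] unfolding d pq by (simp add: dab_def)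
      ultimately have "\<tau> 1 r (dab a b r) = of_int (r $ b) \<cdot> S a r - of_int (r $ a) \<cdot> S b r
          + of_int (r $ a * r $ b) \<cdot> h a b"
        unfolding Sq Sp by (simp add: br_scale_left scale_right_diff_distrib)
      with t0 show ?thesis by blast
    qed
  qed
  have h_antisym: "h b a = - h a b" for a b
    unfolding h_def by (rule br_antisym)
  \<comment> \<open>For \<open>r\<^sub>a = r\<^sub>b = r\<^sub>c = 1\<close> the directions of the three fields add up to zero.\<close>
  have cocycle: "h a b + h b c + h c a = 0" if "a \<noteq> b" "b \<noteq> c" "c \<noteq> a" for a b c
  proof -
    define r where "r = axis a 1 + axis b 1 + (axis c 1 :: int ^ 'n)"
    have r: "r $ a = 1" "r $ b = 1" "r $ c = 1" using that by (simp_all add: r_def)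
    have "dab a b r + (dab b c r + dab c a r) = 0"
      using that by (simp add: vec_eq_iff dab_component r)
    then have "\<tau> 1 r (dab a b r + (dab b c r + dab c a r)) = 0"
      using zero[of 1 r] by simp
    then have "\<tau> 1 r (dab a b r) + (\<tau> 1 r (dab b c r) + \<tau> 1 r (dab c a r)) = 0"
      by (simp only: coeff_add[OF \<tau>] adm_add adm_dab order_refl)
    then have "(S a r - S b r + h a b) + ((S b r - S c r + h b c) + (S c r - S a r + h c a)) = 0"
      using tau_dab[of a b r] tau_dab[of b c r] tau_dab[of c a r] that by (simp add: r)
    then show ?thesis by (simp add: algebra_simps)
  qed
  define o' :: 'n where "o' = undefined"
  \<comment> \<open>By the cocycle identity \<open>h\<close> is a difference; the choice of \<open>o'\<close> extends \<open>\<phi>\<close> from the trace zero matrices to all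
    matrices, by sending the diagonal unit at \<open>o'\<close> to zero.\<close>
  define \<eta> where "\<eta> i = (if i = o' then 0 else h i o')" for i
  have h_\<eta>: "h a b = \<eta> a - \<eta> b" if ab: "a \<noteq> b" for a b
  proof (cases "a = o' \<or> b = o'")
    case True
    then show ?thesis
      using ab h_antisym[of b o'] by (auto simp: \<eta>_def)
  next
    case False
    have "h a b = (h a b + h b o' + h o' a) - h b o' - h o' a" by simp
    also have "\<dots> = h a o' - h b o'"
      using cocycle[OF ab, of o'] h_antisym[of o' a] False by (auto simp: eq_diff_eq)
    finally show ?thesis using False by (simp add: \<eta>_def)
  qed
  define \<phi> where "\<phi> A = (\<Sum>i\<in>UNIV. \<Sum>j\<in>UNIV - {i}. A $ i $ j \<cdot> \<epsilon> i j) + (\<Sum>i\<in>UNIV. A $ i $ i \<cdot> \<eta> i)"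
    for A :: "complex ^ 'n ^ 'n"
  have \<phi>_add: "\<phi> (A + B) = \<phi> A + \<phi> B" for A B
    by (simp add: \<phi>_def scale_left_distrib sum.distrib algebra_simps)
  have \<phi>_scale: "\<phi> (mscale c A) = c \<cdot> \<phi> A" for c A
    by (simp add: \<phi>_def mscale_def scale_sum_right scale_right_distrib)
  have \<phi>_outer: "\<phi> (outer r u) = (\<Sum>j\<in>UNIV. u $ j \<cdot> (S j r + of_int (r $ j) \<cdot> \<eta> j))" for r u
  proof -
    have "(\<Sum>i\<in>UNIV. \<Sum>j\<in>UNIV - {i}. outer r u $ i $ j \<cdot> \<epsilon> i j)
        = (\<Sum>i\<in>UNIV. \<Sum>j\<in>UNIV. if i \<noteq> j then outer r u $ i $ j \<cdot> \<epsilon> i j else 0)"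
      by (intro sum.cong refl sum.mono_neutral_cong_left) auto
    also have "\<dots> = (\<Sum>j\<in>UNIV. \<Sum>i\<in>UNIV. if i \<noteq> j then outer r u $ i $ j \<cdot> \<epsilon> i j else 0)"
      by (rule sum.swap)
    also have "\<dots> = (\<Sum>j\<in>UNIV. \<Sum>i\<in>UNIV - {j}. outer r u $ i $ j \<cdot> \<epsilon> i j)"
      by (intro sum.cong refl sum.mono_neutral_cong_right) auto
    also have "\<dots> = (\<Sum>j\<in>UNIV. u $ j \<cdot> S j r)"
      by (simp add: S_def outer_def scale_sum_right mult.commute)
    finally show ?thesis
      by (simp add: \<phi>_def scale_right_distrib sum.distrib outer_def mult.commute)
  qed
  have \<tau>1: "\<tau> 1 r u = \<phi> (outer r u)" and \<tau>0: "\<tau> 0 r u = (\<Sum>a\<in>UNIV. u $ a \<cdot> M a)" if "adm r u" for r u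
  proof -
    have sum_dab: "(\<Sum>j\<in>UNIV. dab a b r $ j \<cdot> f j) = of_int (r $ b) \<cdot> f a - of_int (r $ a) \<cdot> f b"
      for a b and f :: "'n \<Rightarrow> 'g"
      by (simp add: dab_component scale_left_diff_distrib sum_subtractf if_distrib[of "\<lambda>x. x \<cdot> _"] cong: if_cong)
    from that show "\<tau> 1 r u = \<phi> (outer r u)"
    proof (induction rule: adm_induct)
      case (gen a b)
      then show ?case
        unfolding \<phi>_outer sum_dab using tau_dab[of a b r]
        by (simp add: h_\<eta> scale_right_diff_distrib scale_right_distrib mult.commute)
    next
      case (add u v)
      then show ?case
        unfolding coeff_add[OF \<tau> add(1,2) order_refl] \<phi>_outer by (simp add: scale_left_distrib sum.distrib)
    next
      case (scale c u)
      then show ?case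
        unfolding coeff_scale[OF \<tau> scale(1) order_refl] \<phi>_outer by (simp add: scale_sum_right)
    qed (rule two')
    from that show "\<tau> 0 r u = (\<Sum>a\<in>UNIV. u $ a \<cdot> M a)"
    proof (induction rule: adm_induct)
      case (gen a b)
      then show ?case unfolding sum_dab using tau_dab[of a b r] by simp
    next
      case (add u v)
      then show ?case
        unfolding coeff_add[OF \<tau> add(1,2) zero_le_one] by (simp add: scale_left_distrib sum.distrib)
    next
      case (scale c u)
      then show ?case
        unfolding coeff_scale[OF \<tau> scale(1) zero_le_one] by (simp add: scale_sum_right)
    qed (rule two')
  qed
  \<comment> \<open>The bracket relation of \<open>\<tau>\<^sub>1\<close> becomes the commutator of matrices of rank one because \<open>r u\<^sup>T s v\<^sup>T = (u \<cdot> s) r v\<^sup>T\<close>.\<close>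
  have rep_outer: "\<phi> (outer r u ** outer s v - outer s v ** outer r u) = br (\<phi> (outer r u)) (\<phi> (outer s v))"
    if ru: "adm r u" and sv: "adm s v" for r s u v
  proof -
    let ?x = "dot u s *s v - dot v r *s u"
    have "adm (r + s) ?x" using adm_bracket[OF ru sv, of 1 1] by simp
    then have bracket: "br (\<phi> (outer r u)) (\<phi> (outer s v))
        = \<phi> (outer (r + s) ?x) - dot u s \<cdot> \<phi> (outer s v) + dot v r \<cdot> \<phi> (outer r u)"
      using linear_brackets(2)[OF \<tau> ru sv] ru sv by (simp only: \<tau>1)
    have "outer (r + s) ?x + mscale (dot v r) (outer r u)
        = (outer r u ** outer s v - outer s v ** outer r u) + mscale (dot u s) (outer s v)"
      unfolding outer_mult by (simp add: vec_eq_iff outer_def mscale_def algebra_simps)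
    from arg_cong[OF this, of \<phi>] have "\<phi> (outer (r + s) ?x) + dot v r \<cdot> \<phi> (outer r u)
        = \<phi> (outer r u ** outer s v - outer s v ** outer r u) + dot u s \<cdot> \<phi> (outer s v)"
      by (simp only: \<phi>_add \<phi>_scale)
    then have "\<phi> (outer r u ** outer s v - outer s v ** outer r u)
        = \<phi> (outer (r + s) ?x) + dot v r \<cdot> \<phi> (outer r u) - dot u s \<cdot> \<phi> (outer s v)"
      by simp
    then show ?thesis unfolding bracket by simp
  qed
  have mscale_mult: "mscale c A ** B = mscale c (A ** B)" "B ** mscale c A = mscale c (B ** A)"
    for c and A B :: "complex ^ 'n ^ 'n"
    by (simp_all add: vec_eq_iff matrix_matrix_mult_def mscale_def sum_distrib_left mult_ac)
  have mscale_diff: "mscale c A - mscale c B = mscale c (A - B)" for c and A B :: "complex ^ 'n ^ 'n"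
    by (simp add: vec_eq_iff mscale_def algebra_simps)
  have mult_add: "(A + B) ** C - C ** (A + B) = (A ** C - C ** A) + (B ** C - C ** B)"
    "C ** (A + B) - (A + B) ** C = (C ** A - A ** C) + (C ** B - B ** C)"
    for A B C :: "complex ^ 'n ^ 'n"
    by (simp_all add: vec_eq_iff matrix_matrix_mult_def algebra_simps sum.distrib)
  have rep: "\<phi> (A ** B - B ** A) = br (\<phi> A) (\<phi> B)" if A: "trace A = 0" and B: "trace B = 0" for A B
    using A
  proof (induction rule: trace_zero_induct)
    case (gen r a b)
    show ?case using B
    proof (induction rule: trace_zero_induct)
      case (gen s c d)
      then show ?case by (rule rep_outer[OF adm_dab adm_dab])
    next
      case (add A B)
      then show ?case by (simp only: mult_add \<phi>_add br_add_right)
    next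
      case (scale c A)
      then show ?case by (simp only: mscale_mult mscale_diff \<phi>_scale br_scale_right)
    qed
  next
    case (add A B)
    then show ?case by (simp only: mult_add \<phi>_add br_add_left)
  next
    case (scale c A)
    then show ?case by (simp only: mscale_mult mscale_diff \<phi>_scale br_scale_left)
  qed
  show thesis
  proof (rule that[OF _ \<phi>_add \<phi>_scale rep])
    show "br (M a) (T r u) = 0" if "adm r u" for a r u
    proof -
      have "adm (axis (\<beta> a) 1) (axis a 1)" using \<beta>[of a] by (simp add: adm_def axis_eq_0_iff)
      from expandsD(2)[OF \<tau> this that] show ?thesis by (simp add: M_def)
    qed
    show "T r u = (\<Sum>a\<in>UNIV. u $ a \<cdot> M a) + \<phi> (outer r u)" if "adm r u" for r u
      using expands_1[OF \<tau> that] \<tau>0[OF that] \<tau>1[OF that] by simp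
  qed
qed

end

section \<open>Eigenvectors\<close>

text \<open>A polynomial of least degree that annihilates one vector \<open>u\<^sub>0\<close> has a root \<open>e\<close>; its cofactor sends \<open>u\<^sub>0\<close> to an
  eigenvector.\<close>

lemma (in complex_space) eigenvector_exists:
  assumes U: "subspace U" "U \<noteq> {0}" and fin: "finite B" "U \<subseteq> span B"
    and S: "\<And>u. u \<in> U \<Longrightarrow> S u \<in> U" "\<And>u v. u \<in> U \<Longrightarrow> v \<in> U \<Longrightarrow> S (u + v) = S u + S v"
      "\<And>c u. u \<in> U \<Longrightarrow> S (c \<cdot> u) = c \<cdot> S u"
  obtains e u where "u \<in> U" "u \<noteq> 0" "S u = e \<cdot> u"
proof -
  obtain u0 where u0: "u0 \<in> U" "u0 \<noteq> 0"
    using U subspace_0 by blast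
  define Y where "Y k = (S ^^ k) u0" for k
  have YU: "Y k \<in> U" for k
    by (induction k) (simp_all add: Y_def u0 S)
  then have "Y k \<in> span B" for k using fin by blast
  then obtain \<beta> k0 where \<beta>: "k0 \<le> card B" "\<beta> k0 \<noteq> 0" "(\<Sum>k\<le>card B. \<beta> k \<cdot> Y k) = 0"
    using linear_relation[OF fin(1), of Y] by blast
  define P0 where "P0 = (\<Sum>k\<le>card B. monom (\<beta> k) k)"
  have coeff: "coeff P0 i = (if i \<le> card B then \<beta> i else 0)" for i
    by (simp add: P0_def coeff_sum)
  then have "P0 \<noteq> 0" using \<beta>(1,2) by (metis coeff_0)
  have "degree P0 \<le> card B" by (rule degree_le) (simp add: coeff)
  then have "pact P0 Y 0 = 0"
    using \<beta>(3) by (simp add: pact_bound coeff)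
  then obtain P where P: "P \<noteq> 0" "pact P Y 0 = 0"
    and least: "\<And>Q. Q \<noteq> 0 \<Longrightarrow> pact Q Y 0 = 0 \<Longrightarrow> degree P \<le> degree Q"
    using ex_has_least_nat[of "\<lambda>P. P \<noteq> 0 \<and> pact P Y 0 = 0" P0 degree] \<open>P0 \<noteq> 0\<close> by blast
  have "degree P \<noteq> 0"
  proof
    assume "degree P = 0"
    then obtain c where "P = [:c:]" by (rule degree_eq_zeroE)
    then show False using P u0 by (simp add: Y_def)
  qed
  then have "\<not> constant (poly P)" by (simp add: constant_degree)
  then obtain e where "poly P e = 0"
    using fundamental_theorem_of_algebra by blast
  then obtain Q where Q: "P = [:- e, 1:] * Q"
    by (auto simp: poly_eq_0_iff_dvd elim: dvdE)
  then have "Q \<noteq> 0" using P(1) by auto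
  have "degree P = Suc (degree Q)"
    unfolding Q using \<open>Q \<noteq> 0\<close> by (subst degree_mult_eq) auto
  define w where "w = pact Q Y 0"
  have "w \<noteq> 0"
    using least[OF \<open>Q \<noteq> 0\<close>] \<open>degree P = Suc (degree Q)\<close> by (auto simp: w_def)
  moreover have "w \<in> U"
    unfolding w_def pact_def by (intro subspace_sum subspace_scale U YU)
  moreover have "S w = e \<cdot> w"
  proof -
    have S_sum: "S (\<Sum>i\<in>A. f i) = (\<Sum>i\<in>A. S (f i))" if "finite A" "\<And>i. i \<in> A \<Longrightarrow> f i \<in> U"
      for A :: "nat set" and f
      using that
    proof (induction A rule: finite_induct)
      case empty
      then show ?case using S(3)[OF u0(1), of 0] by simp
    qed (simp add: S(2) subspace_sum U)
    have "S w = (\<Sum>i\<le>degree Q. S (coeff Q i \<cdot> Y (0 + of_nat i)))"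
      unfolding w_def pact_def by (rule S_sum) (simp_all add: subspace_scale U YU)
    also have "\<dots> = pact Q Y 1"
      unfolding pact_def by (simp add: S(3)[OF YU]) (simp add: Y_def)
    finally have "S w = pact Q Y 1" .
    moreover have "pact P Y 0 = pact Q Y 1 - e \<cdot> w"
      unfolding Q pact_mult by (simp add: w_def)
    ultimately show ?thesis using P(2) by simp
  qed
  ultimately show thesis using that by blast
qed


section \<open>Matrices of variable size\<close>

text \<open>The dimension of a weight space is not determined by a type.  Matrices are therefore functions of
  two indices, multiplied by summing over the indices below \<open>d\<close>; this makes the operations total
  and bilinear on the whole type.\<close>

definition fscale :: "complex \<Rightarrow> (nat \<Rightarrow> complex) \<Rightarrow> (nat \<Rightarrow> complex)" where
  "fscale c f = (\<lambda>i. c * f i)"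

definition mscal :: "complex \<Rightarrow> (nat \<Rightarrow> nat \<Rightarrow> complex) \<Rightarrow> (nat \<Rightarrow> nat \<Rightarrow> complex)" where
  "mscal c A = (\<lambda>i j. c * A i j)"

definition mmul :: "nat \<Rightarrow> (nat \<Rightarrow> nat \<Rightarrow> complex) \<Rightarrow> (nat \<Rightarrow> nat \<Rightarrow> complex) \<Rightarrow> (nat \<Rightarrow> nat \<Rightarrow> complex)" where
  "mmul d A B = (\<lambda>i j. if i < d \<and> j < d then \<Sum>k<d. A i k * B k j else 0)"

definition mvec :: "nat \<Rightarrow> (nat \<Rightarrow> nat \<Rightarrow> complex) \<Rightarrow> (nat \<Rightarrow> complex) \<Rightarrow> (nat \<Rightarrow> complex)" where
  "mvec d A x = (\<lambda>i. if i < d then \<Sum>k<d. A i k * x k else 0)"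

definition coord :: "nat \<Rightarrow> (nat \<Rightarrow> complex) set" where
  "coord d = {x. \<forall>i\<ge>d. x i = 0}"

definition supported :: "nat \<Rightarrow> (nat \<Rightarrow> nat \<Rightarrow> complex) \<Rightarrow> bool" where
  "supported d A \<longleftrightarrow> (\<forall>i j. i \<ge> d \<or> j \<ge> d \<longrightarrow> A i j = 0)"

definition mbr :: "nat \<Rightarrow> (nat \<Rightarrow> nat \<Rightarrow> complex) \<Rightarrow> (nat \<Rightarrow> nat \<Rightarrow> complex) \<Rightarrow> (nat \<Rightarrow> nat \<Rightarrow> complex)" where
  "mbr d A B = mmul d A B - mmul d B A"

definition unit_vec :: "nat \<Rightarrow> nat \<Rightarrow> complex" where
  "unit_vec j = (\<lambda>i. if i = j then 1 else 0)"

interpretation fs: complex_space fscale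
  by unfold_locales (auto simp: fscale_def fun_eq_iff algebra_simps)

interpretation ms: complex_space mscal
  by unfold_locales (auto simp: mscal_def fun_eq_iff algebra_simps)

lemma mmul_add: "mmul d (A + B) C = mmul d A C + mmul d B C" "mmul d C (A + B) = mmul d C A + mmul d C B"
  by (auto simp: mmul_def fun_eq_iff algebra_simps sum.distrib)

lemma mmul_diff: "mmul d (A - B) C = mmul d A C - mmul d B C" "mmul d C (A - B) = mmul d C A - mmul d C B"
  by (auto simp: mmul_def fun_eq_iff algebra_simps sum_subtractf)

lemma mmul_scale: "mmul d (mscal c A) B = mscal c (mmul d A B)" "mmul d A (mscal c B) = mscal c (mmul d A B)"
  by (auto simp: mmul_def mscal_def fun_eq_iff sum_distrib_left mult_ac)

lemma mmul_assoc: "mmul d (mmul d A B) C = mmul d A (mmul d B C)"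
proof -
  have "(\<Sum>k<d. (\<Sum>l<d. A i l * B l k) * C k j) = (\<Sum>l<d. A i l * (\<Sum>k<d. B l k * C k j))" for i j
    unfolding sum_distrib_left sum_distrib_right by (subst sum.swap) (simp add: mult_ac)
  then show ?thesis by (auto simp: mmul_def fun_eq_iff)
qed

lemma mvec_add: "mvec d (A + B) x = mvec d A x + mvec d B x" "mvec d A (x + y) = mvec d A x + mvec d A y"
  by (auto simp: mvec_def fun_eq_iff algebra_simps sum.distrib)

lemma mvec_diff: "mvec d (A - B) x = mvec d A x - mvec d B x" "mvec d A (x - y) = mvec d A x - mvec d A y"
  by (auto simp: mvec_def fun_eq_iff algebra_simps sum_subtractf)

lemma mvec_scale: "mvec d (mscal c A) x = fscale c (mvec d A x)" "mvec d A (fscale c x) = fscale c (mvec d A x)"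
  by (auto simp: mvec_def mscal_def fscale_def fun_eq_iff sum_distrib_left mult_ac)

lemma mvec_zero [simp]: "mvec d 0 x = 0" "mvec d A 0 = 0"
  by (auto simp: mvec_def fun_eq_iff)

lemma mvec_sum: "mvec d (sum f S) x = (\<Sum>a\<in>S. mvec d (f a) x)"
  by (induction S rule: infinite_finite_induct)
    (simp_all only: sum.empty sum.insert sum.infinite mvec_zero mvec_add not_False_eq_True)

lemma mvec_mmul: "mvec d (mmul d A B) x = mvec d A (mvec d B x)"
proof -
  have "(\<Sum>k<d. (\<Sum>l<d. A i l * B l k) * x k) = (\<Sum>l<d. A i l * (\<Sum>k<d. B l k * x k))" for i
    unfolding sum_distrib_left sum_distrib_right by (subst sum.swap) (simp add: mult_ac)
  then show ?thesis by (auto simp: mvec_def mmul_def fun_eq_iff)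
qed

lemma mvec_mbr: "mvec d (mbr d A B) x = mvec d A (mvec d B x) - mvec d B (mvec d A x)"
  by (simp add: mbr_def mvec_diff mvec_mmul)

lemma mvec_coord: "mvec d A x \<in> coord d"
  by (auto simp: mvec_def coord_def)

lemma subspace_coord: "fs.subspace (coord d)"
  by (auto simp: fs.subspace_def coord_def fscale_def)

lemma unit_vec_coord: "j < d \<Longrightarrow> unit_vec j \<in> coord d"
  by (auto simp: coord_def unit_vec_def)

lemma coord_expand: "x \<in> coord d \<Longrightarrow> x = (\<Sum>j<d. fscale (x j) (unit_vec j))"
proof -
  assume x: "x \<in> coord d"
  have "(\<Sum>j<d. fscale (x j) (unit_vec j)) i = (\<Sum>j<d. if i = j then x i else 0)" for i
    by (induction d) (auto simp: fscale_def unit_vec_def)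
  then show ?thesis using x by (auto simp: fun_eq_iff coord_def)
qed

lemma coord_span: "coord d \<subseteq> fs.span (unit_vec ` {..<d})"
proof
  fix x assume "x \<in> coord d"
  then have "x = (\<Sum>j<d. fscale (x j) (unit_vec j))" by (rule coord_expand)
  also have "\<dots> \<in> fs.span (unit_vec ` {..<d})"
    by (intro fs.span_sum fs.span_scale fs.span_base) auto
  finally show "x \<in> fs.span (unit_vec ` {..<d})" .
qed

lemma mvec_unit_vec: "j < d \<Longrightarrow> i < d \<Longrightarrow> mvec d A (unit_vec j) i = A i j"
  by (simp add: mvec_def unit_vec_def if_distrib[of "\<lambda>x. _ * x"] cong: if_cong)

lemma matrix_eqI:
  assumes "supported d A" "supported d B" "\<And>x. x \<in> coord d \<Longrightarrow> mvec d A x = mvec d B x"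
  shows "A = B"
proof (intro ext)
  fix i j
  show "A i j = B i j"
  proof (cases "i < d \<and> j < d")
    case True
    then show ?thesis
      using assms(3)[OF unit_vec_coord, of j] mvec_unit_vec[of j d i] by metis
  next
    case False
    then show ?thesis using assms(1,2) by (auto simp: supported_def)
  qed
qed

lemma supported_mbr: "supported d (mbr d A B)"
  by (simp add: supported_def mbr_def mmul_def)

lemma supported_finite_span: "\<exists>B. finite B \<and> (\<forall>A. supported d A \<longrightarrow> A \<in> ms.span B)"
proof -
  define E :: "nat \<times> nat \<Rightarrow> nat \<Rightarrow> nat \<Rightarrow> complex" where "E = (\<lambda>(i, j) k l. if k = i \<and> l = j then 1 else 0)"
  have "A \<in> ms.span (E ` ({..<d} \<times> {..<d}))" if A: "supported d A" for A
  proof -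
    have app: "(\<Sum>y\<in>F. mscal (c y) (E y)) k l = (\<Sum>y\<in>F. if y = (k, l) then c (k, l) else 0)" if "finite F" for F c k l
      using that by (induction F rule: finite_induct) (auto simp: mscal_def E_def split: prod.splits if_splits)
    have "(\<Sum>y\<in>{..<d} \<times> {..<d}. mscal (A (fst y) (snd y)) (E y)) k l = A k l" for k l
      using A by (subst app) (auto simp: supported_def)
    then have "A = (\<Sum>y\<in>{..<d} \<times> {..<d}. mscal (A (fst y) (snd y)) (E y))"
      by (auto simp: fun_eq_iff)
    also have "\<dots> \<in> ms.span (E ` ({..<d} \<times> {..<d}))"
      by (intro ms.span_sum ms.span_scale ms.span_base) auto
    finally show ?thesis .
  qed
  then show ?thesis by (intro exI[of _ "E ` ({..<d} \<times> {..<d})"]) auto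
qed

lemma bracket_space_mbr: "bracket_space mscal (mbr d)"
  by unfold_locales
    (simp_all add: mbr_def mmul_add mmul_scale ms.scale_right_diff_distrib)

lemma mbr_jacobi: "mbr d A (mbr d B C) = mbr d (mbr d A B) C + mbr d B (mbr d A C)"
  by (simp add: mbr_def mmul_diff mmul_assoc)


section \<open>Nilpotent commutators\<close>

text \<open>The powers start at \<open>A\<close>, so \<open>mpow d A n\<close> is the power with exponent \<open>n + 1\<close>; the unit matrix depends on \<open>d\<close> and is avoided.\<close>

primrec mpow :: "nat \<Rightarrow> (nat \<Rightarrow> nat \<Rightarrow> complex) \<Rightarrow> nat \<Rightarrow> (nat \<Rightarrow> nat \<Rightarrow> complex)" where
  "mpow d A 0 = A"
| "mpow d A (Suc n) = mmul d A (mpow d A n)"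

lemma mbr_mmul: "mbr d z (mmul d A B) = mmul d (mbr d z A) B + mmul d A (mbr d z B)"
  by (simp add: mbr_def mmul_diff mmul_assoc)

text \<open>Leibniz's rule for the derivation \<open>ad z\<close>, which stops after two terms because \<open>y = ad z x\<close> is killed by \<open>ad z\<close>.\<close>

lemma iterated_derivation:
  assumes "mbr d z y = 0" "y = mbr d z x"
  shows "(mbr d z ^^ Suc m) (mmul d x w)
    = mmul d x ((mbr d z ^^ Suc m) w) + mscal (of_nat (Suc m)) (mmul d y ((mbr d z ^^ m) w))"
proof (induction m)
  case 0
  then show ?case by (simp add: mbr_mmul assms(2) add.commute)
next
  case (Suc m)
  interpret bracket_space mscal "mbr d" by (rule bracket_space_mbr)
  have IH: "(mbr d z ^^ Suc m) (mmul d x w)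
      = mmul d x ((mbr d z ^^ Suc m) w) + mscal (of_nat (Suc m)) (mmul d y ((mbr d z ^^ m) w))"
    using Suc by (simp only: plus_fun_def)
  have "(mbr d z ^^ Suc (Suc m)) (mmul d x w)
      = mbr d z (mmul d x ((mbr d z ^^ Suc m) w) + mscal (of_nat (Suc m)) (mmul d y ((mbr d z ^^ m) w)))"
    by (simp only: funpow.simps(2)[of "Suc m"] o_apply IH)
  also have "\<dots> = mmul d x ((mbr d z ^^ Suc (Suc m)) w) + (mmul d y ((mbr d z ^^ Suc m) w)
      + mscal (of_nat (Suc m)) (mmul d y ((mbr d z ^^ Suc m) w)))"
  proof -
    have "mmul d 0 B = 0" for B using mmul_scale(1)[of d 0 0 B] by simp
    then show ?thesis
      by (simp add: br_add_right br_scale_right mbr_mmul assms(1) assms(2)[symmetric] add_ac del: of_nat_Suc)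
  qed
  also have "mmul d y ((mbr d z ^^ Suc m) w) + mscal (of_nat (Suc m)) (mmul d y ((mbr d z ^^ Suc m) w))
      = mscal (of_nat (Suc (Suc m))) (mmul d y ((mbr d z ^^ Suc m) w))"
    by (simp only: of_nat_Suc[of "Suc m"] ms.scale_left_distrib ms.scale_one)
  finally show ?case .
qed

text \<open>The Kleinecke argument: if \<open>y = [z, x]\<close> commutes with \<open>z\<close>, then \<open>ad z\<close> applied \<open>n\<close> times to a polynomial of
  degree \<open>n\<close> in \<open>x\<close> leaves \<open>n! y\<^sup>n\<close> times its leading coefficient.  Applied to a polynomial that annihilates \<open>x\<close>,
  this shows that \<open>y\<close> is nilpotent.\<close>

lemma commutator_nilpotent:
  assumes "supported d x" "mbr d z (mbr d z x) = 0"
  obtains n where "mpow d (mbr d z x) n = 0"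
proof -
  interpret bracket_space mscal "mbr d" by (rule bracket_space_mbr)
  define y where "y = mbr d z x"
  have y: "mbr d z y = 0" using assms(2) by (simp add: y_def)
  note leib = iterated_derivation[OF y y_def]
  have mmul_0: "mmul d A 0 = 0" for A using mmul_scale(2)[of d A 0 0] by simp
  have pow_0: "(mbr d z ^^ k) 0 = 0" for k
    by (induction k) (simp_all only: funpow.simps o_apply id_apply br_zero)
  have key: "(mbr d z ^^ Suc n) (mpow d x n) = mscal (of_nat (fact (Suc n))) (mpow d y n) \<and>
      (\<forall>m > Suc n. (mbr d z ^^ m) (mpow d x n) = 0)" for n
  proof (induction n)
    case 0
    have "(mbr d z ^^ m) x = 0" if m: "m > Suc 0" for m
    proof -
      obtain k where m_eq: "m = k + 2" using m by (metis add.commute less_iff_Suc_add add_2_eq_Suc plus_nat.simps(2))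
      have "(mbr d z ^^ (k + 2)) x = (mbr d z ^^ k) (mbr d z (mbr d z x))"
        by (simp only: funpow_add) (simp add: numeral_2_eq_2)
      then show ?thesis using assms(2) m_eq pow_0 by simp
    qed
    then show ?case by (simp add: y_def)
  next
    case (Suc n)
    have IH: "(mbr d z ^^ Suc n) (mpow d x n) = mscal (of_nat (fact (Suc n))) (mpow d y n)"
      "(mbr d z ^^ m) (mpow d x n) = 0" if "m > Suc n" for m
      using Suc that by (simp_all only: zero_fun_def)
    have "(mbr d z ^^ Suc (Suc n)) (mpow d x n) = 0" by (rule IH(2)) simp
    then have 1: "(mbr d z ^^ Suc (Suc n)) (mpow d x (Suc n))
        = mscal (of_nat (fact (Suc (Suc n)))) (mpow d y (Suc n))"
      using IH(1)[of "Suc (Suc n)"] by (simp add: leib mmul_0 mmul_scale del: funpow.simps fact_Suc of_nat_Suc)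
        (simp add: algebra_simps)
    have 2: "(mbr d z ^^ m) (mpow d x (Suc n)) = 0" if m: "m > Suc (Suc n)" for m
    proof -
      obtain k where k: "m = Suc k" "k > Suc n" using m by (cases m) auto
      then show ?thesis using IH(2) by (simp add: leib mmul_0 del: funpow.simps)
    qed
    show ?case using 1 2 by blast
  qed
  obtain B where B: "finite B" "\<And>A. supported d A \<Longrightarrow> A \<in> ms.span B"
    using supported_finite_span[of d] by blast
  have "supported d (mpow d x k)" for k
    using assms(1) by (cases k) (simp_all add: supported_def mmul_def)
  then have in_span: "mpow d x k \<in> ms.span B" for k by (rule B(2))
  obtain \<beta> k0 where \<beta>: "k0 \<le> card B" "\<beta> k0 \<noteq> 0"
    "(\<Sum>k\<le>card B. mscal (\<beta> k) (mpow d x k)) = 0"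
    by (rule ms.linear_relation[OF B(1) in_span])
  define n where "n = Max {k. k \<le> card B \<and> \<beta> k \<noteq> 0}"
  have fin: "finite {k. k \<le> card B \<and> \<beta> k \<noteq> 0}" by simp
  have n: "n \<le> card B" "\<beta> n \<noteq> 0"
    using Max_in[OF fin] \<beta>(1,2) unfolding n_def by blast+
  have above: "\<beta> k = 0" if "k \<le> card B" "k > n" for k
  proof (rule ccontr)
    assume "\<beta> k \<noteq> 0"
    then have "k \<le> n"
      unfolding n_def using that fin by (intro Max_ge) simp_all
    then show False using that by simp
  qed
  have D_lin: "(mbr d z ^^ m) (\<Sum>k\<in>A. mscal (c k) (f k)) = (\<Sum>k\<in>A. mscal (c k) ((mbr d z ^^ m) (f k)))"
    for m c f and A :: "nat set"
    by (induction m) (simp_all add: br_sum br_scale_right)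
  have "0 = (mbr d z ^^ Suc n) (\<Sum>k\<le>card B. mscal (\<beta> k) (mpow d x k))"
    unfolding \<beta>(3) by (rule pow_0[symmetric])
  also have "\<dots> = (\<Sum>k\<le>card B. mscal (\<beta> k) ((mbr d z ^^ Suc n) (mpow d x k)))"
    by (rule D_lin)
  also have "\<dots> = (\<Sum>k\<in>{n}. mscal (\<beta> k) ((mbr d z ^^ Suc n) (mpow d x k)))"
  proof (rule sum.mono_neutral_right)
    show "\<forall>k\<in>{..card B} - {n}. mscal (\<beta> k) ((mbr d z ^^ Suc n) (mpow d x k)) = 0"
    proof
      fix k assume k: "k \<in> {..card B} - {n}"
      then consider "k < n" | "k > n" "k \<le> card B" by fastforce
      then show "mscal (\<beta> k) ((mbr d z ^^ Suc n) (mpow d x k)) = 0"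
      proof cases
        case 1
        then have "Suc n > Suc k" by simp
        then have "(mbr d z ^^ Suc n) (mpow d x k) = 0" using key[of k] by blast
        then show ?thesis by simp
      qed (simp add: above)
    qed
  qed (use n in auto)
  also have "\<dots> = mscal (\<beta> n * of_nat (fact (Suc n))) (mpow d y n)"
    using key[of n] by simp
  finally have "mpow d y n = 0"
    using n(2) by (simp del: fact_Suc)
  then show thesis using that y_def by blast
qed

lemma nilpotent_kernel:
  assumes "mpow d y n = 0" "w0 \<in> W" "w0 \<noteq> 0" "\<And>w. w \<in> W \<Longrightarrow> mvec d y w \<in> W"
  obtains w where "w \<in> W" "w \<noteq> 0" "mvec d y w = 0"
proof -
  have pow: "mvec d (mpow d y k) x = (mvec d y ^^ Suc k) x" for k x
    by (induction k) (simp_all add: mvec_mmul)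
  have "(mvec d y ^^ Suc n) w0 = 0" using pow[of n w0] assms(1) by simp
  then obtain k where k: "(mvec d y ^^ k) w0 = 0" "\<And>i. i < k \<Longrightarrow> (mvec d y ^^ i) w0 \<noteq> 0"
    using exists_least_iff[of "\<lambda>k. (mvec d y ^^ k) w0 = 0"] by blast
  have "k \<noteq> 0" using k(1) assms(3) by (metis funpow_0)
  then obtain l where l: "k = Suc l" by (cases k) auto
  have "(mvec d y ^^ i) w0 \<in> W" for i by (induction i) (simp_all add: assms(2,4))
  then show thesis using that[of "(mvec d y ^^ l) w0"] k l by simp
qed

locale irreducible_matrices =
  fixes d :: nat and \<T> :: "(nat \<Rightarrow> nat \<Rightarrow> complex) set"
  assumes d_pos: "d > 0" and supp: "A \<in> \<T> \<Longrightarrow> supported d A"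
    and irreducible: "fs.subspace W \<Longrightarrow> W \<subseteq> coord d \<Longrightarrow> (\<And>A w. A \<in> \<T> \<Longrightarrow> w \<in> W \<Longrightarrow> mvec d A w \<in> W) \<Longrightarrow>
      W = {0} \<or> W = coord d"
begin

interpretation bracket_space mscal "mbr d" by (rule bracket_space_mbr)

lemma unit_vec_0: "unit_vec 0 \<in> coord d" "unit_vec 0 \<noteq> 0"
  using unit_vec_coord[OF d_pos] by (auto simp: unit_vec_def fun_eq_iff)

text \<open>The common kernel of the matrices in \<open>Y\<close> is an invariant subspace when brackets with
  \<open>\<T>\<close> stay in \<open>Y\<close>.\<close>

lemma common_kernel_trivial:
  assumes closed: "\<And>y A. y \<in> Y \<Longrightarrow> A \<in> \<T> \<Longrightarrow> mbr d y A \<in> Y"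
    and w: "w \<in> coord d" "w \<noteq> 0" "\<And>y. y \<in> Y \<Longrightarrow> mvec d y w = 0"
    and y: "y \<in> Y" "supported d y"
  shows "y = 0"
proof -
  define K where "K = {w \<in> coord d. \<forall>y\<in>Y. mvec d y w = 0}"
  have "fs.subspace K"
    using subspace_coord[of d] by (auto simp: K_def fs.subspace_def mvec_add mvec_scale)
  moreover have "K \<subseteq> coord d" by (auto simp: K_def)
  moreover have "mvec d A w \<in> K" if A: "A \<in> \<T>" "w \<in> K" for A w
  proof -
    have "mvec d y (mvec d A w) = 0" if y: "y \<in> Y" for y
    proof -
      have "mvec d y w = 0" "mvec d (mbr d y A) w = 0"
        using A closed[OF y A(1)] y by (auto simp: K_def)
      then show ?thesis by (simp add: mvec_mbr)
    qed
    then show ?thesis by (simp add: K_def mvec_coord)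
  qed
  ultimately have "K = {0} \<or> K = coord d" by (rule irreducible)
  moreover have "w \<in> K" using w by (simp add: K_def)
  ultimately have "K = coord d" using w(2) by auto
  then have "mvec d y x = mvec d 0 x" if "x \<in> coord d" for x
    using that y(1) by (auto simp: K_def)
  then show ?thesis
    by (intro matrix_eqI[OF y(2)]) (simp_all add: supported_def)
qed

text \<open>A central commutator is nilpotent, so its kernel is a nonzero invariant subspace.\<close>

lemma central_commutator_zero:
  assumes "A \<in> \<T>" "\<And>A. A \<in> \<T> \<Longrightarrow> mbr d z A = 0" "z = mbr d A x"
  shows "z = 0"
proof -
  \<comment> \<open>Entries outside the square of size \<open>d\<close> do not enter the bracket.\<close>
  define x' where "x' = (\<lambda>i j. if i < d \<and> j < d then x i j else 0)"
  have z: "z = mbr d A x'"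
    unfolding assms(3) by (auto simp: mbr_def mmul_def x'_def fun_eq_iff)
  have "mbr d A (mbr d A x') = 0"
    using assms(2)[OF assms(1)] br_antisym[of A z] z by simp
  then obtain n where n: "mpow d z n = 0"
    using commutator_nilpotent[of d x' A] unfolding z by (auto simp: supported_def x'_def)
  obtain w where w: "w \<in> coord d" "w \<noteq> 0" "mvec d z w = 0"
    using nilpotent_kernel[OF n unit_vec_0] mvec_coord by blast
  show ?thesis
  proof (rule common_kernel_trivial[of "{z, 0}"])
    show "mvec d y w = 0" if "y \<in> {z, 0}" for y using that w by auto
    show "mbr d y B \<in> {z, 0}" if "y \<in> {z, 0}" "B \<in> \<T>" for y B
      using that assms(2) by auto
  qed (use w supported_mbr assms(3) in auto)
qed

text \<open>The commutators \<open>y = [z, A]\<close> with \<open>z\<close> in the abelian ideal \<open>Z\<close> lie in \<open>Z\<close>, hence commute with \<open>z\<close> and are nilpotent; they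
  commute with each other.  Such a family has a nonzero common kernel, found by going through a finite basis, and the common
  kernel is invariant.\<close>

lemma abelian_ideal_central:
  assumes Z: "\<And>z z'. z \<in> Z \<Longrightarrow> z' \<in> Z \<Longrightarrow> mbr d z z' = 0" "\<And>A z. A \<in> \<T> \<Longrightarrow> z \<in> Z \<Longrightarrow> mbr d A z \<in> Z"
    and sub: "ms.subspace Z" and "A \<in> \<T>" "z \<in> Z"
  shows "mbr d A z = 0"
proof -
  define Y where "Y = {mbr d z A | z A. z \<in> Z \<and> A \<in> \<T>}"
  have YZ: "y \<in> Z" if y_in: "y \<in> Y" for y
  proof -
    obtain z A where "y = mbr d z A" "z \<in> Z" "A \<in> \<T>" using y_in unfolding Y_def by blast
    then show ?thesis using Z(2)[of A z] ms.subspace_neg[OF sub, of "mbr d A z"] br_antisym[of z A] by simp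
  qed
  have nil: "\<exists>n. mpow d y n = 0" if y_in: "y \<in> Y" for y
  proof -
    obtain z A where y: "y = mbr d z A" "z \<in> Z" "A \<in> \<T>" using y_in unfolding Y_def by blast
    have "mbr d z (mbr d z A) = 0" using Z(1)[OF y(2) YZ[OF y_in]] y by simp
    from commutator_nilpotent[OF supp[OF y(3)] this] show ?thesis using y(1) by blast
  qed
  obtain F where F: "F \<subseteq> Y" "ms.independent F" "Y \<subseteq> ms.span F"
    by (rule ms.maximal_independent_subset)
  have suppY: "supported d y" if "y \<in> Y" for y
    using that supported_mbr by (auto simp: Y_def)
  obtain B where B: "finite B" "\<And>A. supported d A \<Longrightarrow> A \<in> ms.span B"
    using supported_finite_span[of d] by blast
  have "finite F"
    using ms.independent_span_bound[OF B(1) F(2)] B(2) suppY F(1) by blast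
  then have "\<exists>w\<in>coord d. w \<noteq> 0 \<and> (\<forall>y\<in>F. mvec d y w = 0)"
    using F(1)
  proof (induction F rule: finite_induct)
    case empty
    then show ?case using unit_vec_0 by blast
  next
    case (insert y F)
    define W where "W = {w \<in> coord d. \<forall>y\<in>F. mvec d y w = 0}"
    obtain w0 where w0: "w0 \<in> W" "w0 \<noteq> 0" using insert by (auto simp: W_def zero_fun_def)
    have inv: "mvec d y w \<in> W" if "w \<in> W" for w
    proof -
      have "mvec d y' (mvec d y w) = 0" if y': "y' \<in> F" for y'
      proof -
        have "mvec d (mbr d y' y) w = 0"
          using Z(1)[of y' y] YZ insert(4) y' by auto
        then show ?thesis using \<open>w \<in> W\<close> y' by (simp add: mvec_mbr W_def)
      qed
      then show ?thesis by (simp add: W_def mvec_coord)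
    qed
    obtain n where "mpow d y n = 0" using nil insert(4) by blast
    from nilpotent_kernel[OF this w0 inv] obtain w where "w \<in> W" "w \<noteq> 0" "mvec d y w = 0"
      by blast
    then show ?case by (auto simp: W_def zero_fun_def)
  qed
  then obtain w where w: "w \<in> coord d" "w \<noteq> 0" "\<And>y. y \<in> F \<Longrightarrow> mvec d y w = 0" by blast
  have wY: "mvec d y w = 0" if "y \<in> Y" for y
  proof -
    have "y \<in> ms.span F" using F(3) that by blast
    then show ?thesis
      by (induction rule: ms.span_induct_alt)
        (simp_all only: mvec_zero mvec_add mvec_scale w(3) fs.scale_zero_right add_0_left)
  qed
  have "mbr d z A = 0"
  proof (rule common_kernel_trivial[of Y, OF _ w(1,2) wY])
    show "mbr d y A \<in> Y" if "y \<in> Y" "A \<in> \<T>" for y A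
      using YZ[OF that(1)] that(2) by (auto simp: Y_def)
    show "mbr d z A \<in> Y" using assms by (auto simp: Y_def)
  qed (simp_all add: supported_mbr)
  then show ?thesis using br_antisym[of A z] by simp
qed

text \<open>Schur's lemma.\<close>

lemma central_scalar:
  assumes "\<And>A. A \<in> \<T> \<Longrightarrow> mbr d z A = 0"
  obtains e where "\<And>x. x \<in> coord d \<Longrightarrow> mvec d z x = fscale e x"
proof -
  obtain e u where u: "u \<in> coord d" "u \<noteq> 0" "mvec d z u = fscale e u"
    by (rule fs.eigenvector_exists[OF subspace_coord _ finite_imageI coord_span, of d "mvec d z"])
       (use unit_vec_0 mvec_coord in \<open>auto simp: mvec_add mvec_scale\<close>)
  define K where "K = {w \<in> coord d. mvec d z w = fscale e w}"
  have "fs.subspace K"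
    using subspace_coord[of d] by (auto simp: K_def fs.subspace_def mvec_add mvec_scale fs.scale_right_distrib fs.scale_left_commute)
  moreover have "K \<subseteq> coord d" by (auto simp: K_def)
  moreover have "mvec d A w \<in> K" if A: "A \<in> \<T>" "w \<in> K" for A w
  proof -
    have "mvec d z (mvec d A w) = mvec d A (mvec d z w)"
      using assms[OF A(1)] mvec_mbr[of d z A w] by simp
    then show ?thesis using A(2) by (simp add: K_def mvec_coord mvec_scale)
  qed
  ultimately have "K = {0} \<or> K = coord d" by (rule irreducible)
  moreover have "u \<in> K" using u by (simp add: K_def)
  ultimately have "K = coord d" using u(2) by auto
  then show thesis by (intro that[of e]) (auto simp: K_def)
qed

end

section \<open>Vector fields on the torus\<close>

lemma sum_single: "Poly_Mapping.single k (sum f A) = (\<Sum>a\<in>A. Poly_Mapping.single k (f a))"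
  by (induction A rule: infinite_finite_induct) (simp_all add: single_add)

lemma poly_mapping_sum_single: "p = (\<Sum>k\<in>Poly_Mapping.keys p. Poly_Mapping.single k (Poly_Mapping.lookup p k))"
  by (rule poly_mapping_eqI) (auto simp: lookup_sum lookup_single when_def in_keys_iff)

lemma tensor_carrier_induct [consumes 2, case_names zero single add]:
  assumes p: "p \<in> tensor_carrier V" and V: "0 \<in> V"
    and zero: "P 0" and single: "\<And>s v. v \<in> V \<Longrightarrow> P (Poly_Mapping.single s v)"
    and add: "\<And>p q. p \<in> tensor_carrier V \<Longrightarrow> q \<in> tensor_carrier V \<Longrightarrow> P p \<Longrightarrow> P q \<Longrightarrow> P (p + q)"
  shows "P p"
proof -
  let ?f = "\<lambda>k. Poly_Mapping.single k (Poly_Mapping.lookup p k)"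
  have V': "Poly_Mapping.lookup p k \<in> V" for k using p by (simp add: tensor_carrier_def)
  have "P (\<Sum>k\<in>F. ?f k) \<and> (\<Sum>k\<in>F. ?f k) \<in> tensor_carrier V" if "finite F" for F
    using that
  proof (induction F rule: finite_induct)
    case empty
    then show ?case using zero V by (simp add: tensor_carrier_def)
  next
    case (insert k F)
    have "Poly_Mapping.lookup (\<Sum>k\<in>insert k F. ?f k) s \<in> V" for s
      using insert(1) V V' by (simp add: lookup_sum lookup_single when_def)
    moreover have "?f k \<in> tensor_carrier V" using V V' by (simp add: tensor_carrier_def lookup_single when_def)
    ultimately show ?case
      using insert add single V' by (simp add: tensor_carrier_def)
  qed
  then show ?thesis using poly_mapping_sum_single[of p] by (metis finite_keys)
qed

lemma laurent_induct [case_names zero single add]: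
  assumes "P 0" "\<And>s c. P (Poly_Mapping.single s c)" "\<And>f g. P f \<Longrightarrow> P g \<Longrightarrow> P (f + g)"
  shows "P (f :: 'n::finite laurent)"
  by (rule tensor_carrier_induct[of f UNIV P]) (auto simp: tensor_carrier_def assms)

lemma lconst_add: "lconst (c + d) = lconst c + lconst d"
  and lconst_mult: "lconst (c * d) = lconst c * lconst d"
  and lconst_1: "lconst 1 = 1"
  and lconst_0: "lconst 0 = 0"
  by (simp_all add: lconst_def single_add mult_single)

lemma lookup_lconst_mult [simp]: "Poly_Mapping.lookup (lconst c * f) s = c * Poly_Mapping.lookup f s"
proof (induction f rule: laurent_induct)
  case (single s c)
  then show ?case by (simp add: lconst_def mult_single lookup_single when_def)
qed (simp_all add: distrib_left lookup_add)

lemma lookup_deg_der [simp]: "Poly_Mapping.lookup (deg_der a f) s = of_int (s $ a) * Poly_Mapping.lookup f s"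
  by (simp add: deg_der_def mapp.rep_eq when_def in_keys_iff)

lemma deg_der_add: "deg_der a (f + g) = deg_der a f + deg_der a g"
  by (rule poly_mapping_eqI) (simp add: lookup_add distrib_left)

lemma deg_der_single: "deg_der a (Poly_Mapping.single s c) = Poly_Mapping.single s (of_int (s $ a) * c)"
  by (rule poly_mapping_eqI) (simp add: lookup_single when_def)

text \<open>The field \<open>t\<^sup>r (u \<cdot> d)\<close>.\<close>

definition vf :: "int ^ 'n \<Rightarrow> complex ^ 'n \<Rightarrow> 'n::finite laurent \<Rightarrow> 'n laurent" where
  "vf r u f = (\<Sum>a\<in>UNIV. lconst (u $ a) * tmon r * deg_der a f)"

lemma vf_single: "vf r u (Poly_Mapping.single s c) = Poly_Mapping.single (r + s) (dot u s * c)"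
  by (simp add: vf_def dot_def lconst_def tmon_def deg_der_single mult_single sum_distrib_left
      sum_single mult_ac)

lemma vf_fun_add: "vf r u (f + g) = vf r u f + vf r u g"
  by (simp add: vf_def deg_der_add distrib_left sum.distrib)

lemma vf_zero [simp]: "vf r u 0 = 0"
  using vf_fun_add[of r u 0 0] by simp

interpretation ops: complex_space "op_scale :: complex \<Rightarrow> ('n::finite laurent \<Rightarrow> 'n laurent) \<Rightarrow> _"
  by unfold_locales
    (auto simp: op_scale_def fun_eq_iff lconst_add lconst_mult lconst_1 distrib_left distrib_right mult.assoc)

lemma vf_add: "vf r (u + v) = vf r u + vf r v"
  by (auto simp: fun_eq_iff vf_def lconst_add distrib_right sum.distrib)

lemma vf_scale: "vf r (c *s u) = op_scale c (vf r u)"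
  by (auto simp: fun_eq_iff op_scale_def vf_def lconst_mult sum_distrib_left mult.assoc)

lemma vf_zero_left: "vf r 0 = 0"
  using vf_scale[of r 0 0] by simp

lemma vf_diff: "vf r (u - v) = vf r u - vf r v"
  using vf_add[of r "u - v" v] by (simp add: algebra_simps)

lemma deg_der_vf: "deg_der a = vf 0 (axis a 1)"
proof
  fix f show "deg_der a f = vf 0 (axis a 1) f"
    by (induction f rule: laurent_induct) (simp_all add: vf_single deg_der_single deg_der_add vf_fun_add,
       simp add: poly_mapping_eqI)
qed

lemma div_der_vf: "div_der a b r = vf r (dab a b r)"
proof -
  have "vf r (axis a 1) f = tmon r * deg_der a f" for a f
  proof -
    have "vf r (axis a 1) f = (\<Sum>b\<in>UNIV. if b = a then tmon r * deg_der a f else 0)"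
      unfolding vf_def by (intro sum.cong) (auto simp: lconst_0 lconst_1)
    then show ?thesis by simp
  qed
  then show ?thesis
    by (auto simp: fun_eq_iff div_der_def dab_def vf_diff vf_scale op_scale_def mult.assoc)
qed

lemma vec_axis_induct [case_names axis add scale]:
  assumes "\<And>a. P (axis a 1)" "\<And>u v. P u \<Longrightarrow> P v \<Longrightarrow> P (u + v)" "\<And>c u. P u \<Longrightarrow> P (c *s u)"
  shows "P (u :: complex ^ 'n::finite)"
proof -
  have P0: "P 0" using assms(3)[OF assms(1)[of undefined], of 0] by simp
  have "P (\<Sum>a\<in>F. u $ a *s axis a 1)" if "finite F" for F
    using that by (induction F rule: finite_induct) (simp_all add: P0 assms)
  from this[of UNIV] show ?thesis by (simp add: basis_expansion)
qed

lemma SN_subspace: "ops.subspace SN"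
  unfolding SN_def by (rule ops.subspace_span)

lemmas SN_closed = ops.subspace_add[OF SN_subspace] ops.subspace_scale[OF SN_subspace]

lemma vf_in_SN:
  assumes two: "\<exists>a b :: 'n::finite. a \<noteq> b" and "dot u r = 0"
  shows "vf r u \<in> (SN :: ('n laurent \<Rightarrow> 'n laurent) set)"
proof (cases "r = 0")
  case True
  have "vf 0 u \<in> SN"
  proof (rule vec_axis_induct[where P = "\<lambda>u. vf 0 u \<in> SN"])
    show "vf 0 (axis a 1) \<in> SN" for a
      unfolding SN_def deg_der_vf[symmetric] by (intro ops.span_base) blast
  qed (simp_all only: vf_add vf_scale SN_closed)
  then show ?thesis using True by simp
next
  case False
  then have "adm r u" using assms by (simp add: adm_def)
  then show ?thesis
  proof (rule adm_induct[where P = "\<lambda>u. vf r u \<in> SN"])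
    show "vf r (dab a b r) \<in> SN" for a b
      unfolding SN_def div_der_vf[symmetric] by (intro ops.span_base) blast
  qed (simp_all only: vf_add vf_scale SN_closed two)
qed

lemma SN_induct [consumes 1, case_names vf add scale]:
  assumes "X \<in> (SN :: ('n::finite laurent \<Rightarrow> 'n laurent) set)" and vf: "\<And>r u. dot u r = 0 \<Longrightarrow> vf r u \<in> SN \<Longrightarrow> P (vf r u)"
    and add: "\<And>X Y. X \<in> SN \<Longrightarrow> Y \<in> SN \<Longrightarrow> P X \<Longrightarrow> P Y \<Longrightarrow> P (X + Y)"
    and scale: "\<And>c X. X \<in> SN \<Longrightarrow> P X \<Longrightarrow> P (op_scale c X)"
  shows "P X"
proof -
  have gen: "deg_der a \<in> SN" "div_der a b r \<in> SN" for a b r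
    unfolding SN_def by (rule ops.span_base, blast)+
  have P_gen: "P (deg_der a)" "P (div_der a b r)" for a b r
    using vf[of "axis a 1" 0] vf[of "dab a b r" r] gen(1)[of a] gen(2)[of a b r]
    by (simp_all add: deg_der_vf[symmetric] div_der_vf[symmetric] dot_dab)
  have "P X \<and> X \<in> SN"
  proof (rule ops.span_induct_alt[OF assms(1)[unfolded SN_def], where h = "\<lambda>X. P X \<and> X \<in> SN"])
    have "op_scale 0 (deg_der undefined) = 0" by simp
    then show "P 0 \<and> 0 \<in> SN"
      using scale[OF gen(1) P_gen(1), of 0] SN_closed(2)[OF gen(1), of 0] by simp
  next
    fix c and x y :: "'n laurent \<Rightarrow> 'n laurent"
    assume "x \<in> range deg_der \<union> {div_der a b r | a b r. True}" and y: "P y \<and> y \<in> SN"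
    then have x: "x \<in> SN" "P x" using gen P_gen by auto
    from y show "P (op_scale c x + y) \<and> op_scale c x + y \<in> SN"
      using add[OF SN_closed(2)[OF x(1)] _ scale[OF x]] SN_closed(1)[OF SN_closed(2)[OF x(1)]] by blast
  qed
  then show ?thesis by blast
qed

lemma SN_linear:
  assumes "X \<in> SN"
  shows "X (f + g) = X f + X g" "X (lconst c * f) = lconst c * X f"
proof -
  from assms show "X (f + g) = X f + X g"
  proof (induction arbitrary: f g rule: SN_induct)
    case (add X Y)
    then show ?case by (simp add: add_ac)
  qed (simp_all add: vf_fun_add op_scale_def distrib_left)
  from assms show "X (lconst c * f) = lconst c * X f"
  proof (induction arbitrary: f rule: SN_induct)
    case (vf r u)
    show ?case
    proof (induction f rule: laurent_induct)
      case (single s d)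
      then show ?case by (simp add: lconst_def mult_single vf_single mult_ac)
    qed (simp_all add: distrib_left vf_fun_add)
  qed (simp_all add: op_scale_def distrib_left mult_ac)
qed

lemma op_bracket_vf: "op_bracket (vf r u) (vf s v) = vf (r + s) (dot u s *s v - dot v r *s u)"
proof
  fix f
  show "op_bracket (vf r u) (vf s v) f = vf (r + s) (dot u s *s v - dot v r *s u) f"
  proof (induction f rule: laurent_induct)
    case (single q c)
    have "s + (r + q) = r + (s + q)" by simp
    then show ?case
      by (simp add: op_bracket_def vf_single dot_simps single_diff[symmetric] add.assoc algebra_simps)
  qed (simp_all add: op_bracket_def vf_fun_add add_diff_add)
qed

lemma op_bracket_linear:
  assumes "Y \<in> SN"
  shows "op_bracket (X + X') Y = op_bracket X Y + op_bracket X' Y"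
    "op_bracket (op_scale c X) Y = op_scale c (op_bracket X Y)"
    "op_bracket Y (X + X') = op_bracket Y X + op_bracket Y X'"
    "op_bracket Y (op_scale c X) = op_scale c (op_bracket Y X)"
  by (auto simp: fun_eq_iff op_bracket_def op_scale_def SN_linear[OF assms] right_diff_distrib)

lemma SN_bracket:
  assumes two: "\<exists>a b :: 'n::finite. a \<noteq> b"
    and "X \<in> SN" "Y \<in> (SN :: ('n laurent \<Rightarrow> 'n laurent) set)"
  shows "op_bracket X Y \<in> SN"
proof (rule SN_induct[OF assms(2), where P = "\<lambda>X. op_bracket X Y \<in> SN"])
  fix r and u :: "complex ^ 'n" assume X: "dot u r = 0" "vf r u \<in> SN"
  show "op_bracket (vf r u) Y \<in> SN"
  proof (rule SN_induct[OF assms(3), where P = "\<lambda>Y. op_bracket (vf r u) Y \<in> SN"])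
    show "op_bracket (vf r u) (vf s v) \<in> SN" if "dot v s = 0" for s v
      unfolding op_bracket_vf using X that by (intro vf_in_SN[OF two]) (simp add: dot_simps)
  qed (simp_all only: op_bracket_linear X SN_closed)
qed (simp_all only: op_bracket_linear assms(3) SN_closed)

text \<open>The component of degree \<open>r\<close> of a vector field is read off its values on the coordinates \<open>t\<^sub>a\<close>.\<close>

definition cv :: "('n::finite laurent \<Rightarrow> 'n laurent) \<Rightarrow> int ^ 'n \<Rightarrow> complex ^ 'n" where
  "cv X r = (\<chi> a. Poly_Mapping.lookup (X (tmon (axis a 1))) (r + axis a 1))"

lemma cv_add: "cv (X + Y) r = cv X r + cv Y r"
  by (simp add: cv_def vec_eq_iff lookup_add)

lemma cv_scale: "cv (op_scale c X) r = c *s cv X r"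
  by (simp add: cv_def vec_eq_iff op_scale_def)

lemma cv_vf: "cv (vf r u) q = (if q = r then u else 0)"
  by (auto simp: cv_def vec_eq_iff tmon_def vf_single lookup_single when_def)

lemma finite_cv: "finite {r. cv X r \<noteq> 0}"
proof -
  have "{r. cv X r \<noteq> 0} \<subseteq> (\<Union>a\<in>UNIV. (\<lambda>k. k - axis a 1) ` Poly_Mapping.keys (X (tmon (axis a 1))))"
  proof
    fix r assume "r \<in> {r. cv X r \<noteq> 0}"
    then obtain a where "Poly_Mapping.lookup (X (tmon (axis a 1))) (r + axis a 1) \<noteq> 0"
      by (auto simp: cv_def vec_eq_iff)
    then have "r + axis a 1 \<in> Poly_Mapping.keys (X (tmon (axis a 1)))" by (simp add: in_keys_iff)
    then have "r \<in> (\<lambda>k. k - axis a 1) ` Poly_Mapping.keys (X (tmon (axis a 1)))" by force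
    then show "r \<in> (\<Union>a\<in>UNIV. (\<lambda>k. k - axis a 1) ` Poly_Mapping.keys (X (tmon (axis a 1))))" by blast
  qed
  then show ?thesis by (rule finite_subset) simp
qed

lemma dot_cv: "X \<in> SN \<Longrightarrow> dot (cv X r) r = 0"
  by (rule SN_induct[where P = "\<lambda>X. dot (cv X r) r = 0"]) (simp_all add: cv_vf cv_add cv_scale dot_simps)

section \<open>The tensor product with the Laurent polynomials\<close>

context complex_space
begin

lemma tensor_mult_add:
  "tensor_mult sc f (p + q) = tensor_mult sc f p + tensor_mult sc f q"
  "tensor_mult sc (f + g) p = tensor_mult sc f p + tensor_mult sc g p"
proof -
  show "tensor_mult sc f (p + q) = tensor_mult sc f p + tensor_mult sc f q"
    unfolding tensor_mult_def sum.distrib[symmetric]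
    by (intro sum.cong refl setsum_keys_plus_distrib) (simp_all add: scale_right_distrib single_add)
  show "tensor_mult sc (f + g) p = tensor_mult sc f p + tensor_mult sc g p"
    unfolding tensor_mult_def
    by (rule setsum_keys_plus_distrib) (simp_all add: scale_left_distrib single_add sum.distrib)
qed

lemma tensor_mult_zero [simp]: "tensor_mult sc f 0 = 0" "tensor_mult sc 0 p = 0"
  by (simp_all add: tensor_mult_def)

lemma tensor_mult_single:
  "tensor_mult sc (Poly_Mapping.single r c) (Poly_Mapping.single s v) = Poly_Mapping.single (r + s) (c \<cdot> v)"
  by (cases "c = 0"; cases "v = 0") (simp_all add: tensor_mult_def)

lemma tensor_UNIV_induct [case_names zero single add]:
  assumes "P 0" "\<And>s v. P (Poly_Mapping.single s v)" "\<And>p q. P p \<Longrightarrow> P q \<Longrightarrow> P (p + q)"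
  shows "P (p :: (int ^ 'n::finite) \<Rightarrow>\<^sub>0 'g)"
  by (rule tensor_carrier_induct[of p UNIV P]) (auto simp: tensor_carrier_def assms)

lemma tensor_module: "module (tensor_mult sc :: 'n::finite laurent \<Rightarrow> _)"
proof
  fix f g :: "'n laurent" and p q :: "(int ^ 'n) \<Rightarrow>\<^sub>0 'g"
  show "tensor_mult sc f (p + q) = tensor_mult sc f p + tensor_mult sc f q"
    "tensor_mult sc (f + g) p = tensor_mult sc f p + tensor_mult sc g p"
    by (rule tensor_mult_add)+
  show "tensor_mult sc f (tensor_mult sc g p) = tensor_mult sc (f * g) p"
  proof (induction f rule: laurent_induct)
    case (single r c)
    show ?case
    proof (induction g rule: laurent_induct)
      case (single r' c')
      show ?case
      proof (induction p rule: tensor_UNIV_induct)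
        case (single s v)
        then show ?case by (simp add: tensor_mult_single mult_single add.assoc)
      qed (simp_all add: tensor_mult_add)
    qed (simp_all add: tensor_mult_add distrib_left)
  qed (simp_all add: tensor_mult_add distrib_right)
  show "tensor_mult sc 1 p = p"
  proof (induction p rule: tensor_UNIV_induct)
    case (single s v)
    then show ?case by (simp flip: single_one add: tensor_mult_single)
  qed (simp_all add: tensor_mult_add)
qed

lemma lookup_tensor_mult_lconst:
  "Poly_Mapping.lookup (tensor_mult sc (lconst c) p) s = c \<cdot> Poly_Mapping.lookup p s"
proof (induction p rule: tensor_UNIV_induct)
  case (single r v)
  then show ?case by (simp add: lconst_def tensor_mult_single lookup_single when_def)
qed (simp_all add: tensor_mult_add lookup_add scale_right_distrib)

lemma tensor_carrier_single [simp]: "0 \<in> V \<Longrightarrow> Poly_Mapping.single s v \<in> tensor_carrier V \<longleftrightarrow> v \<in> V"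
  by (auto simp: tensor_carrier_def lookup_single when_def split: if_splits)

lemma tensor_carrier_add:
  "subspace V \<Longrightarrow> p \<in> tensor_carrier V \<Longrightarrow> q \<in> tensor_carrier V \<Longrightarrow> p + q \<in> tensor_carrier V"
  by (simp add: tensor_carrier_def lookup_add subspace_add)

lemma tensor_carrier_sum:
  "subspace V \<Longrightarrow> (\<And>i. i \<in> A \<Longrightarrow> f i \<in> tensor_carrier V) \<Longrightarrow> sum f A \<in> tensor_carrier V"
proof (induction A rule: infinite_finite_induct)
  case (insert i A)
  then show ?case by (simp add: tensor_carrier_add)
qed (simp_all add: tensor_carrier_def subspace_0)

lemma tensor_mult_closed:
  assumes V: "subspace V" and p: "p \<in> tensor_carrier V"
  shows "tensor_mult sc f p \<in> tensor_carrier V"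
proof -
  have "Poly_Mapping.single s (c \<cdot> Poly_Mapping.lookup p s') \<in> tensor_carrier V" for s s' c
    using assms by (simp add: subspace_0 subspace_scale tensor_carrier_def lookup_single when_def)
  then show ?thesis
    unfolding tensor_mult_def by (intro tensor_carrier_sum V)
qed

lemma tensor_carrier_subspace:
  assumes "subspace V"
  shows "module.subspace (tensor_mult sc) (tensor_carrier V)"
  unfolding module.subspace_def[OF tensor_module]
proof (intro conjI ballI allI)
  show "0 \<in> tensor_carrier V" using subspace_0[OF assms] by (simp add: tensor_carrier_def)
qed (simp_all add: tensor_mult_closed tensor_carrier_add assms)

end

definition cdot :: "complex ^ 'n \<Rightarrow> complex ^ 'n::finite \<Rightarrow> complex" where
  "cdot u \<nu> = (\<Sum>a\<in>UNIV. u $ a * \<nu> $ a)"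

lemma cdot_simps: "cdot (u + v) \<nu> = cdot u \<nu> + cdot v \<nu>" "cdot (u - v) \<nu> = cdot u \<nu> - cdot v \<nu>"
  "cdot (c *s u) \<nu> = c * cdot u \<nu>" "cdot (- u) \<nu> = - cdot u \<nu>" "cdot 0 \<nu> = 0"
  by (simp_all add: cdot_def algebra_simps sum.distrib sum_subtractf sum_distrib_left sum_negf)

lemma cdot_axis [simp]: "cdot (axis a c) \<nu> = c * \<nu> $ a"
proof -
  have "cdot (axis a c) \<nu> = (\<Sum>b\<in>UNIV. if b = a then c * \<nu> $ a else 0)"
    unfolding cdot_def by (intro sum.cong) auto
  then show ?thesis by simp
qed

lemma outer_linear: "outer r (u + v) = outer r u + outer r v" "outer r (c *s u) = mscale c (outer r u)"
  "outer 0 u = 0" "outer r 0 = 0"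
  by (simp_all add: outer_def mscale_def vec_eq_iff algebra_simps)

lemma trace_zero [simp]: "trace (0 :: complex ^ 'n ^ 'n::finite) = 0"
  by (simp add: trace_def)

lemma trace_mscale [simp]: "trace (mscale c A) = c * trace (A :: complex ^ 'n ^ 'n::finite)"
  by (simp add: trace_def mscale_def sum_distrib_left)

locale sla_rep =
  fixes V :: "('n::finite, 'v::ab_group_add) sla_module"
  assumes sla_module: "is_sla_module V"
begin

sublocale lm: lie_module "vscale V" sla_carrier sla_scale sla_bracket "vcarrier V" "vact V"
  using sla_module by (simp add: is_sla_module_def)

sublocale cs: complex_space "vscale V"
  by (rule complex_space.intro) (rule lm.vector_space_axioms)

lemmas sub = lm.carrier_subspace

lemma zero_mem [simp]: "0 \<in> vcarrier V"
  by (rule lm.subspace_0[OF sub])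

definition \<phi> :: "complex ^ 'n ^ 'n \<Rightarrow> 'v \<Rightarrow> 'v" where
  "\<phi> A u = vact V (A, 0) u"

lemma sla_mem: "trace A = 0 \<Longrightarrow> (A, c) \<in> sla_carrier"
  by (simp add: sla_carrier_def)

lemma sla_scale_pair: "sla_scale c (A, d) = (mscale c A, c *s d)"
  by (simp add: sla_scale_def mscale_def)

lemma \<phi>_closed: "trace A = 0 \<Longrightarrow> u \<in> vcarrier V \<Longrightarrow> \<phi> A u \<in> vcarrier V"
  unfolding \<phi>_def by (intro lm.act_closed sla_mem)

lemma \<phi>_add_left:
  "trace A = 0 \<Longrightarrow> trace B = 0 \<Longrightarrow> u \<in> vcarrier V \<Longrightarrow> \<phi> (A + B) u = \<phi> A u + \<phi> B u"
  unfolding \<phi>_def using lm.act_add_left[OF sla_mem sla_mem, of A B u 0 0] by simp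

lemma \<phi>_scale_left: "trace A = 0 \<Longrightarrow> u \<in> vcarrier V \<Longrightarrow> \<phi> (mscale c A) u = vscale V c (\<phi> A u)"
  unfolding \<phi>_def using lm.act_scale_left[OF sla_mem, of A u c 0] by (simp add: sla_scale_pair)

lemma \<phi>_add_right:
  "trace A = 0 \<Longrightarrow> u \<in> vcarrier V \<Longrightarrow> v \<in> vcarrier V \<Longrightarrow> \<phi> A (u + v) = \<phi> A u + \<phi> A v"
  unfolding \<phi>_def by (intro lm.act_add_right sla_mem)

lemma \<phi>_scale_right: "trace A = 0 \<Longrightarrow> u \<in> vcarrier V \<Longrightarrow> \<phi> A (vscale V c u) = vscale V c (\<phi> A u)"
  unfolding \<phi>_def by (intro lm.act_scale_right sla_mem)

lemma \<phi>_zero: "trace A = 0 \<Longrightarrow> \<phi> A 0 = 0" "u \<in> vcarrier V \<Longrightarrow> \<phi> 0 u = 0"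
proof -
  show "trace A = 0 \<Longrightarrow> \<phi> A 0 = 0" using \<phi>_scale_right[of A 0 0] by simp
  have "mscale 0 (0 :: complex ^ 'n ^ 'n) = 0" by (simp add: mscale_def vec_eq_iff)
  then show "u \<in> vcarrier V \<Longrightarrow> \<phi> 0 u = 0" using \<phi>_scale_left[of 0 u 0] by simp
qed

lemma \<phi>_bracket:
  "trace A = 0 \<Longrightarrow> trace B = 0 \<Longrightarrow> u \<in> vcarrier V \<Longrightarrow>
    \<phi> (A ** B - B ** A) u = \<phi> A (\<phi> B u) - \<phi> B (\<phi> A u)"
  unfolding \<phi>_def using lm.act_bracket[OF sla_mem sla_mem, of A B u 0 0] by (simp add: sla_bracket_def)

lemma \<phi>_diff_left:
  assumes "trace A = 0" "trace B = 0" "u \<in> vcarrier V"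
  shows "\<phi> (A - B) u = \<phi> A u - \<phi> B u"
proof -
  have "trace (A - B) = 0" using assms by (simp add: trace_sub)
  from \<phi>_add_left[OF this assms(2,3)] show ?thesis by simp
qed

lemma \<phi>_sum_left:
  assumes "\<And>i. i \<in> S \<Longrightarrow> trace (A i) = 0" "u \<in> vcarrier V" "finite S"
  shows "trace (\<Sum>i\<in>S. A i) = 0 \<and> \<phi> (\<Sum>i\<in>S. A i) u = (\<Sum>i\<in>S. \<phi> (A i) u)"
  using assms(3,1)
proof (induction S rule: finite_induct)
  case (insert i S)
  then show ?case by (simp add: \<phi>_add_left[OF _ _ assms(2)] trace_add)
qed (simp add: \<phi>_zero assms(2))

text \<open>The matrix part of the action of \<open>d\<^sub>a\<^sub>b(r)\<close> is the expansion of \<open>r u\<^sup>T\<close> in matrix units, where \<open>u\<close> is the direction of the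
  field.\<close>

lemma \<phi>_outer_dab:
  assumes u: "u \<in> vcarrier V"
  shows "(\<Sum>i\<in>UNIV - {a}. vscale V (of_int (r $ i) * of_int (r $ b)) (\<phi> (matrix_unit i a) u))
      - (\<Sum>i\<in>UNIV - {b}. vscale V (of_int (r $ i) * of_int (r $ a)) (\<phi> (matrix_unit i b) u))
      + vscale V (of_int (r $ a) * of_int (r $ b)) (\<phi> (matrix_unit a a - matrix_unit b b) u)
    = \<phi> (outer r (dab a b r)) u"
proof -
  have tr: "trace (matrix_unit i j :: complex ^ 'n ^ 'n) = (if i = j then 1 else 0)" for i j
  proof -
    have "trace (matrix_unit i j :: complex ^ 'n ^ 'n) = (\<Sum>k\<in>UNIV. if k = i then (if i = j then 1 else 0) else 0)"
      unfolding trace_def matrix_unit_def by (intro sum.cong) auto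
    then show ?thesis by simp
  qed
  define S where "S a b = (\<Sum>i\<in>UNIV - {a}. mscale (of_int (r $ i) * of_int (r $ b)) (matrix_unit i a :: complex ^ 'n ^ 'n))" for a b
  have S: "trace (S a b) = 0"
    "\<phi> (S a b) u = (\<Sum>i\<in>UNIV - {a}. vscale V (of_int (r $ i) * of_int (r $ b)) (\<phi> (matrix_unit i a) u))" for a b
    using \<phi>_sum_left[of "UNIV - {a}" "\<lambda>i. mscale (of_int (r $ i) * of_int (r $ b)) (matrix_unit i a)" u] u
    unfolding S_def by (auto simp: tr \<phi>_scale_left)
  define D where "D = mscale (of_int (r $ a) * of_int (r $ b)) (matrix_unit a a - matrix_unit b b :: complex ^ 'n ^ 'n)"
  have D: "trace D = 0" "\<phi> D u = vscale V (of_int (r $ a) * of_int (r $ b)) (\<phi> (matrix_unit a a - matrix_unit b b) u)"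
    using u by (simp_all add: D_def tr trace_sub \<phi>_scale_left)
  have entry: "S a b $ k $ l = (if l = a \<and> k \<noteq> a then of_int (r $ k) * of_int (r $ b) else 0)" for a b k l
  proof -
    have "S a b $ k $ l = (\<Sum>i\<in>UNIV - {a}. if i = k then (if l = a then of_int (r $ k) * of_int (r $ b) else 0) else 0)"
      unfolding S_def sum_component by (intro sum.cong) (auto simp: mscale_def matrix_unit_def)
    then show ?thesis by simp
  qed
  have "outer r (dab a b r) = S a b - S b a + D"
    by (simp add: vec_eq_iff entry) (auto simp: outer_def dab_component D_def mscale_def matrix_unit_def algebra_simps)
  then show ?thesis
    using S[of a b] S[of b a] D u by (simp add: \<phi>_add_left \<phi>_diff_left trace_sub)
qed

text \<open>The coefficient of \<open>t\<^sup>r\<^sup>+\<^sup>s\<close> in the action of \<open>t\<^sup>r (u \<cdot> d)\<close> on \<open>t\<^sup>s \<otimes> w\<close>, for a shift \<open>\<nu>\<close>.\<close>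

definition coef_op :: "complex ^ 'n \<Rightarrow> int ^ 'n \<Rightarrow> complex ^ 'n \<Rightarrow> int ^ 'n \<Rightarrow> 'v \<Rightarrow> 'v" where
  "coef_op \<nu> r u s w = vscale V (dot u s + cdot u \<nu>) w + \<phi> (outer r u) w"

lemma coef_op_closed: "dot u r = 0 \<Longrightarrow> w \<in> vcarrier V \<Longrightarrow> coef_op \<nu> r u s w \<in> vcarrier V"
  unfolding coef_op_def by (intro lm.subspace_add[OF sub] lm.subspace_scale[OF sub] \<phi>_closed) (simp_all add: trace_outer)

lemma coef_op_add:
  "dot u r = 0 \<Longrightarrow> w \<in> vcarrier V \<Longrightarrow> w' \<in> vcarrier V \<Longrightarrow>
    coef_op \<nu> r u s (w + w') = coef_op \<nu> r u s w + coef_op \<nu> r u s w'"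
  "dot u r = 0 \<Longrightarrow> dot v r = 0 \<Longrightarrow> w \<in> vcarrier V \<Longrightarrow>
    coef_op \<nu> r (u + v) s w = coef_op \<nu> r u s w + coef_op \<nu> r v s w"
  by (simp_all add: coef_op_def \<phi>_add_right \<phi>_add_left trace_outer lm.scale_right_distrib
      lm.scale_left_distrib outer_linear dot_simps cdot_simps add_ac)

lemma coef_op_scale:
  "dot u r = 0 \<Longrightarrow> w \<in> vcarrier V \<Longrightarrow> coef_op \<nu> r u s (vscale V c w) = vscale V c (coef_op \<nu> r u s w)"
  "dot u r = 0 \<Longrightarrow> w \<in> vcarrier V \<Longrightarrow> coef_op \<nu> r (c *s u) s w = vscale V c (coef_op \<nu> r u s w)"
  by (simp_all add: coef_op_def \<phi>_scale_right \<phi>_scale_left trace_outer lm.scale_right_distrib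
      outer_linear dot_simps cdot_simps distrib_left[symmetric] mult.commute)

lemma coef_op_zero: "dot u r = 0 \<Longrightarrow> coef_op \<nu> r u s 0 = 0" "w \<in> vcarrier V \<Longrightarrow> coef_op \<nu> r 0 s w = 0"
  by (simp_all add: coef_op_def \<phi>_zero trace_outer outer_linear cdot_simps)

text \<open>The contributions of the shifts enter only through the linear condition \<open>nu\<close>; three different shifts are allowed since the shift
  will depend on whether the degree is zero.\<close>

lemma coef_op_bracket:
  assumes d: "dot u r = 0" "dot v s = 0" and w: "w \<in> vcarrier V"
    and nu: "cdot (dot u s *s v - dot v r *s u) \<nu> = dot u s * cdot v \<nu>s - dot v r * cdot u \<nu>r"
  shows "coef_op \<nu> (r + s) (dot u s *s v - dot v r *s u) m w
    = coef_op \<nu>r r u (s + m) (coef_op \<nu>s s v m w) - coef_op \<nu>s s v (r + m) (coef_op \<nu>r r u m w)"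
proof -
  let ?A = "outer r u" and ?B = "outer s v"
  let ?x = "dot u s *s v - dot v r *s u"
  have tr: "trace ?A = 0" "trace ?B = 0" using d by (simp_all add: trace_outer)
  have trm: "trace (mscale c ?A) = 0" "trace (mscale c ?B) = 0" for c using tr by simp_all
  have "outer (r + s) ?x = (?A ** ?B - ?B ** ?A) + mscale (dot u s) ?B - mscale (dot v r) ?A"
    unfolding outer_mult by (simp add: vec_eq_iff outer_def mscale_def algebra_simps)
  moreover have trc: "trace (?A ** ?B - ?B ** ?A) = 0"
    by (simp add: trace_sub trace_mul_sym[of ?A])
  ultimately have \<phi>x: "\<phi> (outer (r + s) ?x) w
      = \<phi> ?A (\<phi> ?B w) - \<phi> ?B (\<phi> ?A w) + vscale V (dot u s) (\<phi> ?B w) - vscale V (dot v r) (\<phi> ?A w)"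
    using tr trm w by (simp add: \<phi>_add_left \<phi>_diff_left \<phi>_bracket \<phi>_scale_left trace_add)
  have c: "\<phi> ?A w \<in> vcarrier V" "\<phi> ?B w \<in> vcarrier V" "\<And>c. vscale V c w \<in> vcarrier V"
    using tr w sub by (auto intro: \<phi>_closed lm.subspace_scale)
  let ?e = "dot u m + cdot u \<nu>r" and ?f = "dot v m + cdot v \<nu>s"
  have 1: "coef_op \<nu>r r u (s + m) (coef_op \<nu>s s v m w)
      = vscale V ((dot u s + ?e) * ?f) w + vscale V (dot u s + ?e) (\<phi> ?B w) + vscale V ?f (\<phi> ?A w) + \<phi> ?A (\<phi> ?B w)"
    unfolding coef_op_def using tr w c
    by (simp add: \<phi>_add_right \<phi>_scale_right lm.scale_right_distrib dot_simps add.assoc)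
  have 2: "coef_op \<nu>s s v (r + m) (coef_op \<nu>r r u m w)
      = vscale V ((dot v r + ?f) * ?e) w + vscale V (dot v r + ?f) (\<phi> ?A w) + vscale V ?e (\<phi> ?B w) + \<phi> ?B (\<phi> ?A w)"
    unfolding coef_op_def using tr w c
    by (simp add: \<phi>_add_right \<phi>_scale_right lm.scale_right_distrib dot_simps add.assoc)
  have 3: "dot ?x m + cdot ?x \<nu> = (dot u s + ?e) * ?f - (dot v r + ?f) * ?e"
    unfolding nu by (simp add: dot_simps algebra_simps)
  show ?thesis
    unfolding 1 2 unfolding coef_op_def \<phi>x 3
    by (simp add: lm.scale_left_distrib lm.scale_left_diff_distrib)
qed

end

section \<open>Weight decompositions\<close>

text \<open>An invariant subspace contains the weight components of each of its elements: subtracting the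
  eigenvalue of one component removes it and multiplies another one by a nonzero scalar.\<close>

lemma (in complex_space) weight_components:
  assumes C: "subspace C" and D: "\<And>a u v. u \<in> C \<Longrightarrow> v \<in> C \<Longrightarrow> D a (u + v) = D a u + D a v"
      "\<And>a c u. u \<in> C \<Longrightarrow> D a (c \<cdot> u) = c \<cdot> D a u"
    and W: "subspace W" "W \<subseteq> C" "\<And>a u. u \<in> W \<Longrightarrow> D a u \<in> W"
    and "finite F"
    and x: "\<And>i. i \<in> F \<Longrightarrow> x i \<in> C" "\<And>i a. i \<in> F \<Longrightarrow> D a (x i) = w i a \<cdot> x i"
    and distinct: "\<And>i j. i \<in> F \<Longrightarrow> j \<in> F \<Longrightarrow> i \<noteq> j \<Longrightarrow> \<exists>a. w i a \<noteq> w j a"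
    and sum: "(\<Sum>i\<in>F. x i) \<in> W"
  shows "\<forall>i\<in>F. x i \<in> W"
  using \<open>finite F\<close> x distinct sum
proof (induction F arbitrary: x rule: finite_induct)
  case (insert j F)
  have D_sum: "D a (\<Sum>i\<in>S. f i) = (\<Sum>i\<in>S. D a (f i))" if "finite S" "\<And>i. i \<in> S \<Longrightarrow> f i \<in> C" for a S f
    using that
  proof (induction S rule: finite_induct)
    case empty
    then show ?case using D(2)[of 0 a 0] subspace_0[OF C] by simp
  next
    case (insert i S)
    then show ?case by (simp add: D(1) subspace_sum C)
  qed
  have mem: "(w i a - w j a) \<cdot> x i \<in> W" if i: "i \<in> F" for i a
  proof -
    let ?y = "\<Sum>i\<in>insert j F. x i"
    have "D a ?y - w j a \<cdot> ?y \<in> W"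
      using insert.prems(4) W by (intro subspace_diff subspace_scale) auto
    also have "D a ?y - w j a \<cdot> ?y = (\<Sum>i\<in>insert j F. (w i a - w j a) \<cdot> x i)"
      using insert by (subst D_sum)
        (auto simp: scale_sum_right sum_subtractf scale_left_diff_distrib scale_right_distrib)
    also have "\<dots> = (\<Sum>i\<in>F. (w i a - w j a) \<cdot> x i)"
      using insert.hyps by simp
    finally have s: "(\<Sum>i\<in>F. (w i a - w j a) \<cdot> x i) \<in> W" .
    have "\<forall>i\<in>F. (w i a - w j a) \<cdot> x i \<in> W"
    proof (rule insert.IH)
      show "(w i a - w j a) \<cdot> x i \<in> C" if "i \<in> F" for i
        using insert.prems(1) that C by (intro subspace_scale) auto
      show "D b ((w i a - w j a) \<cdot> x i) = w i b \<cdot> (w i a - w j a) \<cdot> x i" if "i \<in> F" for i b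
        using insert.prems(1,2) that by (simp add: D(2) mult.commute)
    qed (use insert.prems(3) s in auto)
    then show ?thesis using i by blast
  qed
  have F: "x i \<in> W" if i: "i \<in> F" for i
  proof -
    obtain a where "w i a \<noteq> w j a"
      using insert.prems(3)[of i j] i insert.hyps by auto
    then have "(1 / (w i a - w j a)) \<cdot> (w i a - w j a) \<cdot> x i = x i" by simp
    then show ?thesis using subspace_scale[OF W(1) mem[OF i, of a], of "1 / (w i a - w j a)"] by simp
  qed
  have "(\<Sum>i\<in>insert j F. x i) - (\<Sum>i\<in>F. x i) \<in> W"
    by (rule subspace_diff[OF W(1) insert.prems(4) subspace_sum[OF W(1) F]])
  then have "x j \<in> W" using insert.hyps by simp
  then show ?case using F by simp
qed simp


section \<open>The tensor modules\<close>

lemma jscale_vector_space: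
  assumes "module (jmult J)"
  shows "vector_space (jscale J)"
proof -
  interpret module "jmult J" by (rule assms)
  show ?thesis
    by unfold_locales
      (simp_all add: jscale_def scale_right_distrib scale_left_distrib lconst_add lconst_mult lconst_1)
qed

locale sla_scalar = sla_rep V for V :: "('n::finite, 'v::ab_group_add) sla_module" +
  fixes \<mu> lam :: "complex ^ 'n"
  assumes C_scalar: "u \<in> vcarrier V \<Longrightarrow> vact V (C_elem a) u = vscale V (\<mu> $ a) u"
    and two: "\<exists>a b :: 'n. a \<noteq> b"
begin

text \<open>Fields of degree zero are not commutators, so they may act with the shift \<open>lam\<close> while all other
  fields act with the shift \<open>\<mu>\<close>.\<close>

definition shift :: "int ^ 'n \<Rightarrow> complex ^ 'n" where
  "shift r = (if r = 0 then lam else \<mu>)"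

abbreviation gen_op :: "int ^ 'n \<Rightarrow> complex ^ 'n \<Rightarrow> int ^ 'n \<Rightarrow> 'v \<Rightarrow> 'v" where
  "gen_op r \<equiv> coef_op (shift r) r"

lemma shift_bracket:
  assumes "dot u r = 0" "dot v s = 0"
  shows "cdot (dot u s *s v - dot v r *s u) (shift (r + s)) = dot u s * cdot v (shift s) - dot v r * cdot u (shift r)"
proof -
  consider "r = 0" | "s = 0" | "r + s = 0" | "r \<noteq> 0" "s \<noteq> 0" "r + s \<noteq> 0" by blast
  then show ?thesis
  proof cases
    case 3
    then have "s = - r" by (simp add: eq_neg_iff_add_eq_0 add.commute)
    then have "dot u s = 0" "dot v r = 0"
      using assms dot_diff(2)[of u 0 r] dot_diff(2)[of v 0 r] by simp_all
    then show ?thesis by (simp add: cdot_simps)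
  qed (simp_all add: shift_def cdot_simps)
qed

lemmas gen_op_bracket = coef_op_bracket[OF _ _ _ shift_bracket]

text \<open>The action formulas for all fields \<open>t\<^sup>r (u \<cdot> d)\<close> at once, without choosing generators.\<close>

definition acts :: "('n, (int ^ 'n) \<Rightarrow>\<^sub>0 'v) AS_module \<Rightarrow> bool" where
  "acts M \<longleftrightarrow> jcarrier M = tensor_carrier (vcarrier V) \<and> jmult M = tensor_mult (vscale V) \<and> SN_module M \<and>
     (\<forall>r u s w. dot u r = 0 \<longrightarrow> w \<in> vcarrier V \<longrightarrow>
        jact M (vf r u) (Poly_Mapping.single s w) = Poly_Mapping.single (r + s) (gen_op r u s w))"

lemma gen_op_dab:
  assumes "w \<in> vcarrier V"
  shows "gen_op r (dab a b r) s w = vscale V (of_int (r $ b) * (of_int (s $ a) + \<mu> $ a) - of_int (r $ a) * (of_int (s $ b) + \<mu> $ b)) w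
    + \<phi> (outer r (dab a b r)) w"
proof (cases "r = 0")
  case True
  then show ?thesis using assms by (simp add: coef_op_def dab_def cdot_simps)
next
  case False
  have "dot (dab a b r) s + cdot (dab a b r) \<mu>
      = of_int (r $ b) * (of_int (s $ a) + \<mu> $ a) - of_int (r $ a) * (of_int (s $ b) + \<mu> $ b)"
    by (simp add: dot_dab) (simp add: dab_def cdot_simps algebra_simps)
  then show ?thesis using False by (simp add: coef_op_def shift_def)
qed

lemma formula_dab:
  assumes u: "u \<in> vcarrier V"
  shows "Poly_Mapping.single (r + s)
            (vscale V (of_int (r $ b) * (of_int (s $ a) + \<mu> $ a) - of_int (r $ a) * (of_int (s $ b) + \<mu> $ b)) u) +
           Poly_Mapping.single (r + s)
             ((\<Sum>i\<in>UNIV - {a}. vscale V (of_int (r $ i) * of_int (r $ b)) (vact V (matrix_unit i a, 0) u))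
              - (\<Sum>i\<in>UNIV - {b}. vscale V (of_int (r $ i) * of_int (r $ a)) (vact V (matrix_unit i b, 0) u))
              + vscale V (of_int (r $ a) * of_int (r $ b)) (vact V (matrix_unit a a - matrix_unit b b, 0) u))
      = Poly_Mapping.single (r + s) (gen_op r (dab a b r) s u)"
  unfolding gen_op_dab[OF u] using \<phi>_outer_dab[OF u, where a = a and b = b and r = r]
  by (simp add: \<phi>_def single_add)

lemma gen_op_deg: "w \<in> vcarrier V \<Longrightarrow> gen_op 0 (axis a 1) s w = vscale V (of_int (s $ a) + lam $ a) w"
  by (simp add: coef_op_def shift_def outer_linear \<phi>_zero)

lemma acts_is_tensor_module:
  assumes "acts M"
  shows "is_tensor_module lam V M"
  unfolding is_tensor_module_def
proof (intro conjI allI ballI exI[of _ \<mu>])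
  fix a and s :: "int ^ 'n" and u assume u: "u \<in> vcarrier V"
  show "jact M (deg_der a) (Poly_Mapping.single s u) = Poly_Mapping.single s (vscale V (of_int (s $ a) + lam $ a) u)"
    using assms u by (simp add: acts_def deg_der_vf gen_op_deg)
next
  show "let \<phi> = (\<lambda>A. vact V (A, 0)); \<iota> = (of_int :: int \<Rightarrow> complex) in
         \<forall>a b r s. \<forall>u\<in>vcarrier V.
           jact M (div_der a b r) (Poly_Mapping.single s u) =
           Poly_Mapping.single (r + s)
             (vscale V (\<iota> (r $ b) * (\<iota> (s $ a) + \<mu> $ a) - \<iota> (r $ a) * (\<iota> (s $ b) + \<mu> $ b)) u) +
           Poly_Mapping.single (r + s)
             ((\<Sum>i\<in>UNIV - {a}. vscale V (\<iota> (r $ i) * \<iota> (r $ b)) (\<phi> (matrix_unit i a) u))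
              - (\<Sum>i\<in>UNIV - {b}. vscale V (\<iota> (r $ i) * \<iota> (r $ a)) (\<phi> (matrix_unit i b) u))
              + vscale V (\<iota> (r $ a) * \<iota> (r $ b)) (\<phi> (matrix_unit a a - matrix_unit b b) u))"
    unfolding Let_def
  proof (intro allI ballI, unfold formula_dab)
    fix a b and r s :: "int ^ 'n" and u assume "u \<in> vcarrier V"
    then show "jact M (div_der a b r) (Poly_Mapping.single s u) = Poly_Mapping.single (r + s) (gen_op r (dab a b r) s u)"
      using assms by (simp add: acts_def div_der_vf dot_dab)
  qed
qed (use assms C_scalar in \<open>simp_all add: acts_def\<close>)

text \<open>The formulas are linear in \<open>u\<close>, so they pass from the directions of the \<open>d\<^sub>a\<close> and \<open>d\<^sub>a\<^sub>b(r)\<close> to all \<open>u\<close>.  The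
  scalars in the definition of a tensor module agree with \<open>\<mu>\<close> since \<open>V\<close> is not zero.\<close>

lemma is_tensor_module_acts:
  assumes M: "is_tensor_module lam V M" and ne: "vcarrier V \<noteq> {0}"
  shows "acts M"
proof -
  have c: "jcarrier M = tensor_carrier (vcarrier V)" "jmult M = tensor_mult (vscale V)" "SN_module M"
    and deg: "\<And>a s u. u \<in> vcarrier V \<Longrightarrow>
      jact M (deg_der a) (Poly_Mapping.single s u) = Poly_Mapping.single s (vscale V (of_int (s $ a) + lam $ a) u)"
    using M by (simp_all add: is_tensor_module_def)
  obtain \<mu>' where \<mu>': "\<And>a u. u \<in> vcarrier V \<Longrightarrow> vact V (C_elem a) u = vscale V (\<mu>' $ a) u"
    and div: "let \<phi> = (\<lambda>A. vact V (A, 0)); \<iota> = (of_int :: int \<Rightarrow> complex) in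
         \<forall>a b r s. \<forall>u\<in>vcarrier V.
           jact M (div_der a b r) (Poly_Mapping.single s u) =
           Poly_Mapping.single (r + s)
             (vscale V (\<iota> (r $ b) * (\<iota> (s $ a) + \<mu>' $ a) - \<iota> (r $ a) * (\<iota> (s $ b) + \<mu>' $ b)) u) +
           Poly_Mapping.single (r + s)
             ((\<Sum>i\<in>UNIV - {a}. vscale V (\<iota> (r $ i) * \<iota> (r $ b)) (\<phi> (matrix_unit i a) u))
              - (\<Sum>i\<in>UNIV - {b}. vscale V (\<iota> (r $ i) * \<iota> (r $ a)) (\<phi> (matrix_unit i b) u))
              + vscale V (\<iota> (r $ a) * \<iota> (r $ b)) (\<phi> (matrix_unit a a - matrix_unit b b) u))"
    using M unfolding is_tensor_module_def by blast
  obtain u0 where u0: "u0 \<in> vcarrier V" "u0 \<noteq> 0" using ne zero_mem by blast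
  have "\<mu>' $ a = \<mu> $ a" for a
  proof -
    have "vscale V (\<mu>' $ a) u0 = vscale V (\<mu> $ a) u0"
      by (rule trans[OF \<mu>'[OF u0(1), symmetric] C_scalar[OF u0(1)]])
    then show ?thesis by (rule lm.scale_right_imp_eq[OF u0(2)])
  qed
  then have "\<mu>' = \<mu>" by (simp add: vec_eq_iff)
  have div': "jact M (vf r (dab a b r)) (Poly_Mapping.single s w) = Poly_Mapping.single (r + s) (gen_op r (dab a b r) s w)"
    if "w \<in> vcarrier V" for a b r s w
    using div that unfolding \<open>\<mu>' = \<mu>\<close> Let_def div_der_vf[symmetric] formula_dab[OF that, symmetric] by blast
  interpret M: lie_module "jscale M" SN op_scale op_bracket "jcarrier M" "jact M"
    using c(3) by (simp add: SN_module_def)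
  have mem: "Poly_Mapping.single s w \<in> jcarrier M" if "w \<in> vcarrier V" for s w
    using that by (simp add: c)
  have sc: "jscale M k (Poly_Mapping.single s w) = Poly_Mapping.single s (vscale V k w)" for k s w
    by (simp add: jscale_def c lconst_def cs.tensor_mult_single)
  have "jact M (vf r u) (Poly_Mapping.single s w) = Poly_Mapping.single (r + s) (gen_op r u s w)"
    if ru: "dot u r = 0" and w: "w \<in> vcarrier V" for r u s w
  proof (cases "r = 0")
    case True
    have "jact M (vf 0 u) (Poly_Mapping.single s w) = Poly_Mapping.single s (gen_op 0 u s w)"
    proof (rule vec_axis_induct[where P = "\<lambda>u. jact M (vf 0 u) (Poly_Mapping.single s w) = Poly_Mapping.single s (gen_op 0 u s w)"])
      show "jact M (vf 0 (axis a 1)) (Poly_Mapping.single s w) = Poly_Mapping.single s (gen_op 0 (axis a 1) s w)" for a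
        using deg[OF w] w by (simp add: deg_der_vf gen_op_deg)
    qed (simp_all add: vf_add vf_scale M.act_add_left M.act_scale_left vf_in_SN[OF two] mem w sc coef_op_add coef_op_scale single_add)
    then show ?thesis using True by simp
  next
    case False
    then have "adm r u" using ru by (simp add: adm_def)
    then show ?thesis
    proof (rule adm_induct[where P = "\<lambda>u. jact M (vf r u) (Poly_Mapping.single s w) = Poly_Mapping.single (r + s) (gen_op r u s w)"])
    qed (simp_all add: div' vf_add vf_scale M.act_add_left M.act_scale_left vf_in_SN[OF two] adm_def mem w sc coef_op_add coef_op_scale single_add two)
  qed
  then show ?thesis using c by (simp add: acts_def)
qed

text \<open>The action of an arbitrary field is defined through its components \<open>cv X r\<close>, which depend only on \<open>X\<close>.  This makes it
  independent of a presentation of \<open>X\<close> by generators, and so well defined.\<close>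

definition tgen :: "('n laurent \<Rightarrow> 'n laurent) \<Rightarrow> int ^ 'n \<Rightarrow> 'v \<Rightarrow> ((int ^ 'n) \<Rightarrow>\<^sub>0 'v)" where
  "tgen X s w = (\<Sum>r\<in>{r. cv X r \<noteq> 0}. Poly_Mapping.single (r + s) (gen_op r (cv X r) s w))"

definition tact :: "('n laurent \<Rightarrow> 'n laurent) \<Rightarrow> ((int ^ 'n) \<Rightarrow>\<^sub>0 'v) \<Rightarrow> ((int ^ 'n) \<Rightarrow>\<^sub>0 'v)" where
  "tact X p = (\<Sum>s\<in>Poly_Mapping.keys p. tgen X s (Poly_Mapping.lookup p s))"

lemma tgen_superset:
  assumes "finite F" "{r. cv X r \<noteq> 0} \<subseteq> F" "w \<in> vcarrier V"
  shows "tgen X s w = (\<Sum>r\<in>F. Poly_Mapping.single (r + s) (gen_op r (cv X r) s w))"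
  unfolding tgen_def using assms by (intro sum.mono_neutral_left) (auto simp: coef_op_zero)

lemma tgen_linear:
  assumes X: "X \<in> SN" and w: "w \<in> vcarrier V"
  shows "w' \<in> vcarrier V \<Longrightarrow> tgen X s (w + w') = tgen X s w + tgen X s w'"
    "tgen X s 0 = 0"
    "Y \<in> SN \<Longrightarrow> tgen (X + Y) s w = tgen X s w + tgen Y s w"
    "tgen (op_scale c X) s w = tensor_mult (vscale V) (lconst c) (tgen X s w)"
    "tgen X s (vscale V c w) = tensor_mult (vscale V) (lconst c) (tgen X s w)"
    "tgen X s w \<in> tensor_carrier (vcarrier V)"
proof -
  note d = dot_cv[OF X]
  show "tgen X s 0 = 0" by (simp add: tgen_def coef_op_zero d)
  show "w' \<in> vcarrier V \<Longrightarrow> tgen X s (w + w') = tgen X s w + tgen X s w'"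
    by (simp add: tgen_def coef_op_add d w single_add sum.distrib)
  have m: "tensor_mult (vscale V) (lconst c) (\<Sum>r\<in>F. Poly_Mapping.single (r + s) (f r))
      = (\<Sum>r\<in>F. Poly_Mapping.single (r + s) (vscale V c (f r)))" for F :: "(int ^ 'n) set" and f
    by (induction F rule: infinite_finite_induct) (simp_all add: cs.tensor_mult_add cs.tensor_mult_single lconst_def)
  show "tgen X s (vscale V c w) = tensor_mult (vscale V) (lconst c) (tgen X s w)"
    by (simp add: tgen_def m coef_op_scale d w)
  have F: "finite {r. cv X r \<noteq> 0}" by (rule finite_cv)
  have "{r. cv (op_scale c X) r \<noteq> 0} \<subseteq> {r. cv X r \<noteq> 0}" by (auto simp: cv_scale)
  from tgen_superset[OF F this w] show "tgen (op_scale c X) s w = tensor_mult (vscale V) (lconst c) (tgen X s w)"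
    by (simp add: tgen_superset[OF F order_refl w] m cv_scale coef_op_scale d w)
  show "tgen (X + Y) s w = tgen X s w + tgen Y s w" if Y: "Y \<in> SN"
  proof -
    let ?F = "{r. cv X r \<noteq> 0} \<union> {r. cv Y r \<noteq> 0}"
    have F: "finite ?F" by (simp add: finite_cv)
    have sub: "{r. cv X r \<noteq> 0} \<subseteq> ?F" "{r. cv Y r \<noteq> 0} \<subseteq> ?F" "{r. cv (X + Y) r \<noteq> 0} \<subseteq> ?F"
      by (auto simp: cv_add)
    show ?thesis
      unfolding sub[THEN tgen_superset[OF F _ w]]
      by (simp add: cv_add coef_op_add d dot_cv[OF Y] w single_add sum.distrib)
  qed
  show "tgen X s w \<in> tensor_carrier (vcarrier V)"
    unfolding tgen_def using w d by (intro cs.tensor_carrier_sum sub) (simp add: coef_op_closed)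
qed

lemma tgen_vf:
  assumes "dot u r = 0" "w \<in> vcarrier V"
  shows "tgen (vf r u) s w = Poly_Mapping.single (r + s) (gen_op r u s w)"
proof -
  have "{q. cv (vf r u) q \<noteq> 0} \<subseteq> {r}" by (auto simp: cv_vf split: if_splits)
  from tgen_superset[OF _ this assms(2)] show ?thesis by (simp add: cv_vf)
qed

lemma tact_add:
  assumes X: "X \<in> SN" and pq: "p \<in> tensor_carrier (vcarrier V)" "q \<in> tensor_carrier (vcarrier V)"
  shows "tact X (p + q) = tact X p + tact X q"
  unfolding tact_def
  by (rule setsum_keys_plus_distrib) (use pq in \<open>simp_all add: tgen_linear(1)[OF X] tgen_linear(2)[OF X zero_mem] tensor_carrier_def\<close>)

lemma tact_single: "X \<in> SN \<Longrightarrow> w \<in> vcarrier V \<Longrightarrow> tact X (Poly_Mapping.single s w) = tgen X s w"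
  by (cases "w = 0") (simp_all add: tact_def tgen_linear(2)[of X 0])

lemma tact_closed:
  assumes "X \<in> SN" "p \<in> tensor_carrier (vcarrier V)"
  shows "tact X p \<in> tensor_carrier (vcarrier V)"
proof -
  have "tgen X s (Poly_Mapping.lookup p s) \<in> tensor_carrier (vcarrier V)" for s
    using assms(2) by (intro tgen_linear(6)[OF assms(1)]) (simp add: tensor_carrier_def)
  then show ?thesis unfolding tact_def by (intro cs.tensor_carrier_sum sub)
qed

definition tensor_module :: "('n, (int ^ 'n) \<Rightarrow>\<^sub>0 'v) AS_module" where
  "tensor_module = \<lparr>jcarrier = tensor_carrier (vcarrier V), jmult = tensor_mult (vscale V), jact = tact\<rparr>"

lemma tact_bracket_vf:
  assumes "dot u r = 0" "dot v s = 0" "w \<in> vcarrier V"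
  shows "tact (op_bracket (vf r u) (vf s v)) (Poly_Mapping.single m w)
    = tact (vf r u) (tact (vf s v) (Poly_Mapping.single m w)) - tact (vf s v) (tact (vf r u) (Poly_Mapping.single m w))"
proof -
  have x: "dot (dot u s *s v - dot v r *s u) (r + s) = 0"
    using assms by (simp add: dot_simps)
  note S = vf_in_SN[OF two]
  show ?thesis
    using assms x
    by (simp add: op_bracket_vf tact_single S tgen_vf coef_op_closed gen_op_bracket single_diff add.assoc add.left_commute[of s r])
qed

lemma tensor_module_SN: "SN_module tensor_module"
  unfolding SN_module_def
proof (rule lie_module.intro)
  have js: "jscale tensor_module = (\<lambda>c. tensor_mult (vscale V) (lconst c))"
    by (auto simp: fun_eq_iff jscale_def tensor_module_def)
  let ?T = "tensor_carrier (vcarrier V)"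
  show vs: "vector_space (jscale tensor_module)"
    by (rule jscale_vector_space) (simp add: tensor_module_def cs.tensor_module)
  then interpret js: vector_space "jscale tensor_module" .
  note addc = cs.tensor_carrier_add[OF sub]
  have m_closed: "tensor_mult (vscale V) f p \<in> ?T" if "p \<in> ?T" for f p
    by (rule cs.tensor_mult_closed[OF sub that])
  have add_left: "tact (X + Y) p = tact X p + tact Y p" if "X \<in> SN" "Y \<in> SN" "p \<in> ?T" for X Y p
    using that(3) unfolding tact_def by (simp add: tgen_linear(3)[OF that(1) _ that(2)] tensor_carrier_def sum.distrib)
  have m_sum: "tensor_mult (vscale V) f (sum g A) = (\<Sum>a\<in>A. tensor_mult (vscale V) f (g a))" for f g and A :: "(int ^ 'n) set"
    by (induction A rule: infinite_finite_induct) (simp_all add: cs.tensor_mult_add)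
  have scale_left: "tact (op_scale c X) p = tensor_mult (vscale V) (lconst c) (tact X p)" if "X \<in> SN" "p \<in> ?T" for c X p
    using that(2) unfolding tact_def m_sum by (simp add: tgen_linear(4)[OF that(1)] tensor_carrier_def)
  have scale_right: "tact X (tensor_mult (vscale V) (lconst c) p) = tensor_mult (vscale V) (lconst c) (tact X p)"
    if X: "X \<in> SN" and p: "p \<in> ?T" for c X p
    using p zero_mem
  proof (induction p rule: tensor_carrier_induct)
    case zero
    then show ?case by (simp add: tact_def)
  next
    case (single s v)
    then show ?case using X
      by (simp add: lconst_def cs.tensor_mult_single tact_single lm.subspace_scale[OF sub])
        (simp add: tgen_linear lconst_def)
  next
    case (add p q)
    then show ?case using X by (simp add: cs.tensor_mult_add tact_add m_closed)
  qed
  have bracket: "tact (op_bracket X Y) p = tact X (tact Y p) - tact Y (tact X p)"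
    if X: "X \<in> SN" and Y: "Y \<in> SN" and p: "p \<in> ?T" for X Y p
    using p zero_mem
  proof (induction p rule: tensor_carrier_induct)
    case zero
    then show ?case by (simp add: tact_def)
  next
    case (add p q)
    then show ?case using X Y by (simp add: tact_add SN_bracket[OF two] tact_closed add_diff_add)
  next
    case (single s w)
    have w: "Poly_Mapping.single s w \<in> ?T" using single by simp
    show ?case
    proof (rule SN_induct[OF X, where P = "\<lambda>X. tact (op_bracket X Y) (Poly_Mapping.single s w)
        = tact X (tact Y (Poly_Mapping.single s w)) - tact Y (tact X (Poly_Mapping.single s w))"])
      fix r and u :: "complex ^ 'n" assume u: "dot u r = 0" "vf r u \<in> SN"
      show "tact (op_bracket (vf r u) Y) (Poly_Mapping.single s w)
        = tact (vf r u) (tact Y (Poly_Mapping.single s w)) - tact Y (tact (vf r u) (Poly_Mapping.single s w))"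
      proof (rule SN_induct[OF Y, where P = "\<lambda>Y. tact (op_bracket (vf r u) Y) (Poly_Mapping.single s w)
        = tact (vf r u) (tact Y (Poly_Mapping.single s w)) - tact Y (tact (vf r u) (Poly_Mapping.single s w))"])
        show "tact (op_bracket (vf r u) (vf q v)) (Poly_Mapping.single s w)
          = tact (vf r u) (tact (vf q v) (Poly_Mapping.single s w)) - tact (vf q v) (tact (vf r u) (Poly_Mapping.single s w))"
          if "dot v q = 0" for q v by (rule tact_bracket_vf[OF u(1) that single])
      qed (simp_all add: op_bracket_linear u add_left scale_left SN_bracket[OF two] w tact_closed tact_add
          scale_right add_diff_add cs.tensor_mult_add module.scale_right_diff_distrib[OF cs.tensor_module])
    qed (simp_all add: op_bracket_linear Y add_left scale_left SN_bracket[OF two] w tact_closed tact_add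
          scale_right add_diff_add cs.tensor_mult_add module.scale_right_diff_distrib[OF cs.tensor_module])
  qed
  show "lie_module_axioms (jscale tensor_module) SN op_scale op_bracket (jcarrier tensor_module) (jact tensor_module)"
  proof (unfold_locales, goal_cases)
    case 1
    have "0 \<in> ?T" by (simp add: tensor_carrier_def)
    then show ?case
      by (subst js.subspace_def, unfold js) (auto simp: tensor_module_def addc m_closed)
  qed (simp_all add: tensor_module_def js[unfolded tensor_module_def] tact_closed tact_add add_left scale_left scale_right bracket)
qed

lemma acts_tensor_module: "acts tensor_module"
  using tensor_module_SN tact_single[OF vf_in_SN[OF two]] tgen_vf
  by (auto simp: acts_def tensor_module_def)

end

section \<open>Tensor modules are irreducible objects of the category\<close>

locale tensor_rep = sla_scalar V \<mu> lam
  for V :: "('n::finite, 'v::ab_group_add) sla_module" and \<mu> lam :: "complex ^ 'n" +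
  fixes M :: "('n, (int ^ 'n) \<Rightarrow>\<^sub>0 'v) AS_module"
  assumes acts_M: "acts M"
begin

lemma carrier: "jcarrier M = tensor_carrier (vcarrier V)" and mult: "jmult M = tensor_mult (vscale V)"
  and SN_mod: "SN_module M"
  and act_vf: "dot u r = 0 \<Longrightarrow> w \<in> vcarrier V \<Longrightarrow>
    jact M (vf r u) (Poly_Mapping.single s w) = Poly_Mapping.single (r + s) (gen_op r u s w)"
  using acts_M by (simp_all add: acts_def)

sublocale J: lie_module "jscale M" SN op_scale op_bracket "jcarrier M" "jact M"
  using SN_mod by (simp add: SN_module_def)

sublocale Jc: complex_space "jscale M"
  by (rule complex_space.intro) (rule J.vector_space_axioms)

sublocale Jm: module "jmult M"
  unfolding mult by (rule cs.tensor_module)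

lemma jscale_single: "jscale M c (Poly_Mapping.single s w) = Poly_Mapping.single s (vscale V c w)"
  by (simp add: jscale_def mult lconst_def cs.tensor_mult_single)

lemma mult_single: "jmult M (Poly_Mapping.single r c) (Poly_Mapping.single s w) = Poly_Mapping.single (r + s) (vscale V c w)"
  by (simp add: mult cs.tensor_mult_single)

lemma single_mem [simp]: "Poly_Mapping.single s w \<in> jcarrier M \<longleftrightarrow> w \<in> vcarrier V"
  by (simp add: carrier)

lemma Jm_subspace: "Jm.subspace (jcarrier M)"
  unfolding carrier mult by (rule cs.tensor_carrier_subspace[OF sub])

lemma act_deg: "w \<in> vcarrier V \<Longrightarrow>
    jact M (deg_der a) (Poly_Mapping.single s w) = jscale M (of_int (s $ a) + lam $ a) (Poly_Mapping.single s w)"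
  by (simp add: deg_der_vf act_vf gen_op_deg jscale_single)

lemma deg_der_SN: "deg_der a \<in> (SN :: ('n laurent \<Rightarrow> 'n laurent) set)"
  unfolding deg_der_vf by (rule vf_in_SN[OF two]) simp

lemma carrier_induct [consumes 1, case_names zero single add]:
  assumes "p \<in> jcarrier M" "P 0" "\<And>s w. w \<in> vcarrier V \<Longrightarrow> P (Poly_Mapping.single s w)"
    "\<And>p q. p \<in> jcarrier M \<Longrightarrow> q \<in> jcarrier M \<Longrightarrow> P p \<Longrightarrow> P q \<Longrightarrow> P (p + q)"
  shows "P p"
  using tensor_carrier_induct[of p "vcarrier V" P] assms by (simp add: carrier)

lemma act_zero: "X \<in> SN \<Longrightarrow> jact M X 0 = 0"
  using J.act_scale_right[of X 0 0] J.subspace_0[OF J.carrier_subspace] by simp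

text \<open>On monomials this is the fact that moving from \<open>t\<^sup>s\<close> to \<open>t\<^sup>q\<^sup>+\<^sup>s\<close> changes the coefficient of the action of
  \<open>t\<^sup>r (u \<cdot> d)\<close> by \<open>u \<cdot> q\<close>.\<close>

lemma leibniz:
  assumes X: "X \<in> SN" and p: "p \<in> jcarrier M"
  shows "jact M X (jmult M f p) = jmult M (X f) p + jmult M f (jact M X p)"
proof -
  have closed: "jmult M f p \<in> jcarrier M" if "p \<in> jcarrier M" for f p
    using Jm.subspace_scale[OF Jm_subspace that] .
  note Xf = SN_linear[OF X]
  have op_scale_apply: "op_scale c Y g = lconst c * Y g" for c Y g
    by (simp add: op_scale_def)
  have X0: "X 0 = 0" using SN_linear(2)[OF X, of 0 0] by (simp add: lconst_0)
  show ?thesis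
    using p
  proof (induction p rule: carrier_induct)
    case zero
    then show ?case by (simp add: act_zero X)
  next
    case (add p q)
    then show ?case by (simp add: J.act_add_right X closed Jm.scale_right_distrib add_ac)
  next
    case (single s w)
    show ?case
    proof (induction f rule: laurent_induct)
      case zero
      then show ?case by (simp add: act_zero X X0)
    next
      case (add f g)
      then show ?case
        using single by (simp add: J.act_add_right X closed Jm.scale_left_distrib Xf add_ac)
    next
      case (single q c)
      let ?f = "Poly_Mapping.single q c" and ?p = "Poly_Mapping.single s w"
      have w: "?p \<in> jcarrier M" "w \<in> vcarrier V" using \<open>w \<in> vcarrier V\<close> by simp_all
      have cw: "vscale V c w \<in> vcarrier V" using w by (simp add: lm.subspace_scale[OF sub])
      show ?case
      proof (rule SN_induct[OF X, where P = "\<lambda>X. jact M X (jmult M ?f ?p) = jmult M (X ?f) ?p + jmult M ?f (jact M X ?p)"])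
        fix r and u :: "complex ^ 'n" assume u: "dot u r = 0" "vf r u \<in> SN"
        have "gen_op r u (q + s) (vscale V c w) = vscale V (dot u q * c) w + vscale V c (gen_op r u s w)"
          using u w(2) by (simp add: coef_op_scale) (simp add: coef_op_def dot_simps lm.scale_right_distrib lm.scale_left_distrib algebra_simps)
        then show "jact M (vf r u) (jmult M ?f ?p) = jmult M (vf r u ?f) ?p + jmult M ?f (jact M (vf r u) ?p)"
          using u w cw by (simp add: mult_single act_vf vf_single single_add add.assoc add.left_commute[of q r])
      next
        fix X Y :: "'n laurent \<Rightarrow> 'n laurent" assume "X \<in> SN" "Y \<in> SN"
          "jact M X (jmult M ?f ?p) = jmult M (X ?f) ?p + jmult M ?f (jact M X ?p)"
          "jact M Y (jmult M ?f ?p) = jmult M (Y ?f) ?p + jmult M ?f (jact M Y ?p)"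
        then show "jact M (X + Y) (jmult M ?f ?p) = jmult M ((X + Y) ?f) ?p + jmult M ?f (jact M (X + Y) ?p)"
          using closed[OF w(1)] w(1)
          by (simp only: J.act_add_left Jm.scale_right_distrib Jm.scale_left_distrib plus_fun_apply add_ac)
      next
        fix d and X :: "'n laurent \<Rightarrow> 'n laurent" assume "X \<in> SN"
          "jact M X (jmult M ?f ?p) = jmult M (X ?f) ?p + jmult M ?f (jact M X ?p)"
        then show "jact M (op_scale d X) (jmult M ?f ?p) = jmult M (op_scale d X ?f) ?p + jmult M ?f (jact M (op_scale d X) ?p)"
          using closed[OF w(1)] w(1) op_scale_apply[of d X ?f]
          by (simp only: J.act_scale_left Jm.scale_right_distrib jscale_def Jm.scale_scale mult.commute)
      qed
    qed
  qed
qed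

lemma eigenbasis: "diagonalizable_on (jscale M) (jcarrier M) (jact M (deg_der a))"
proof -
  define E where "E = {p \<in> jcarrier M. \<exists>c. jact M (deg_der a) p = jscale M c p}"
  obtain B where B: "B \<subseteq> E" "J.independent B" "E \<subseteq> J.span B"
    by (rule J.maximal_independent_subset)
  have "p \<in> J.span B" if "p \<in> jcarrier M" for p
    using that
  proof (induction p rule: carrier_induct)
    case (single s w)
    then have "Poly_Mapping.single s w \<in> E" using act_deg by (auto simp: E_def)
    then show ?case using B(3) by blast
  qed (simp_all add: J.span_zero J.span_add)
  moreover have "J.span B \<subseteq> jcarrier M"
    using B(1) by (intro J.span_minimal J.carrier_subspace) (auto simp: E_def)
  ultimately have "J.span B = jcarrier M" by blast
  then show ?thesis
    using B unfolding diagonalizable_on_def by (intro exI[of _ B]) (auto simp: E_def)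
qed

lemma lookup_act_deg:
  assumes "p \<in> jcarrier M"
  shows "Poly_Mapping.lookup (jact M (deg_der a) p) s = vscale V (of_int (s $ a) + lam $ a) (Poly_Mapping.lookup p s)"
  using assms
proof (induction p rule: carrier_induct)
  case zero
  then show ?case by (simp add: act_zero deg_der_SN)
next
  case (single r w)
  then show ?case by (simp add: act_deg jscale_single lookup_single when_def)
next
  case (add p q)
  then show ?case by (simp add: J.act_add_right deg_der_SN lookup_add lm.scale_right_distrib)
qed

lemma lookup_jscale: "Poly_Mapping.lookup (jscale M c p) s = vscale V c (Poly_Mapping.lookup p s)"
  by (simp only: jscale_def mult cs.lookup_tensor_mult_lconst)

lemma weights_M: "weights M \<subseteq> {lam + (\<chi> a. of_int (r $ a)) | r :: int ^ 'n. True}"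
proof
  fix \<nu> assume "\<nu> \<in> weights M"
  then obtain p where p: "p \<in> jcarrier M" "p \<noteq> 0" "\<And>a. jact M (deg_der a) p = jscale M (\<nu> $ a) p"
    by (auto simp: weights_def)
  note act = lookup_act_deg[OF p(1)]
  obtain s where s: "Poly_Mapping.lookup p s \<noteq> 0" using p(2) by (metis lookup_zero poly_mapping_eqI)
  have "\<nu> $ a = of_int (s $ a) + lam $ a" for a
  proof (rule lm.scale_right_imp_eq[OF s])
    show "vscale V (\<nu> $ a) (Poly_Mapping.lookup p s) = vscale V (of_int (s $ a) + lam $ a) (Poly_Mapping.lookup p s)"
      using act[of a s] unfolding p(3) by (simp only: jscale_def mult cs.lookup_tensor_mult_lconst)
  qed
  then have "\<nu> = lam + (\<chi> a. of_int (s $ a))" by (simp add: vec_eq_iff)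
  then show "\<nu> \<in> {lam + (\<chi> a. of_int (r $ a)) | r :: int ^ 'n. True}" by blast
qed

lemma lookup_mult_single_0: "Poly_Mapping.lookup (jmult M f (Poly_Mapping.single 0 w)) s = vscale V (Poly_Mapping.lookup f s) w"
proof (induction f rule: laurent_induct)
  case (single r c)
  then show ?case by (simp add: mult_single lookup_single when_def)
qed (simp_all add: Jm.scale_left_distrib lookup_add lm.scale_left_distrib)

text \<open>A basis of \<open>V\<close>, placed in degree zero, is a basis over the Laurent polynomials: the coefficients of \<open>t\<^sup>s\<close> in a relation are a
  relation in \<open>V\<close>.\<close>

lemma free_basis:
  assumes "finite B0" "lm.span B0 = vcarrier V"
  shows "\<exists>B. finite B \<and> \<not> Jm.dependent B \<and> Jm.span B = jcarrier M"
proof -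
  obtain B where B: "B \<subseteq> B0" "lm.independent B" "B0 \<subseteq> lm.span B"
    by (rule lm.maximal_independent_subset)
  have BV: "B \<subseteq> vcarrier V" using B(1) assms(2) lm.span_superset by blast
  have "lm.span B = vcarrier V"
    using B(3) assms(2) lm.span_minimal[OF B(3) lm.subspace_span] lm.span_minimal[OF BV sub] by blast
  let ?e = "Poly_Mapping.single (0 :: int ^ 'n)"
  have "finite (?e ` B)" using finite_subset[OF B(1) assms(1)] by simp
  moreover have "\<not> Jm.dependent (?e ` B)"
  proof
    assume "Jm.dependent (?e ` B)"
    then obtain t U p where t: "finite t" "t \<subseteq> ?e ` B" "(\<Sum>v\<in>t. jmult M (U v) v) = 0" "p \<in> t" "U p \<noteq> 0"
      unfolding Jm.dependent_explicit by blast
    obtain T where T: "T \<subseteq> B" "t = ?e ` T" using t(2) subset_imageE by metis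
    have inj: "inj_on ?e T" by (auto simp: inj_on_def dest: arg_cong[of _ _ "\<lambda>p. Poly_Mapping.lookup p 0"])
    have finT: "finite T" using t(1) T(2) inj by (simp add: finite_image_iff)
    have "Poly_Mapping.lookup (U (?e b)) s = 0" if b: "b \<in> T" for b s
    proof (rule lm.independentD[OF B(2) finT T(1) _ b])
      have "0 = Poly_Mapping.lookup (\<Sum>v\<in>t. jmult M (U v) v) s" by (simp add: t(3))
      also have "\<dots> = (\<Sum>b\<in>T. vscale V (Poly_Mapping.lookup (U (?e b)) s) b)"
        unfolding T(2) by (simp add: sum.reindex[OF inj] lookup_sum lookup_mult_single_0)
      finally show "(\<Sum>b\<in>T. vscale V (Poly_Mapping.lookup (U (?e b)) s) b) = 0" by simp
    qed
    then have "U p = 0" using t(4) T(2) by (auto intro: poly_mapping_eqI)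
    then show False using t(5) by simp
  qed
  moreover have "Jm.span (?e ` B) = jcarrier M"
  proof
    show "Jm.span (?e ` B) \<subseteq> jcarrier M"
      using BV by (intro Jm.span_minimal Jm_subspace) auto
    have "Poly_Mapping.single s w \<in> Jm.span (?e ` B)" if "w \<in> lm.span B" for s w
      using that
    proof (induction rule: lm.span_induct_alt)
      case base
      then show ?case by (simp add: Jm.span_zero)
    next
      case (step c x y)
      have "Poly_Mapping.single s (vscale V c x) = jmult M (Poly_Mapping.single s c) (?e x)"
        by (simp add: mult_single)
      moreover have "\<dots> \<in> Jm.span (?e ` B)"
        using step(1) by (intro Jm.span_scale Jm.span_base) auto
      ultimately show ?case using step(2) by (simp add: single_add Jm.span_add)
    qed
    then show "jcarrier M \<subseteq> Jm.span (?e ` B)"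
      using \<open>lm.span B = vcarrier V\<close>
      by (auto intro: Jm.span_zero Jm.span_add elim: carrier_induct)
  qed
  ultimately show ?thesis by blast
qed

lemma in_category:
  assumes "finite B0" "lm.span B0 = vcarrier V"
  shows "category_J_at lam M"
  unfolding category_J_at_def category_J_def
  using Jm.module_axioms Jm_subspace SN_mod eigenbasis free_basis[OF assms] leibniz weights_M by blast

lemma vact_pair:
  assumes "trace A = 0" "w \<in> vcarrier V"
  shows "vact V (A, c) w = \<phi> A w + vscale V (cdot c \<mu>) w"
proof -
  have "vact V (0, c) w = vscale V (cdot c \<mu>) w"
  proof (rule vec_axis_induct[where P = "\<lambda>c. vact V (0, c) w = vscale V (cdot c \<mu>) w"])
    show "vact V (0, axis a 1) w = vscale V (cdot (axis a 1) \<mu>) w" for a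
      using C_scalar[OF assms(2), of a] by (simp add: C_elem_def)
    show "vact V (0, u + v) w = vscale V (cdot (u + v) \<mu>) w"
      if "vact V (0, u) w = vscale V (cdot u \<mu>) w" "vact V (0, v) w = vscale V (cdot v \<mu>) w" for u v
      using lm.act_add_left[OF sla_mem sla_mem assms(2), of 0 0 u v] that
      by (simp add: cdot_simps lm.scale_left_distrib)
    show "vact V (0, k *s u) w = vscale V (cdot (k *s u) \<mu>) w"
      if "vact V (0, u) w = vscale V (cdot u \<mu>) w" for k u
    proof -
      have "mscale k (0 :: complex ^ 'n ^ 'n) = 0" by (simp add: mscale_def vec_eq_iff)
      then show ?thesis
        using lm.act_scale_left[OF sla_mem assms(2), of 0 k u] that by (simp add: cdot_simps sla_scale_pair)
    qed
  qed
  then show ?thesis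
    using lm.act_add_left[OF sla_mem[of A 0] sla_mem[of 0 c] assms(2)] assms(1) by (simp add: \<phi>_def)
qed

text \<open>The operators of \<open>d\<^sub>a\<^sub>b(r)\<close> differ from \<open>\<phi>\<close> at matrices of rank one by scalars, and these matrices span.\<close>

lemma \<phi>_preserves:
  assumes W: "lm.subspace W" "W \<subseteq> vcarrier V"
    and gen: "\<And>r a b w. w \<in> W \<Longrightarrow> gen_op r (dab a b r) 0 w \<in> W"
    and A: "trace A = 0" and w: "w \<in> W"
  shows "\<phi> A w \<in> W"
proof (rule trace_zero_induct[OF A, where P = "\<lambda>A. \<phi> A w \<in> W"])
  have wV: "w \<in> vcarrier V" using W w by blast
  show "\<phi> (outer r (dab a b r)) w \<in> W" for r a b
  proof -
    have "gen_op r (dab a b r) 0 w - vscale V (dot (dab a b r) 0 + cdot (dab a b r) (shift r)) w \<in> W"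
      using gen[OF w] w by (intro lm.subspace_diff[OF W(1)] lm.subspace_scale[OF W(1)])
    then show ?thesis by (simp add: coef_op_def)
  qed
qed (use W w in \<open>auto simp: \<phi>_add_left \<phi>_scale_left lm.subspace_add lm.subspace_scale\<close>)

text \<open>A submodule is graded, and multiplication by monomials identifies its components.  The component of degree zero is a submodule of \<open>V\<close>.\<close>

lemma irreducible:
  assumes irr: "vcarrier V \<noteq> {0}" "\<And>W. sla_submodule W V \<Longrightarrow> W = {0} \<or> W = vcarrier V"
  shows "AS_irreducible M"
  unfolding AS_irreducible_def
proof (intro conjI allI impI)
  obtain u where "u \<in> vcarrier V" "u \<noteq> 0" using irr(1) zero_mem by blast
  then have "Poly_Mapping.single 0 u \<in> jcarrier M" "Poly_Mapping.single (0 :: int ^ 'n) u \<noteq> 0"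
    by simp (metis \<open>u \<noteq> 0\<close> lookup_single_eq lookup_zero)
  then show "jcarrier M \<noteq> {0}" by blast
  fix W assume sW: "AS_submodule W M"
  then have W: "W \<subseteq> jcarrier M" "Jm.subspace W" "\<And>X w. X \<in> SN \<Longrightarrow> w \<in> W \<Longrightarrow> jact M X w \<in> W"
    by (auto simp: AS_submodule_def)
  have WJ: "J.subspace W"
    using W(2) unfolding J.subspace_def Jm.subspace_def by (simp add: jscale_def)
  define W0 where "W0 = {w \<in> vcarrier V. Poly_Mapping.single 0 w \<in> W}"
  have shift_deg: "Poly_Mapping.single s w \<in> W \<longleftrightarrow> Poly_Mapping.single r w \<in> W" for r s :: "int ^ 'n" and w
  proof -
    have "jmult M (Poly_Mapping.single (r - s) 1) (Poly_Mapping.single s w) = Poly_Mapping.single r w"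
      "jmult M (Poly_Mapping.single (s - r) 1) (Poly_Mapping.single r w) = Poly_Mapping.single s w"
      by (simp_all add: mult_single)
    then show ?thesis using Jm.subspace_scale[OF W(2)] by metis
  qed
  have comp: "Poly_Mapping.lookup p s \<in> W0" if p: "p \<in> W" for p s
  proof -
    have pV: "Poly_Mapping.lookup p k \<in> vcarrier V" for k using p W(1) by (auto simp: carrier tensor_carrier_def)
    have "\<forall>k\<in>Poly_Mapping.keys p. Poly_Mapping.single k (Poly_Mapping.lookup p k) \<in> W"
    proof (rule Jc.weight_components[where D = "\<lambda>a. jact M (deg_der a)" and w = "\<lambda>k a. of_int (k $ a) + lam $ a",
          OF J.carrier_subspace _ _ WJ W(1)])
      show "\<exists>a. of_int (i $ a) + lam $ a \<noteq> of_int (j $ a) + lam $ a" if "i \<noteq> j" for i j :: "int ^ 'n"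
        using that by (simp add: vec_eq_iff)
      show "(\<Sum>k\<in>Poly_Mapping.keys p. Poly_Mapping.single k (Poly_Mapping.lookup p k)) \<in> W"
        using p poly_mapping_sum_single[of p] by simp
    qed (simp_all add: J.act_add_right J.act_scale_right deg_der_SN W(3) pV act_deg)
    moreover have "Poly_Mapping.single s 0 \<in> W" using J.subspace_0[OF WJ] by simp
    ultimately have "Poly_Mapping.single s (Poly_Mapping.lookup p s) \<in> W"
      by (cases "s \<in> Poly_Mapping.keys p") (auto simp: in_keys_iff)
    then have "Poly_Mapping.single 0 (Poly_Mapping.lookup p s) \<in> W"
      by (rule shift_deg[THEN iffD1])
    then show ?thesis using pV by (simp add: W0_def)
  qed
  have sub0: "lm.subspace W0"
    unfolding lm.subspace_def
  proof (intro conjI ballI allI)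
    show "0 \<in> W0" using J.subspace_0[OF WJ] by (simp add: W0_def)
    show "x + y \<in> W0" if "x \<in> W0" "y \<in> W0" for x y
      using that J.subspace_add[OF WJ] lm.subspace_add[OF sub] by (simp add: W0_def single_add)
    show "vscale V c x \<in> W0" if "x \<in> W0" for c x
      using that J.subspace_scale[OF WJ, of "Poly_Mapping.single 0 x" c] lm.subspace_scale[OF sub]
      by (simp add: W0_def jscale_single)
  qed
  have W0V: "W0 \<subseteq> vcarrier V" by (auto simp: W0_def)
  have gen: "gen_op r (dab a b r) 0 w \<in> W0" if "w \<in> W0" for r a b w
  proof -
    have d: "dot (dab a b r) r = 0" by (simp add: dot_dab)
    have "jact M (vf r (dab a b r)) (Poly_Mapping.single 0 w) \<in> W"
      using that vf_in_SN[OF two d] W(3) by (auto simp: W0_def)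
    then have "Poly_Mapping.single r (gen_op r (dab a b r) 0 w) \<in> W"
      using that by (simp add: act_vf[OF d] W0_def)
    then have "Poly_Mapping.single 0 (gen_op r (dab a b r) 0 w) \<in> W"
      by (rule shift_deg[THEN iffD1])
    then show ?thesis
      using that by (simp add: W0_def coef_op_closed[OF d])
  qed
  have "sla_submodule W0 V"
    unfolding sla_submodule_def
  proof (intro conjI ballI W0V sub0)
    fix X :: "'n sla" and w assume X: "X \<in> sla_carrier" and w: "w \<in> W0"
    obtain A c where Ac: "X = (A, c)" "trace A = 0" using X by (auto simp: sla_carrier_def)
    have wV: "w \<in> vcarrier V" using w W0V by blast
    have "\<phi> A w \<in> W0" by (rule \<phi>_preserves[OF sub0 W0V gen Ac(2) w])
    then show "vact V X w \<in> W0"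
      unfolding Ac(1) vact_pair[OF Ac(2) wV]
      by (rule lm.subspace_add[OF sub0 _ lm.subspace_scale[OF sub0 w]])
  qed
  then consider "W0 = {0}" | "W0 = vcarrier V" using irr(2) by blast
  then show "W = {0} \<or> W = jcarrier M"
  proof cases
    case 1
    have "p = 0" if "p \<in> W" for p
      using comp[OF that] 1 by (auto intro: poly_mapping_eqI)
    then show ?thesis using J.subspace_0[OF WJ] by blast
  next
    case 2
    have "p \<in> W" if "p \<in> jcarrier M" for p
      using that
    proof (induction p rule: carrier_induct)
      case (single s w)
      then have "Poly_Mapping.single 0 w \<in> W" using 2 by (auto simp: W0_def)
      then show ?case by (rule shift_deg[THEN iffD1])
    qed (simp_all add: J.subspace_0[OF WJ] J.subspace_add[OF WJ])
    then show ?thesis using W(1) by blast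
  qed
qed

end

section \<open>Isomorphisms of tensor modules\<close>

lemma lookup_map_zero: "h 0 = 0 \<Longrightarrow> Poly_Mapping.lookup (Poly_Mapping.map h p) s = h (Poly_Mapping.lookup p s)"
  by (simp add: map.rep_eq when_def)

locale tensor_pair = A: tensor_rep V \<mu> lam M + B: tensor_rep W \<mu>' lam M'
  for V :: "('n::finite, 'v::ab_group_add) sla_module" and \<mu> lam :: "complex ^ 'n" and M
    and W :: "('n, 'w::ab_group_add) sla_module" and \<mu>' and M'
begin

text \<open>An isomorphism of \<open>V\<close> and \<open>W\<close> is applied coefficientwise.  It forces equal scalars \<open>\<mu>\<close> because it commutes with the \<open>C\<^sub>a\<close>.\<close>

lemma tensor_iso:
  assumes iso: "sla_isomorphic V W" and ne: "vcarrier V \<noteq> {0}"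
  shows "AS_isomorphic M M'"
proof -
  obtain h where h: "bij_betw h (vcarrier V) (vcarrier W)"
    and h_add: "\<And>u v. u \<in> vcarrier V \<Longrightarrow> v \<in> vcarrier V \<Longrightarrow> h (u + v) = h u + h v"
    and h_scale: "\<And>c u. u \<in> vcarrier V \<Longrightarrow> h (vscale V c u) = vscale W c (h u)"
    and h_act: "\<And>X u. X \<in> sla_carrier \<Longrightarrow> u \<in> vcarrier V \<Longrightarrow> h (vact V X u) = vact W X (h u)"
    using iso unfolding sla_isomorphic_def by blast
  have h0: "h 0 = 0" using h_scale[of 0 0] by simp
  have h_mem: "h u \<in> vcarrier W" if "u \<in> vcarrier V" for u using h that by (rule bij_betw_apply)
  have h_inj: "inj_on h (vcarrier V)" using h by (rule bij_betw_imp_inj_on)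
  obtain u0 where u0: "u0 \<in> vcarrier V" "u0 \<noteq> 0" using ne A.zero_mem by blast
  have "h u0 \<noteq> 0" using inj_onD[OF h_inj, of u0 0] u0 h0 by auto
  have "\<mu> $ a = \<mu>' $ a" for a
  proof (rule B.lm.scale_right_imp_eq[OF \<open>h u0 \<noteq> 0\<close>])
    have "C_elem a \<in> sla_carrier" by (simp add: C_elem_def sla_carrier_def)
    from h_act[OF this u0(1)] show "vscale W (\<mu> $ a) (h u0) = vscale W (\<mu>' $ a) (h u0)"
      by (simp add: A.C_scalar B.C_scalar u0 h_mem h_scale)
  qed
  then have \<mu>: "\<mu>' = \<mu>" by (simp add: vec_eq_iff)
  have h_gen: "h (A.gen_op r u s w) = B.gen_op r u s (h w)" if "dot u r = 0" "w \<in> vcarrier V" for r u s w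
    using that h_act[OF A.sla_mem, of "outer r u" w 0]
    by (simp add: A.coef_op_def B.coef_op_def h_add h_scale A.lm.subspace_scale[OF A.sub] A.\<phi>_closed
        trace_outer A.\<phi>_def[symmetric] B.\<phi>_def[symmetric] A.shift_def B.shift_def \<mu>)
  define H :: "((int ^ 'n) \<Rightarrow>\<^sub>0 'v) \<Rightarrow> ((int ^ 'n) \<Rightarrow>\<^sub>0 'w)" where "H = Poly_Mapping.map h"
  have H_lookup: "Poly_Mapping.lookup (H p) s = h (Poly_Mapping.lookup p s)" for p :: "(int ^ 'n) \<Rightarrow>\<^sub>0 'v" and s
    unfolding H_def by (rule lookup_map_zero[of h, OF h0])
  have H_single: "H (Poly_Mapping.single s w) = Poly_Mapping.single s (h w)" for s :: "int ^ 'n" and w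
    by (rule poly_mapping_eqI) (simp add: H_lookup lookup_single when_def h0)
  have memA: "p \<in> jcarrier M \<longleftrightarrow> (\<forall>s. Poly_Mapping.lookup p s \<in> vcarrier V)" for p
    by (simp add: A.carrier tensor_carrier_def)
  have memB: "p \<in> jcarrier M' \<longleftrightarrow> (\<forall>s. Poly_Mapping.lookup p s \<in> vcarrier W)" for p
    by (simp add: B.carrier tensor_carrier_def)
  have H_add: "H (p + q) = H p + H q" if "p \<in> jcarrier M" "q \<in> jcarrier M" for p q
    using that by (intro poly_mapping_eqI) (simp add: H_lookup lookup_add memA h_add)
  have H_mem: "H p \<in> jcarrier M'" if "p \<in> jcarrier M" for p
    using that by (simp add: memA memB H_lookup h_mem)
  have H0: "H 0 = 0" by (rule poly_mapping_eqI) (simp add: H_lookup h0)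
  have closed: "jmult M f p \<in> jcarrier M" if "p \<in> jcarrier M" for f p
    using A.Jm.subspace_scale[OF A.Jm_subspace that] .
  have H_mult: "H (jmult M f p) = jmult M' f (H p)" if "p \<in> jcarrier M" for f p
    using that
  proof (induction p rule: A.carrier_induct)
    case (single s w)
    show ?case
    proof (induction f rule: laurent_induct)
      case (single r c)
      then show ?case using \<open>w \<in> vcarrier V\<close> by (simp add: H_single A.mult_single B.mult_single h_scale)
    next
      case (add f g)
      then show ?case using single by (simp add: H_add closed A.Jm.scale_left_distrib B.Jm.scale_left_distrib)
    qed (simp add: H0)
  qed (simp_all add: H0 H_add H_mem closed A.Jm.scale_right_distrib B.Jm.scale_right_distrib)
  have H_scale: "H (jscale M c p) = jscale M' c (H p)" if "p \<in> jcarrier M" for c p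
    using H_mult[OF that] by (simp add: jscale_def)
  have H_act: "H (jact M X p) = jact M' X (H p)" if X: "X \<in> SN" and p: "p \<in> jcarrier M" for X p
  proof (rule SN_induct[OF X, where P = "\<lambda>X. H (jact M X p) = jact M' X (H p)"])
    fix r and u :: "complex ^ 'n" assume u: "dot u r = 0" "vf r u \<in> SN"
    show "H (jact M (vf r u) p) = jact M' (vf r u) (H p)"
      using p
    proof (induction p rule: A.carrier_induct)
      case (single s w)
      then show ?case by (simp add: A.act_vf B.act_vf u H_single h_gen h_mem)
    qed (simp_all add: H0 A.act_zero B.act_zero u A.J.act_add_right B.J.act_add_right H_add H_mem A.J.act_closed)
  qed (simp_all add: A.J.act_add_left B.J.act_add_left A.J.act_scale_left B.J.act_scale_left p H_mem H_add H_scale A.J.act_closed)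
  have "bij_betw H (jcarrier M) (jcarrier M')"
  proof (rule bij_betwI')
    show "H p = H q \<longleftrightarrow> p = q" if "p \<in> jcarrier M" "q \<in> jcarrier M" for p q
    proof
      assume eq: "H p = H q"
      show "p = q"
      proof (rule poly_mapping_eqI)
        fix s
        have "h (Poly_Mapping.lookup p s) = h (Poly_Mapping.lookup q s)"
          unfolding H_lookup[symmetric] eq ..
        then show "Poly_Mapping.lookup p s = Poly_Mapping.lookup q s"
          using inj_onD[OF h_inj] that by (simp add: memA)
      qed
    qed simp
    show "\<exists>p\<in>jcarrier M. q = H p" if q: "q \<in> jcarrier M'" for q
    proof
      define g where "g = inv_into (vcarrier V) h"
      have g: "g w \<in> vcarrier V" "h (g w) = w" if "w \<in> vcarrier W" for w
        using h that unfolding g_def by (auto simp: bij_betw_def inv_into_into f_inv_into_f)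
      have "g 0 = 0"
        using inv_into_f_f[OF h_inj A.zero_mem] by (simp add: g_def h0)
      note l = lookup_map_zero[of g, OF this]
      show "Poly_Mapping.map g q \<in> jcarrier M" using q g by (simp add: memA memB l)
      show "q = H (Poly_Mapping.map g q)"
        using q g by (intro poly_mapping_eqI) (simp add: H_lookup l memB)
    qed
  qed (rule H_mem)
  then show ?thesis
    unfolding AS_isomorphic_def using H_add H_mult H_act by blast
qed

text \<open>An isomorphism preserves the weight space at \<open>lam\<close>, which is the component of degree zero; by linearity over the Laurent
  polynomials it is the same map \<open>g\<close> in every degree.\<close>

lemma sla_iso:
  assumes iso: "AS_isomorphic M M'" and ne: "vcarrier V \<noteq> {0}"
  shows "sla_isomorphic V W"
proof -
  obtain H where H: "bij_betw H (jcarrier M) (jcarrier M')"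
    and H_add: "\<And>p q. p \<in> jcarrier M \<Longrightarrow> q \<in> jcarrier M \<Longrightarrow> H (p + q) = H p + H q"
    and H_mult: "\<And>f p. p \<in> jcarrier M \<Longrightarrow> H (jmult M f p) = jmult M' f (H p)"
    and H_act: "\<And>X p. X \<in> SN \<Longrightarrow> p \<in> jcarrier M \<Longrightarrow> H (jact M X p) = jact M' X (H p)"
    using iso unfolding AS_isomorphic_def by blast
  have H_mem: "H p \<in> jcarrier M'" if "p \<in> jcarrier M" for p using H that by (rule bij_betw_apply)
  have H0: "H 0 = 0" using H_mult[of 0 0] A.single_mem[of 0 0] by simp
  define g where "g w = Poly_Mapping.lookup (H (Poly_Mapping.single 0 w)) 0" for w
  have H_single0: "H (Poly_Mapping.single 0 w) = Poly_Mapping.single 0 (g w)" if w: "w \<in> vcarrier V" for w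
  proof (rule poly_mapping_eqI)
    fix s :: "int ^ 'n"
    have mem: "Poly_Mapping.single 0 w \<in> jcarrier M" using w by simp
    show "Poly_Mapping.lookup (H (Poly_Mapping.single 0 w)) s = Poly_Mapping.lookup (Poly_Mapping.single 0 (g w)) s"
    proof (cases "s = 0")
      case True
      then show ?thesis by (simp add: g_def)
    next
      case False
      then obtain a where a: "s $ a \<noteq> 0" by (auto simp: vec_eq_iff)
      have "jact M' (deg_der a) (H (Poly_Mapping.single 0 w)) = jscale M' (lam $ a) (H (Poly_Mapping.single 0 w))"
        using H_act[OF A.deg_der_SN mem, of a] H_mult[OF mem, of "lconst (lam $ a)"] w
        by (simp add: A.act_deg jscale_def)
      then have "vscale W (of_int (s $ a) + lam $ a) (Poly_Mapping.lookup (H (Poly_Mapping.single 0 w)) s)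
          = vscale W (lam $ a) (Poly_Mapping.lookup (H (Poly_Mapping.single 0 w)) s)"
        by (simp only: B.lookup_act_deg[OF H_mem[OF mem], symmetric] B.lookup_jscale)
      then have "Poly_Mapping.lookup (H (Poly_Mapping.single 0 w)) s = 0"
        using a B.lm.scale_right_imp_eq[of "Poly_Mapping.lookup (H (Poly_Mapping.single 0 w)) s"
            "of_int (s $ a) + lam $ a" "lam $ a"] by auto
      then show ?thesis using False by (simp add: lookup_single)
    qed
  qed
  have H_single: "H (Poly_Mapping.single s w) = Poly_Mapping.single s (g w)" if w: "w \<in> vcarrier V" for s w
    using H_mult[of "Poly_Mapping.single 0 w" "Poly_Mapping.single s 1"] w
    by (simp add: A.mult_single B.mult_single H_single0)
  have g_mem: "g w \<in> vcarrier W" if "w \<in> vcarrier V" for w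
    using H_mem[of "Poly_Mapping.single 0 w"] that by (simp add: H_single)
  have single_inj: "Poly_Mapping.single s v = Poly_Mapping.single s w \<Longrightarrow> v = w" for s :: "int ^ 'n" and v w :: 'w
    by (metis lookup_single_eq)
  have g_add: "g (u + v) = g u + g v" if "u \<in> vcarrier V" "v \<in> vcarrier V" for u v
    using H_add[of "Poly_Mapping.single 0 u" "Poly_Mapping.single 0 v"] that
    by (simp add: g_def single_add[symmetric] lookup_add)
  have g_scale: "g (vscale V c u) = vscale W c (g u)" if "u \<in> vcarrier V" for c u
    using H_mult[of "Poly_Mapping.single 0 u" "lconst c"] that
    by (simp add: g_def jscale_def[symmetric] A.jscale_single B.lookup_jscale)
  have g0: "g 0 = 0" using g_scale[of 0 0] by simp
  have H_lookup: "Poly_Mapping.lookup (H p) s = g (Poly_Mapping.lookup p s)" if "p \<in> jcarrier M" for p s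
    using that
  proof (induction p rule: A.carrier_induct)
    case (add p q)
    then show ?case by (simp add: H_add lookup_add g_add A.carrier tensor_carrier_def)
  qed (simp_all add: H0 g0 H_single lookup_single when_def)
  have bij: "bij_betw g (vcarrier V) (vcarrier W)"
  proof (rule bij_betwI')
    show "g u = g v \<longleftrightarrow> u = v" if uv: "u \<in> vcarrier V" "v \<in> vcarrier V" for u v
    proof
      assume "g u = g v"
      then have "H (Poly_Mapping.single 0 u) = H (Poly_Mapping.single 0 v)" using uv by (simp add: H_single)
      then have "Poly_Mapping.single (0 :: int ^ 'n) u = Poly_Mapping.single 0 v"
        using inj_onD[OF bij_betw_imp_inj_on[OF H]] uv by simp
      then show "u = v" by (metis lookup_single_eq)
    qed simp
    show "\<exists>v\<in>vcarrier V. w = g v" if w: "w \<in> vcarrier W" for w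
    proof -
      obtain p where p: "p \<in> jcarrier M" "H p = Poly_Mapping.single 0 w"
        using H w bij_betw_imp_surj_on[OF H] by (metis B.single_mem imageE)
      have "w = g (Poly_Mapping.lookup p 0)" using H_lookup[OF p(1), of 0] p(2) by simp
      then show ?thesis using p(1) by (auto simp: A.carrier tensor_carrier_def)
    qed
  qed (rule g_mem)
  have g_gen: "g (A.gen_op r u 0 w) = B.gen_op r u 0 (g w)" if u: "dot u r = 0" and w: "w \<in> vcarrier V" for r u w
  proof (rule single_inj[of r])
    show "Poly_Mapping.single r (g (A.gen_op r u 0 w)) = Poly_Mapping.single r (B.gen_op r u 0 (g w))"
      using H_act[OF vf_in_SN[OF A.two u], of "Poly_Mapping.single 0 w"] w u
      by (simp add: A.act_vf B.act_vf H_single A.coef_op_closed g_mem)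
  qed
  obtain u0 where u0: "u0 \<in> vcarrier V" "u0 \<noteq> 0" using ne A.zero_mem by blast
  have gu0: "g u0 \<noteq> 0" using inj_onD[OF bij_betw_imp_inj_on[OF bij], of u0 0] u0 g0 by auto
  have \<mu>: "\<mu> $ j = \<mu>' $ j" for j
  proof -
    \<comment> \<open>In the fields of degrees \<open>e\<^sub>i\<close> and \<open>-e\<^sub>i\<close> along \<open>e\<^sub>j\<close> the matrix parts cancel.\<close>
    obtain i where i: "i \<noteq> j" using A.two by metis
    let ?r = "axis i 1 :: int ^ 'n" and ?u = "axis j 1 :: complex ^ 'n"
    have d: "dot ?u ?r = 0" "dot ?u (- ?r) = 0" "?r \<noteq> 0" "- ?r \<noteq> 0"
      using i by (simp_all add: axis_eq_0_iff)
    have o: "outer (- ?r) ?u = mscale (- 1) (outer ?r ?u)" by (simp add: outer_def mscale_def vec_eq_iff)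
    have tr: "trace (outer ?r ?u) = 0" using d by (simp add: trace_outer)
    have VA: "A.gen_op ?r ?u 0 u0 + A.gen_op (- ?r) ?u 0 u0 = vscale V (2 * \<mu> $ j) u0"
      using d u0 unfolding A.coef_op_def o
      by (simp add: A.shift_def A.\<phi>_scale_left tr A.lm.scale_left_distrib[symmetric])
    have WB: "B.gen_op ?r ?u 0 (g u0) + B.gen_op (- ?r) ?u 0 (g u0) = vscale W (2 * \<mu>' $ j) (g u0)"
      using d g_mem[OF u0(1)] unfolding B.coef_op_def o
      by (simp add: B.shift_def B.\<phi>_scale_left tr B.lm.scale_left_distrib[symmetric])
    have "g (vscale V (2 * \<mu> $ j) u0) = vscale W (2 * \<mu>' $ j) (g u0)"
      unfolding VA[symmetric] WB[symmetric] using d u0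
      by (simp add: g_add A.coef_op_closed g_gen)
    then have "vscale W (2 * \<mu> $ j) (g u0) = vscale W (2 * \<mu>' $ j) (g u0)"
      using u0 by (simp add: g_scale)
    from B.lm.scale_right_imp_eq[OF gu0 this] show ?thesis by simp
  qed
  then have \<mu>_eq: "\<mu>' = \<mu>" by (simp add: vec_eq_iff)
  have g_\<phi>: "g (A.\<phi> A w) = B.\<phi> A (g w)" if A: "trace A = 0" and w: "w \<in> vcarrier V" for A w
  proof (rule trace_zero_induct[OF A, where P = "\<lambda>A. g (A.\<phi> A w) = B.\<phi> A (g w)"])
    fix r :: "int ^ 'n" and a b
    let ?u = "dab a b r"
    have d: "dot ?u r = 0" by (simp add: dot_dab)
    have "g (A.gen_op r ?u 0 w) = vscale W (dot ?u 0 + cdot ?u (A.shift r)) (g w) + g (A.\<phi> (outer r ?u) w)"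
      using w d unfolding A.coef_op_def
      by (simp add: g_add g_scale A.\<phi>_closed trace_outer A.lm.subspace_scale[OF A.sub])
    moreover have "A.shift r = B.shift r" by (simp add: A.shift_def B.shift_def \<mu>_eq)
    ultimately show "g (A.\<phi> (outer r ?u) w) = B.\<phi> (outer r ?u) (g w)"
      using g_gen[OF d w] by (simp add: B.coef_op_def)
  qed (use w in \<open>simp_all add: A.\<phi>_add_left B.\<phi>_add_left A.\<phi>_scale_left B.\<phi>_scale_left g_mem g_add g_scale A.\<phi>_closed\<close>)
  have "g (vact V X w) = vact W X (g w)" if X: "X \<in> sla_carrier" and w: "w \<in> vcarrier V" for X w
  proof -
    obtain A c where Ac: "X = (A, c)" "trace A = 0" using X by (auto simp: sla_carrier_def)
    show ?thesis
      unfolding Ac(1) using w Ac(2)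
      by (simp add: A.vact_pair B.vact_pair g_mem g_add g_scale g_\<phi> A.\<phi>_closed A.lm.subspace_scale[OF A.sub] \<mu>_eq)
  qed
  then show ?thesis
    unfolding sla_isomorphic_def using bij g_add g_scale by blast
qed

end

section \<open>The weight space of an object of the category\<close>

locale J_object =
  fixes J :: "('n::finite, 'j::ab_group_add) AS_module" and lam :: "complex ^ 'n"
  assumes in_cat: "category_J_at lam J" and two: "\<exists>a b :: 'n. a \<noteq> b"
begin

lemma cat: "module (jmult J)" "module.subspace (jmult J) (jcarrier J)" "SN_module J"
  "diagonalizable_on (jscale J) (jcarrier J) (jact J (deg_der a))"
  "\<exists>B. finite B \<and> \<not> module.dependent (jmult J) B \<and> module.span (jmult J) B = jcarrier J"
  "X \<in> SN \<Longrightarrow> u \<in> jcarrier J \<Longrightarrow> jact J X (jmult J f u) = jmult J (X f) u + jmult J f (jact J X u)"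
  and weights: "weights J \<subseteq> {lam + (\<chi> a. of_int (r $ a)) | r :: int ^ 'n. True}"
  using in_cat unfolding category_J_at_def category_J_def by blast+

sublocale L: lie_module "jscale J" SN op_scale op_bracket "jcarrier J" "jact J"
  using cat(3) by (simp add: SN_module_def)

sublocale Lc: complex_space "jscale J"
  by (rule complex_space.intro) (rule L.vector_space_axioms)

sublocale Jm: module "jmult J"
  by (rule cat(1))

abbreviation t :: "int ^ 'n \<Rightarrow> 'j \<Rightarrow> 'j" where
  "t r u \<equiv> jmult J (tmon r) u"

lemma deg_SN: "deg_der a \<in> (SN :: ('n laurent \<Rightarrow> 'n laurent) set)"
  unfolding deg_der_vf by (rule vf_in_SN[OF two]) simp

lemma mult_closed: "u \<in> jcarrier J \<Longrightarrow> jmult J f u \<in> jcarrier J"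
  by (rule Jm.subspace_scale[OF cat(2)])

lemma tmon_mult: "tmon r * tmon s = (tmon (r + s) :: 'n laurent)" and tmon_0: "tmon 0 = (1 :: 'n laurent)"
  by (simp_all add: tmon_def mult_single)

lemma t_t: "t r (t s u) = t (r + s) u" and t_0: "t 0 u = u"
  by (simp_all add: tmon_mult tmon_0)

lemma t_inj: "t r u = t r v \<longleftrightarrow> u = v"
proof
  assume eq: "t r u = t r v"
  have "t (- r) (t r u) = t (- r) (t r v)" by (simp only: eq)
  then show "u = v" by (simp only: t_t add.left_inverse t_0)
qed simp

lemma mult_scale: "jmult J f (jscale J c u) = jscale J c (jmult J f u)"
  by (simp add: jscale_def mult.commute)

lemma vf_tmon: "vf r u (tmon s) = lconst (dot u s) * tmon (r + s)"
  by (simp add: tmon_def vf_single lconst_def mult_single)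

lemma act_t: "dot u r = 0 \<Longrightarrow> w \<in> jcarrier J \<Longrightarrow>
    jact J (vf r u) (t s w) = jscale J (dot u s) (t (r + s) w) + t s (jact J (vf r u) w)"
  by (simp add: cat(6) vf_in_SN[OF two] vf_tmon jscale_def Jm.scale_scale del: Jm.scale_scale flip: Jm.scale_scale)

lemma act_deg_t: "w \<in> jcarrier J \<Longrightarrow>
    jact J (deg_der a) (t s w) = jscale J (of_int (s $ a)) (t s w) + t s (jact J (deg_der a) w)"
  unfolding deg_der_vf by (simp add: act_t)

text \<open>The weight space of weight \<open>lam + s\<close>.\<close>

definition wspace :: "int ^ 'n \<Rightarrow> 'j set" where
  "wspace s = {u \<in> jcarrier J. \<forall>a. jact J (deg_der a) u = jscale J (of_int (s $ a) + lam $ a) u}"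

lemma wspace_subspace: "L.subspace (wspace s)"
  using L.carrier_subspace
  unfolding L.subspace_def wspace_def
  by (auto simp: L.act_add_right L.act_scale_right deg_SN L.scale_right_distrib L.scale_left_commute
      dest: L.act_scale_right[OF deg_SN, of 0 _ 0])

lemma wspace_carrier: "u \<in> wspace s \<Longrightarrow> u \<in> jcarrier J"
  by (simp add: wspace_def)

lemma wspace_shift: "u \<in> wspace s \<Longrightarrow> t r u \<in> wspace (r + s)"
  by (simp add: wspace_def mult_closed act_deg_t mult_scale L.scale_left_distrib algebra_simps)

lemma deg_commute:
  assumes "u \<in> jcarrier J"
  shows "jact J (deg_der a) (jact J (deg_der b) u) = jact J (deg_der b) (jact J (deg_der a) u)"
proof -
  have "op_bracket (deg_der a) (deg_der b) = (0 :: 'n laurent \<Rightarrow> 'n laurent)"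
    unfolding deg_der_vf op_bracket_vf by (simp add: vf_zero_left)
  moreover have "jact J 0 u = 0"
    using L.act_scale_left[OF deg_SN assms, of 0 undefined] by simp
  ultimately show ?thesis
    using L.act_bracket[OF deg_SN deg_SN assms, of a b] by simp
qed

text \<open>Each eigenvector of the first operators is a sum of eigenvectors of the next one, and its components
  stay eigenvectors of the first operators because these form an invariant subspace.\<close>

lemma joint_eigenvectors_span:
  assumes "finite F"
  shows "jcarrier J \<subseteq> L.span {u \<in> jcarrier J. \<forall>a\<in>F. \<exists>c. jact J (deg_der a) u = jscale J c u}"
  using assms
proof (induction F rule: finite_induct)
  case empty
  then show ?case using L.span_superset by auto
next
  case (insert b F)
  let ?E = "\<lambda>F. {u \<in> jcarrier J. \<forall>a\<in>F. \<exists>c. jact J (deg_der a) u = jscale J c u}"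
  have "?E F \<subseteq> L.span (?E (insert b F))"
  proof
    fix x assume x: "x \<in> ?E F"
    then have "\<forall>a\<in>F. \<exists>c. jact J (deg_der a) x = jscale J c x" by blast
    then obtain \<alpha> where \<alpha>: "\<And>a. a \<in> F \<Longrightarrow> jact J (deg_der a) x = jscale J (\<alpha> a) x" by metis
    obtain B where B: "L.span B = jcarrier J" "\<forall>b'\<in>B. \<exists>c. jact J (deg_der b) b' = jscale J c b'"
      using cat(4)[of b] unfolding diagonalizable_on_def by blast
    then obtain e where e: "\<And>b'. b' \<in> B \<Longrightarrow> jact J (deg_der b) b' = jscale J (e b') b'" by metis
    have BJ: "B \<subseteq> jcarrier J" using B(1) L.span_superset by blast
    have "x \<in> L.span B" using x B(1) by simp
    then obtain S k where S: "finite S" "S \<subseteq> B" "x = (\<Sum>v\<in>S. jscale J (k v) v)"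
      by (auto simp: L.span_explicit)
    define y where "y c = (\<Sum>v\<in>{v\<in>S. e v = c}. jscale J (k v) v)" for c
    have xy: "x = (\<Sum>c\<in>e ` S. y c)"
      unfolding y_def S(3) by (rule sum.image_gen[OF S(1)])
    have yJ: "y c \<in> jcarrier J" for c
      unfolding y_def using S(2) BJ by (intro L.subspace_sum L.subspace_scale L.carrier_subspace) auto
    have act_sum: "jact J (deg_der b) (\<Sum>v\<in>T. jscale J (k v) v) = (\<Sum>v\<in>T. jscale J (k v) (jact J (deg_der b) v))"
      if "finite T" "T \<subseteq> jcarrier J" for T
      using that
    proof (induction T rule: finite_induct)
      case empty
      then show ?case
        using L.act_scale_right[OF deg_SN L.subspace_0[OF L.carrier_subspace], of b 0] by simp
    next
      case (insert v T)
      then show ?case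
        by (simp add: L.act_add_right L.act_scale_right deg_SN L.subspace_sum L.subspace_scale
            L.carrier_subspace subset_iff)
    qed
    have ye: "jact J (deg_der b) (y c) = jscale J c (y c)" for c
    proof -
      have "jact J (deg_der b) (y c) = (\<Sum>v\<in>{v\<in>S. e v = c}. jscale J (k v) (jact J (deg_der b) v))"
        unfolding y_def using S BJ by (intro act_sum) auto
      also have "\<dots> = (\<Sum>v\<in>{v\<in>S. e v = c}. jscale J c (jscale J (k v) v))"
        using S(2) by (intro sum.cong) (auto simp: e L.scale_left_commute subset_iff)
      finally show ?thesis by (simp add: y_def L.scale_sum_right)
    qed
    define W where "W = {u \<in> jcarrier J. \<forall>a\<in>F. jact J (deg_der a) u = jscale J (\<alpha> a) u}"
    have W: "L.subspace W"
      using L.carrier_subspace unfolding L.subspace_def W_def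
      by (auto simp: L.act_add_right L.act_scale_right deg_SN L.scale_right_distrib L.scale_left_commute
          dest: L.act_scale_right[OF deg_SN, of 0 _ 0])
    have "\<forall>c\<in>e ` S. y c \<in> W"
    proof (rule Lc.weight_components[where D = "\<lambda>_ :: unit. jact J (deg_der b)" and w = "\<lambda>c _. c",
          OF L.carrier_subspace _ _ W])
      show "jact J (deg_der b) u \<in> W" if "u \<in> W" for u
        using that by (auto simp: W_def L.act_closed deg_SN deg_commute[of u _ b] L.act_scale_right)
      show "(\<Sum>c\<in>e ` S. y c) \<in> W" using x \<alpha> xy by (simp add: W_def)
    qed (use S(1) yJ ye in \<open>auto simp: L.act_add_right L.act_scale_right deg_SN W_def\<close>)
    then have "\<forall>c\<in>e ` S. y c \<in> ?E (insert b F)"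
      using yJ ye by (auto simp: W_def)
    then show "x \<in> L.span (?E (insert b F))"
      unfolding xy by (intro L.span_sum L.span_base) blast
  qed
  then have "L.span (?E F) \<subseteq> L.span (?E (insert b F))"
    by (intro L.span_minimal) auto
  then show ?case using insert.IH by blast
qed

lemma wspaces_span: "jcarrier J \<subseteq> L.span (\<Union>s. wspace s)"
proof -
  have "{u \<in> jcarrier J. \<forall>a\<in>UNIV. \<exists>c. jact J (deg_der a) u = jscale J c u} \<subseteq> L.span (\<Union>s. wspace s)"
  proof
    fix u assume u: "u \<in> {u \<in> jcarrier J. \<forall>a\<in>UNIV. \<exists>c. jact J (deg_der a) u = jscale J c u}"
    show "u \<in> L.span (\<Union>s. wspace s)"
    proof (cases "u = 0")
      case True
      then show ?thesis by (simp add: L.span_zero)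
    next
      case False
      have "\<forall>a. \<exists>c. jact J (deg_der a) u = jscale J c u" using u by blast
      then obtain c where c: "\<And>a. jact J (deg_der a) u = jscale J (c a) u" by metis
      then have "(\<chi> a. c a) \<in> weights J" using u False by (auto simp: weights_def)
      then obtain s :: "int ^ 'n" where s: "(\<chi> a. c a) = lam + (\<chi> a. of_int (s $ a))" using weights by blast
      have "c a = of_int (s $ a) + lam $ a" for a using arg_cong[OF s, of "\<lambda>v. v $ a"] by simp
      then have "u \<in> wspace s" using c u by (simp add: wspace_def)
      then show ?thesis by (intro L.span_base) blast
    qed
  qed
  then have "L.span {u \<in> jcarrier J. \<forall>a\<in>UNIV. \<exists>c. jact J (deg_der a) u = jscale J c u} \<subseteq> L.span (\<Union>s. wspace s)"
    by (intro L.span_minimal) auto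
  then show ?thesis using joint_eigenvectors_span[of UNIV] by auto
qed

abbreviation U :: "'j set" where "U \<equiv> wspace 0"

lemma U_carrier: "u \<in> U \<Longrightarrow> u \<in> jcarrier J"
  by (rule wspace_carrier)

lemma t_wspace: "u \<in> U \<Longrightarrow> t s u \<in> wspace s"
  using wspace_shift[of u 0 s] by simp

end

text \<open>A linear map \<open>g\<close> from \<open>C\<close> to the weight space extends to the map \<open>t\<^sup>s \<otimes> w \<mapsto> t\<^sup>s g(w)\<close>.\<close>

locale glue_map = J_object J lam + sp: complex_space sc
  for J :: "('n::finite, 'j::ab_group_add) AS_module" and lam and sc :: "complex \<Rightarrow> 'w::ab_group_add \<Rightarrow> 'w" +
  fixes C :: "'w set" and g :: "'w \<Rightarrow> 'j"
  assumes C: "sp.subspace C" and g_mem: "w \<in> C \<Longrightarrow> g w \<in> wspace 0"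
    and g_add: "w \<in> C \<Longrightarrow> w' \<in> C \<Longrightarrow> g (w + w') = g w + g w'"
    and g_scale: "w \<in> C \<Longrightarrow> g (sc c w) = jscale J c (g w)"
begin

lemma C0 [simp]: "0 \<in> C" by (rule sp.subspace_0[OF C])

lemma g0: "g 0 = 0" using g_scale[of 0 0] by simp

lemma gJ: "w \<in> C \<Longrightarrow> g w \<in> jcarrier J" using g_mem U_carrier by blast

definition glue :: "((int ^ 'n) \<Rightarrow>\<^sub>0 'w) \<Rightarrow> 'j" where
  "glue p = (\<Sum>s\<in>Poly_Mapping.keys p. t s (g (Poly_Mapping.lookup p s)))"

lemma glue_single: "glue (Poly_Mapping.single s w) = t s (g w)"
  by (cases "w = 0") (simp_all add: glue_def g0)

lemma glue_0 [simp]: "glue 0 = 0" by (simp add: glue_def)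

lemma glue_add: "p \<in> tensor_carrier C \<Longrightarrow> q \<in> tensor_carrier C \<Longrightarrow> glue (p + q) = glue p + glue q"
  unfolding glue_def
  by (rule setsum_keys_plus_distrib) (simp_all add: tensor_carrier_def g0 g_add Jm.scale_right_distrib)

lemma glue_closed: "p \<in> tensor_carrier C \<Longrightarrow> glue p \<in> jcarrier J"
  unfolding glue_def by (intro Jm.subspace_sum[OF cat(2)] mult_closed gJ) (simp add: tensor_carrier_def)

lemma glue_mult:
  assumes "p \<in> tensor_carrier C"
  shows "glue (tensor_mult sc f p) = jmult J f (glue p)"
  using assms C0
proof (induction p rule: tensor_carrier_induct)
  case (single s w)
  have closed: "tensor_mult sc f (Poly_Mapping.single s w) \<in> tensor_carrier C" for f
    using single by (intro sp.tensor_mult_closed[OF C]) simp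
  show ?case
  proof (induction f rule: laurent_induct)
    case (single r c)
    have "Poly_Mapping.single r c = lconst c * tmon r" by (simp add: lconst_def tmon_def mult_single)
    then have "jmult J (Poly_Mapping.single r c) (t s (g w)) = t (r + s) (jscale J c (g w))"
      by (simp add: jscale_def tmon_mult[symmetric] mult_ac)
    then show ?case using \<open>w \<in> C\<close> by (simp add: sp.tensor_mult_single glue_single g_scale)
  next
    case (add f h)
    then show ?case by (simp add: sp.tensor_mult_add glue_add closed Jm.scale_left_distrib)
  qed simp
next
  case (add p q)
  then show ?case
    by (simp add: sp.tensor_mult_add glue_add sp.tensor_mult_closed[OF C] Jm.scale_right_distrib)
qed simp

lemma glue_image_subspace: "Jm.subspace (glue ` tensor_carrier C)"
  unfolding Jm.subspace_def
proof (intro conjI ballI allI)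
  have "0 \<in> tensor_carrier C" by (simp add: tensor_carrier_def)
  with glue_0[symmetric] show "0 \<in> glue ` tensor_carrier C" by (rule image_eqI)
next
  fix x y assume "x \<in> glue ` tensor_carrier C" "y \<in> glue ` tensor_carrier C"
  then obtain p q where pq: "p \<in> tensor_carrier C" "x = glue p" "q \<in> tensor_carrier C" "y = glue q" by blast
  have "x + y = glue (p + q)" unfolding pq by (rule glue_add[OF pq(1,3), symmetric])
  moreover have "p + q \<in> tensor_carrier C" by (rule sp.tensor_carrier_add[OF C pq(1,3)])
  ultimately show "x + y \<in> glue ` tensor_carrier C" by (rule image_eqI)
next
  fix f x assume "x \<in> glue ` tensor_carrier C"
  then obtain p where p: "p \<in> tensor_carrier C" "x = glue p" by blast
  have "jmult J f x = glue (tensor_mult sc f p)" unfolding p by (rule glue_mult[OF p(1), symmetric])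
  moreover have "tensor_mult sc f p \<in> tensor_carrier C" by (rule sp.tensor_mult_closed[OF C p(1)])
  ultimately show "jmult J f x \<in> glue ` tensor_carrier C" by (rule image_eqI)
qed

lemma glue_eq_0:
  assumes p: "p \<in> tensor_carrier C" "glue p = 0" and inj: "\<And>w. w \<in> C \<Longrightarrow> g w = 0 \<Longrightarrow> w = 0"
  shows "p = 0"
proof -
  have pC: "Poly_Mapping.lookup p s \<in> C" for s using p(1) by (simp add: tensor_carrier_def)
  have "\<forall>s\<in>Poly_Mapping.keys p. t s (g (Poly_Mapping.lookup p s)) \<in> {0}"
  proof (rule Lc.weight_components[where D = "\<lambda>a. jact J (deg_der a)" and w = "\<lambda>s a. of_int (s $ a) + lam $ a",
        OF L.carrier_subspace])
    show "(\<Sum>s\<in>Poly_Mapping.keys p. t s (g (Poly_Mapping.lookup p s))) \<in> {0}"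
      using p(2) by (simp add: glue_def)
    show "{0} \<subseteq> jcarrier J" using L.subspace_0[OF L.carrier_subspace] by simp
    show "jact J (deg_der a) u \<in> {0}" if "u \<in> {0}" for a u
      using that L.act_scale_right[OF deg_SN L.subspace_0[OF L.carrier_subspace], of a 0] by simp
    show "jact J (deg_der a) (t i (g (Poly_Mapping.lookup p i)))
        = jscale J (of_int (i $ a) + lam $ a) (t i (g (Poly_Mapping.lookup p i)))" for i a
      using t_wspace[OF g_mem[OF pC], of i] by (simp add: wspace_def)
    show "\<exists>a. of_int (i $ a) + lam $ a \<noteq> of_int (j $ a) + lam $ a" if "i \<noteq> j" for i j :: "int ^ 'n"
      using that by (simp add: vec_eq_iff)
  qed (simp_all add: L.act_add_right L.act_scale_right deg_SN mult_closed gJ pC)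
  then have "g (Poly_Mapping.lookup p s) = 0" if "s \<in> Poly_Mapping.keys p" for s
    using that t_inj[of s _ 0] by auto
  then have "Poly_Mapping.lookup p s = 0" for s
    using inj[OF pC, of s] by (cases "s \<in> Poly_Mapping.keys p") (auto simp: in_keys_iff)
  then show ?thesis by (auto intro: poly_mapping_eqI)
qed

lemma glue_inj:
  assumes inj: "\<And>w. w \<in> C \<Longrightarrow> g w = 0 \<Longrightarrow> w = 0"
    and pq: "p \<in> tensor_carrier C" "q \<in> tensor_carrier C" "glue p = glue q"
  shows "p = q"
proof -
  have m: "p - q \<in> tensor_carrier C"
    using pq by (simp add: tensor_carrier_def lookup_minus sp.subspace_diff[OF C])
  have "glue ((p - q) + q) = glue (p - q) + glue q" by (rule glue_add[OF m pq(2)])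
  then have "glue (p - q) = 0" using pq(3) by simp
  from glue_eq_0[OF m this inj] show ?thesis by simp
qed

lemma glue_surj:
  assumes surj: "\<And>u. u \<in> wspace 0 \<Longrightarrow> \<exists>w\<in>C. u = g w" and x: "x \<in> jcarrier J"
  shows "\<exists>p\<in>tensor_carrier C. x = glue p"
proof -
  have "x \<in> L.span (\<Union>s. wspace s)" using wspaces_span x by blast
  then show ?thesis
  proof (induction rule: L.span_induct_alt)
    case base
    have "0 \<in> tensor_carrier C" by (simp add: tensor_carrier_def)
    then show ?case by (metis glue_0)
  next
    case (step c y z)
    then obtain s where y: "y \<in> wspace s" by blast
    have "t (- s) y \<in> wspace 0" using wspace_shift[OF y, of "- s"] by simp
    then obtain w where w: "w \<in> C" "t (- s) y = g w" using surj by blast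
    have "y = t s (g w)" unfolding w(2)[symmetric] t_t by (simp add: tmon_0)
    then have "jscale J c y = glue (Poly_Mapping.single s (sc c w))"
      using w(1) by (simp add: glue_single g_scale mult_scale)
    moreover obtain p where p: "p \<in> tensor_carrier C" "z = glue p" using step(2) by blast
    moreover have "Poly_Mapping.single s (sc c w) \<in> tensor_carrier C"
      using w(1) by (simp add: sp.subspace_scale[OF C])
    ultimately show ?case
      using glue_add sp.tensor_carrier_add[OF C] by metis
  qed
qed

end

context J_object
begin

text \<open>The coefficients of finitely many generators of \<open>J\<close> span a subspace of \<open>U\<close>.  Its multiples by monomials contain the
  generators and form a submodule over the Laurent polynomials, so they exhaust \<open>J\<close>, and the subspace is \<open>U\<close>.\<close>

lemma weight_space_finite: "\<exists>B. finite B \<and> B \<subseteq> U \<and> U \<subseteq> L.span B"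
proof -
  interpret G: glue_map J lam "jscale J" U "\<lambda>u. u"
    by unfold_locales (simp_all add: wspace_subspace)
  obtain B where B: "finite B" "Jm.span B = jcarrier J" using cat(5) by blast
  have "\<exists>p\<in>tensor_carrier U. b = G.glue p" if "b \<in> B" for b
    using G.glue_surj[of b] B(2) that Jm.span_superset by blast
  then obtain p where p: "\<And>b. b \<in> B \<Longrightarrow> p b \<in> tensor_carrier U" "\<And>b. b \<in> B \<Longrightarrow> b = G.glue (p b)" by metis
  define B' where "B' = (\<Union>b\<in>B. Poly_Mapping.lookup (p b) ` Poly_Mapping.keys (p b))"
  have B'U: "B' \<subseteq> U" using p(1) by (auto simp: B'_def tensor_carrier_def)
  have spU: "L.span B' \<subseteq> U" using B'U by (intro L.span_minimal wspace_subspace)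
  interpret G': glue_map J lam "jscale J" "L.span B'" "\<lambda>u. u"
    by unfold_locales (use spU in auto)
  have tc: "tensor_carrier (L.span B') \<subseteq> tensor_carrier U" using spU by (auto simp: tensor_carrier_def)
  let ?Q = "G.glue ` tensor_carrier (L.span B')"
  have "Jm.subspace ?Q" by (rule G'.glue_image_subspace)
  moreover have "B \<subseteq> ?Q"
  proof
    fix b assume b: "b \<in> B"
    have "Poly_Mapping.lookup (p b) s \<in> L.span B'" for s
    proof (cases "s \<in> Poly_Mapping.keys (p b)")
      case True
      then show ?thesis using b by (intro L.span_base) (auto simp: B'_def)
    next
      case False
      then show ?thesis by (simp add: in_keys_iff L.span_zero)
    qed
    then have "p b \<in> tensor_carrier (L.span B')" unfolding tensor_carrier_def by blast
    with p(2)[OF b] show "b \<in> ?Q" by (rule image_eqI)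
  qed
  ultimately have Q: "jcarrier J \<subseteq> ?Q" using Jm.span_minimal B(2) by metis
  have "u \<in> L.span B'" if u: "u \<in> U" for u
  proof -
    obtain q where q: "q \<in> tensor_carrier (L.span B')" "u = G.glue q"
      using Q u U_carrier by blast
    have "G.glue (Poly_Mapping.single 0 u) = u" by (simp add: G.glue_single t_0)
    then have "Poly_Mapping.single 0 u = q"
      using G.glue_inj[of "Poly_Mapping.single 0 u" q] q tc u by auto
    then have "u = Poly_Mapping.lookup q 0" by (metis lookup_single_eq)
    then show ?thesis using q(1) by (auto simp: tensor_carrier_def)
  qed
  moreover have "finite B'" using B(1) by (simp add: B'_def)
  ultimately show ?thesis using B'U by blast
qed

lemma coordinates:
  obtains d and \<beta> :: "(nat \<Rightarrow> complex) \<Rightarrow> 'j" where "bij_betw \<beta> (coord d) U"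
    "\<And>f h. \<beta> (f + h) = \<beta> f + \<beta> h" "\<And>c f. \<beta> (fscale c f) = jscale J c (\<beta> f)"
proof -
  obtain B where B: "finite B" "B \<subseteq> U" "U \<subseteq> L.span B" using weight_space_finite by blast
  obtain B0 where B0: "B0 \<subseteq> B" "L.independent B0" "B \<subseteq> L.span B0"
    by (rule L.maximal_independent_subset)
  have fin: "finite B0" using B0(1) B(1) by (rule finite_subset)
  define d where "d = card B0"
  obtain b where b: "bij_betw b {..<d} B0"
    using ex_bij_betw_nat_finite[OF fin] by (auto simp: d_def atLeast0LessThan)
  have inj: "inj_on b {..<d}" and img: "b ` {..<d} = B0" using b by (auto simp: bij_betw_def)
  have spanU: "L.span B0 = U"
    using L.span_minimal[OF B0(3) L.subspace_span] B(3) L.span_minimal[OF _ wspace_subspace] B0(1) B(2) by blast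
  define \<beta> where "\<beta> f = (\<Sum>i<d. jscale J (f i) (b i))" for f :: "nat \<Rightarrow> complex"
  have add: "\<beta> (f + h) = \<beta> f + \<beta> h" for f h
    by (simp add: \<beta>_def L.scale_left_distrib sum.distrib)
  have scale: "\<beta> (fscale c f) = jscale J c (\<beta> f)" for c f
    by (simp add: \<beta>_def fscale_def L.scale_sum_right)
  have sum_B0: "\<beta> (\<lambda>i. if i < d then u (b i) else 0) = (\<Sum>v\<in>B0. jscale J (u v) v)" for u
    unfolding \<beta>_def img[symmetric] by (simp add: sum.reindex[OF inj])
  have "bij_betw \<beta> (coord d) U"
  proof (rule bij_betw_imageI)
    show "inj_on \<beta> (coord d)"
    proof (rule inj_onI)
      fix f h assume fh: "f \<in> coord d" "h \<in> coord d" "\<beta> f = \<beta> h"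
      have "f i = h i" if i: "i < d" for i
      proof -
        let ?u = "\<lambda>v. f (inv_into {..<d} b v) - h (inv_into {..<d} b v)"
        have "(\<Sum>v\<in>B0. jscale J (?u v) v) = \<beta> f - \<beta> h"
          unfolding img[symmetric] \<beta>_def
          by (simp add: sum.reindex[OF inj] inv_into_f_f[OF inj] L.scale_left_diff_distrib sum_subtractf)
        then have "(\<Sum>v\<in>B0. jscale J (?u v) v) = 0" using fh(3) by simp
        from L.independentD[OF B0(2) fin order_refl this, of "b i"] show ?thesis
          using i img by (auto simp: inv_into_f_f[OF inj])
      qed
      then show "f = h" using fh(1,2) by (auto simp: fun_eq_iff coord_def) (metis not_le)
    qed
    show "\<beta> ` coord d = U"
    proof
      show "\<beta> ` coord d \<subseteq> U"
        using B0(1) B(2) img unfolding \<beta>_def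
        by (auto intro!: L.subspace_sum[OF wspace_subspace] L.subspace_scale[OF wspace_subspace])
      show "U \<subseteq> \<beta> ` coord d"
      proof
        fix x assume "x \<in> U"
        then have "x \<in> L.span B0" using spanU by simp
        then obtain u where "x = (\<Sum>v\<in>B0. jscale J (u v) v)"
          using fin by (auto simp: L.span_finite)
        then have "x = \<beta> (\<lambda>i. if i < d then u (b i) else 0)" by (simp add: sum_B0)
        moreover have "(\<lambda>i. if i < d then u (b i) else 0) \<in> coord d" by (auto simp: coord_def)
        ultimately show "x \<in> \<beta> ` coord d" by blast
      qed
    qed
  qed
  then show thesis using that add scale by blast
qed

end

section \<open>Irreducible objects are tensor modules\<close>

definition mat_of :: "nat \<Rightarrow> ((nat \<Rightarrow> complex) \<Rightarrow> (nat \<Rightarrow> complex)) \<Rightarrow> (nat \<Rightarrow> nat \<Rightarrow> complex)" where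
  "mat_of d A = (\<lambda>i j. if i < d \<and> j < d then A (unit_vec j) i else 0)"

lemma supported_mat_of: "supported d (mat_of d A)"
  by (simp add: supported_def mat_of_def)

lemma mvec_mat_of:
  assumes A: "\<And>f. f \<in> coord d \<Longrightarrow> A f \<in> coord d"
      "\<And>f h. f \<in> coord d \<Longrightarrow> h \<in> coord d \<Longrightarrow> A (f + h) = A f + A h"
      "\<And>c f. f \<in> coord d \<Longrightarrow> A (fscale c f) = fscale c (A f)"
    and f: "f \<in> coord d"
  shows "mvec d (mat_of d A) f = A f"
proof
  fix i
  have A_sum: "A (\<Sum>j\<in>S. fscale (f j) (unit_vec j)) = (\<Sum>j\<in>S. fscale (f j) (A (unit_vec j)))"
    if "finite S" "S \<subseteq> {..<d}" for S
    using that
  proof (induction S rule: finite_induct)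
    case empty
    have "A (fscale 0 0) = fscale 0 (A 0)" using fs.subspace_0[OF subspace_coord] by (rule A(3))
    then show ?case by (simp only: sum.empty fs.scale_zero_left)
  next
    case (insert j S)
    have "(\<Sum>j\<in>S. fscale (f j) (unit_vec j)) \<in> coord d"
      using insert.prems by (intro fs.subspace_sum[OF subspace_coord] fs.subspace_scale[OF subspace_coord] unit_vec_coord) auto
    moreover have "unit_vec j \<in> coord d" "fscale (f j) (unit_vec j) \<in> coord d"
      using insert.prems by (auto intro!: fs.subspace_scale[OF subspace_coord] unit_vec_coord)
    moreover have "A (\<Sum>j\<in>S. fscale (f j) (unit_vec j)) = (\<Sum>j\<in>S. fscale (f j) (A (unit_vec j)))"
      by (rule insert.IH) (use insert.prems in auto)
    ultimately show ?case using insert.hyps by (simp only: sum.insert A(2,3) not_False_eq_True)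
  qed
  have sum_apply: "(\<Sum>j\<in>S. F j) i = (\<Sum>j\<in>S. F j i)" if "finite S" for S :: "nat set" and F :: "nat \<Rightarrow> nat \<Rightarrow> complex"
    using that by (induction S rule: finite_induct) simp_all
  have "A f = (\<Sum>j<d. fscale (f j) (A (unit_vec j)))"
    using A_sum[of "{..<d}"] coord_expand[OF f] by simp
  then have Afi: "A f i = (\<Sum>j<d. f j * A (unit_vec j) i)"
    by (simp add: sum_apply fscale_def)
  show "mvec d (mat_of d A) f i = A f i"
  proof (cases "i < d")
    case True
    then show ?thesis by (simp add: Afi mvec_def mat_of_def mult.commute)
  next
    case False
    then show ?thesis using A(1)[OF f] by (simp add: mvec_def coord_def)
  qed
qed

text \<open>Coordinates on the weight space turn the operators \<open>T(r, u)\<close> into matrices, so that the module \<open>V\<close> is realized on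
  \<open>coord d\<close>.\<close>

locale J_coordinates = J_object J lam
  for J :: "('n::finite, 'j::ab_group_add) AS_module" and lam +
  fixes d :: nat and \<beta> :: "(nat \<Rightarrow> complex) \<Rightarrow> 'j"
  assumes bij: "bij_betw \<beta> (coord d) (wspace 0)"
    and \<beta>_add: "\<beta> (f + h) = \<beta> f + \<beta> h" and \<beta>_scale: "\<beta> (fscale c f) = jscale J c (\<beta> f)"
begin

lemma \<beta>_mem: "f \<in> coord d \<Longrightarrow> \<beta> f \<in> U"
  using bij by (rule bij_betw_apply)

lemma \<beta>_inj: "f \<in> coord d \<Longrightarrow> h \<in> coord d \<Longrightarrow> \<beta> f = \<beta> h \<Longrightarrow> f = h"
  using bij by (auto simp: bij_betw_def dest: inj_onD)

definition \<gamma> :: "'j \<Rightarrow> nat \<Rightarrow> complex" where "\<gamma> = inv_into (coord d) \<beta>"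

lemma \<gamma>: "u \<in> U \<Longrightarrow> \<gamma> u \<in> coord d" "u \<in> U \<Longrightarrow> \<beta> (\<gamma> u) = u"
  using bij unfolding \<gamma>_def by (auto simp: bij_betw_def inv_into_into f_inv_into_f)

lemma \<beta>_0: "\<beta> 0 = 0"
  using \<beta>_scale[of 0 0] by simp

lemma \<beta>_diff: "\<beta> (f - h) = \<beta> f - \<beta> h"
  using \<beta>_add[of "f - h" h] by (simp add: algebra_simps)

lemma coord_closed: "f \<in> coord d \<Longrightarrow> h \<in> coord d \<Longrightarrow> f + h \<in> coord d"
  "f \<in> coord d \<Longrightarrow> fscale c f \<in> coord d" "f \<in> coord d \<Longrightarrow> h \<in> coord d \<Longrightarrow> f - h \<in> coord d"
  by (rule fs.subspace_add[OF subspace_coord] fs.subspace_scale[OF subspace_coord] fs.subspace_diff[OF subspace_coord]; assumption)+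

text \<open>The operator on the weight space by which \<open>t\<^sup>r (u \<cdot> d)\<close> acts, after its degree is removed.\<close>

definition S :: "int ^ 'n \<Rightarrow> complex ^ 'n \<Rightarrow> 'j \<Rightarrow> 'j" where
  "S r u w = t (- r) (jact J (vf r u) w)"

lemma act_wspace:
  assumes d: "dot u r = 0" and w: "w \<in> U"
  shows "jact J (vf r u) w \<in> wspace r"
  unfolding wspace_def
proof (intro CollectI conjI allI)
  have X: "vf r u \<in> SN" by (rule vf_in_SN[OF two d])
  have wJ: "w \<in> jcarrier J" by (rule U_carrier[OF w])
  show "jact J (vf r u) w \<in> jcarrier J" by (rule L.act_closed[OF X wJ])
  fix a
  have "op_bracket (deg_der a) (vf r u) = op_scale (of_int (r $ a)) (vf r u)"
    unfolding deg_der_vf op_bracket_vf vf_scale[symmetric] by simp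
  then have "jscale J (of_int (r $ a)) (jact J (vf r u) w)
      = jact J (deg_der a) (jact J (vf r u) w) - jact J (vf r u) (jact J (deg_der a) w)"
    using L.act_bracket[OF deg_SN X wJ, of a] L.act_scale_left[OF X wJ] by simp
  moreover have "jact J (deg_der a) w = jscale J (lam $ a) w"
    using w by (simp add: wspace_def)
  ultimately show "jact J (deg_der a) (jact J (vf r u) w) = jscale J (of_int (r $ a) + lam $ a) (jact J (vf r u) w)"
    using L.act_scale_right[OF X wJ, of "lam $ a"] by (simp add: L.scale_left_distrib eq_diff_eq)
qed

lemma S_mem: "dot u r = 0 \<Longrightarrow> w \<in> U \<Longrightarrow> S r u w \<in> U"
  using wspace_shift[OF act_wspace, of u r w "- r"] by (simp add: S_def)

lemma act_S: "jact J (vf r u) w = t r (S r u w)"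
  unfolding S_def t_t by (simp add: tmon_0)

lemma act_t_S:
  assumes "dot u r = 0" "w \<in> U"
  shows "jact J (vf r u) (t s w) = t (r + s) (jscale J (dot u s) w + S r u w)"
proof -
  have "t s (t r (S r u w)) = t (r + s) (S r u w)" unfolding t_t by (simp add: add.commute)
  then show ?thesis
    using act_t[OF assms(1) U_carrier[OF assms(2)], of s]
    by (simp only: act_S Jm.scale_right_distrib mult_scale)
qed

lemma S_add_left: "dot u r = 0 \<Longrightarrow> dot v r = 0 \<Longrightarrow> w \<in> U \<Longrightarrow> S r (u + v) w = S r u w + S r v w"
  by (simp add: S_def vf_add L.act_add_left vf_in_SN[OF two] U_carrier Jm.scale_right_distrib)

lemma S_scale_left: "dot u r = 0 \<Longrightarrow> w \<in> U \<Longrightarrow> S r (c *s u) w = jscale J c (S r u w)"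
  by (simp add: S_def vf_scale L.act_scale_left vf_in_SN[OF two] U_carrier mult_scale)

lemma S_add_right: "dot u r = 0 \<Longrightarrow> w \<in> U \<Longrightarrow> w' \<in> U \<Longrightarrow> S r u (w + w') = S r u w + S r u w'"
  by (simp add: S_def L.act_add_right vf_in_SN[OF two] U_carrier Jm.scale_right_distrib)

lemma S_scale_right: "dot u r = 0 \<Longrightarrow> w \<in> U \<Longrightarrow> S r u (jscale J c w) = jscale J c (S r u w)"
  by (simp add: S_def L.act_scale_right vf_in_SN[OF two] U_carrier mult_scale)

lemma S_bracket:
  assumes d: "dot u r = 0" "dot v s = 0" and w: "w \<in> U"
  shows "S r u (S s v w) - S s v (S r u w)
    = S (r + s) (dot u s *s v - dot v r *s u) w - jscale J (dot u s) (S s v w) + jscale J (dot v r) (S r u w)"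
proof -
  have X: "vf r u \<in> SN" "vf s v \<in> SN" using d by (auto intro: vf_in_SN[OF two])
  have "t (r + s) (S (r + s) (dot u s *s v - dot v r *s u) w)
      = jact J (vf r u) (jact J (vf s v) w) - jact J (vf s v) (jact J (vf r u) w)"
    using L.act_bracket[OF X U_carrier[OF w]] unfolding op_bracket_vf act_S[of "r + s"] .
  also have "jact J (vf r u) (jact J (vf s v) w) = t (r + s) (jscale J (dot u s) (S s v w) + S r u (S s v w))"
    unfolding act_S[of s] by (rule act_t_S[OF d(1) S_mem[OF d(2) w]])
  also have "jact J (vf s v) (jact J (vf r u) w) = t (r + s) (jscale J (dot v r) (S r u w) + S s v (S r u w))"
    unfolding act_S[of r] using act_t_S[OF d(2) S_mem[OF d(1) w], of r] by (simp only: add.commute[of s])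
  finally have "S (r + s) (dot u s *s v - dot v r *s u) w
      = (jscale J (dot u s) (S s v w) + S r u (S s v w)) - (jscale J (dot v r) (S r u w) + S s v (S r u w))"
    unfolding Jm.scale_right_diff_distrib[symmetric] by (simp only: t_inj)
  then show ?thesis by (simp add: algebra_simps)
qed

lemma S_degree_0:
  assumes w: "w \<in> U"
  shows "S 0 u w = jscale J (cdot u lam) w"
proof (rule vec_axis_induct[where P = "\<lambda>u. S 0 u w = jscale J (cdot u lam) w"])
  show "S 0 (axis a 1) w = jscale J (cdot (axis a 1) lam) w" for a
    using w by (simp add: S_def deg_der_vf[symmetric] tmon_0 wspace_def)
qed (simp_all add: S_add_left S_scale_left w cdot_simps L.scale_left_distrib)

definition T :: "int ^ 'n \<Rightarrow> complex ^ 'n \<Rightarrow> nat \<Rightarrow> nat \<Rightarrow> complex" where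
  "T r u = mat_of d (\<lambda>f. \<gamma> (S r u (\<beta> f)))"

lemma \<beta>_T:
  assumes u: "dot u r = 0" and f: "f \<in> coord d"
  shows "\<beta> (mvec d (T r u) f) = S r u (\<beta> f)"
proof -
  have mem: "S r u (\<beta> f) \<in> U" if "f \<in> coord d" for f by (rule S_mem[OF u \<beta>_mem[OF that]])
  have "mvec d (T r u) f = \<gamma> (S r u (\<beta> f))"
    unfolding T_def
  proof (rule mvec_mat_of[OF _ _ _ f])
    show "\<gamma> (S r u (\<beta> f)) \<in> coord d" if "f \<in> coord d" for f by (rule \<gamma>(1)[OF mem[OF that]])
    show "\<gamma> (S r u (\<beta> (f + h))) = \<gamma> (S r u (\<beta> f)) + \<gamma> (S r u (\<beta> h))" if "f \<in> coord d" "h \<in> coord d" for f h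
    proof (rule \<beta>_inj)
      show "\<beta> (\<gamma> (S r u (\<beta> (f + h)))) = \<beta> (\<gamma> (S r u (\<beta> f)) + \<gamma> (S r u (\<beta> h)))"
        unfolding \<gamma>(2)[OF mem[OF coord_closed(1)[OF that]]] \<beta>_add[of "\<gamma> (S r u (\<beta> f))"]
          \<gamma>(2)[OF mem[OF that(1)]] \<gamma>(2)[OF mem[OF that(2)]]
        using that by (simp add: \<beta>_add S_add_right u \<beta>_mem)
    qed (use that mem coord_closed in \<open>simp_all add: \<gamma>(1)\<close>)
    show "\<gamma> (S r u (\<beta> (fscale c f))) = fscale c (\<gamma> (S r u (\<beta> f)))" if "f \<in> coord d" for c f
    proof (rule \<beta>_inj)
      show "\<beta> (\<gamma> (S r u (\<beta> (fscale c f)))) = \<beta> (fscale c (\<gamma> (S r u (\<beta> f))))"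
        unfolding \<gamma>(2)[OF mem[OF coord_closed(2)[OF that]]] \<beta>_scale[of c "\<gamma> (S r u (\<beta> f))"] \<gamma>(2)[OF mem[OF that]]
        using that by (simp add: \<beta>_scale S_scale_right u \<beta>_mem)
    qed (use that mem coord_closed in \<open>simp_all add: \<gamma>(1)\<close>)
  qed
  then show ?thesis using \<gamma>(2)[OF mem[OF f]] by simp
qed

lemma supported_T: "supported d (T r u)"
  unfolding T_def by (rule supported_mat_of)

lemma supported_combine:
  "supported d A \<Longrightarrow> supported d B \<Longrightarrow> supported d (A + B)"
  "supported d A \<Longrightarrow> supported d B \<Longrightarrow> supported d (A - B)"
  "supported d A \<Longrightarrow> supported d (mscal c A)"
  by (simp_all add: supported_def mscal_def)

lemma matrix_eqI_\<beta>:
  assumes "supported d A" "supported d B" "\<And>f. f \<in> coord d \<Longrightarrow> \<beta> (mvec d A f) = \<beta> (mvec d B f)"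
  shows "A = B"
  by (rule matrix_eqI[OF assms(1,2)]) (rule \<beta>_inj[OF mvec_coord mvec_coord assms(3)])

lemma T_relations:
  "adm r u \<Longrightarrow> adm r v \<Longrightarrow> T r (u + v) = T r u + T r v"
  "adm r u \<Longrightarrow> T r (c *s u) = mscal c (T r u)"
  "adm r u \<Longrightarrow> adm s v \<Longrightarrow> mbr d (T r u) (T s v)
    = T (r + s) (dot u s *s v - dot v r *s u) - mscal (dot u s) (T s v) + mscal (dot v r) (T r u)"
proof -
  show "T r (u + v) = T r u + T r v" if "adm r u" "adm r v"
    using that by (intro matrix_eqI_\<beta> supported_combine supported_T)
      (simp add: \<beta>_T adm_def dot_simps mvec_add \<beta>_add S_add_left \<beta>_mem)
  show "T r (c *s u) = mscal c (T r u)" if "adm r u"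
    using that by (intro matrix_eqI_\<beta> supported_combine supported_T)
      (simp add: \<beta>_T adm_def dot_simps mvec_scale \<beta>_scale S_scale_left \<beta>_mem)
  show "mbr d (T r u) (T s v)
    = T (r + s) (dot u s *s v - dot v r *s u) - mscal (dot u s) (T s v) + mscal (dot v r) (T r u)"
    if "adm r u" "adm s v"
  proof (intro matrix_eqI_\<beta> supported_combine supported_T supported_mbr)
    fix f assume f: "f \<in> coord d"
    have d: "dot u r = 0" "dot v s = 0" using that by (simp_all add: adm_def)
    then have x: "dot (dot u s *s v - dot v r *s u) (r + s) = 0" by (simp add: dot_simps)
    show "\<beta> (mvec d (mbr d (T r u) (T s v)) f)
        = \<beta> (mvec d (T (r + s) (dot u s *s v - dot v r *s u) - mscal (dot u s) (T s v) + mscal (dot v r) (T r u)) f)"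
      using S_bracket[OF d \<beta>_mem[OF f]]
      by (simp only: mvec_mbr mvec_add mvec_diff mvec_scale \<beta>_add \<beta>_diff \<beta>_scale \<beta>_T d x f mvec_coord)
  qed
qed

lemma glue_map_\<beta>:
  assumes "fs.subspace W" "W \<subseteq> coord d"
  shows "glue_map J lam fscale W \<beta>"
  by unfold_locales (use assms in \<open>auto intro: \<beta>_mem \<beta>_add \<beta>_scale\<close>)

text \<open>An invariant subspace of the weight space generates the submodule of its multiples by monomials.  Fields of degree
  zero act on the weight space by scalars and impose no condition.\<close>

lemma matrices_irreducible:
  assumes irr: "AS_irreducible J"
  shows "irreducible_matrices d {T r u | r u. adm r u}"
proof
  interpret Gc: glue_map J lam fscale "coord d" \<beta> by (rule glue_map_\<beta>[OF subspace_coord order_refl])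
  have \<beta>_ker: "f = 0" if "f \<in> coord d" "\<beta> f = 0" for f
    using \<beta>_inj[OF that(1) fs.subspace_0[OF subspace_coord]] that(2) \<beta>_0 by simp
  have surj: "\<exists>f\<in>coord d. u = \<beta> f" if "u \<in> U" for u
    using \<gamma>[OF that] by metis
  show "supported d A" if "A \<in> {T r u | r u. adm r u}" for A using that supported_T by auto
  show "d > 0"
  proof (rule ccontr)
    assume "\<not> d > 0"
    then have "f = 0" if "f \<in> coord d" for f using that by (auto simp: coord_def fun_eq_iff)
    then have "p = 0" if "p \<in> tensor_carrier (coord d)" for p :: "(int ^ 'n) \<Rightarrow>\<^sub>0 (nat \<Rightarrow> complex)"
      using that by (intro poly_mapping_eqI) (simp add: tensor_carrier_def)
    then have "x = 0" if "x \<in> jcarrier J" for x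
      using Gc.glue_surj[OF surj that] Gc.glue_0 by metis
    then show False using irr L.subspace_0[OF L.carrier_subspace] by (auto simp: AS_irreducible_def)
  qed
  fix W assume W: "fs.subspace W" "W \<subseteq> coord d"
    and inv: "\<And>A w. A \<in> {T r u | r u. adm r u} \<Longrightarrow> w \<in> W \<Longrightarrow> mvec d A w \<in> W"
  interpret G: glue_map J lam fscale W \<beta> by (rule glue_map_\<beta>[OF W])
  let ?Q = "G.glue ` tensor_carrier W"
  have QJ: "?Q \<subseteq> jcarrier J" using G.glue_closed by blast
  note Qsub = G.glue_image_subspace
  have Q_add: "x + y \<in> ?Q" if "x \<in> ?Q" "y \<in> ?Q" for x y by (rule Jm.subspace_add[OF Qsub that])
  have Q_scale: "jscale J c x \<in> ?Q" if "x \<in> ?Q" for c x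
    unfolding jscale_def by (rule Jm.subspace_scale[OF Qsub that])
  have tQ: "t s (\<beta> w) \<in> ?Q" if "w \<in> W" for s w
  proof (rule image_eqI)
    show "t s (\<beta> w) = G.glue (Poly_Mapping.single s w)" by (rule G.glue_single[symmetric])
    show "Poly_Mapping.single s w \<in> tensor_carrier W"
      using that fs.tensor_carrier_single[OF G.C0] by blast
  qed
  have Q_vf: "jact J (vf r u) x \<in> ?Q" if u: "dot u r = 0" and x: "x \<in> ?Q" for r u x
  proof -
    obtain p where p: "p \<in> tensor_carrier W" "x = G.glue p" using x by blast
    show ?thesis
      using p(1) G.C0 unfolding p(2)
    proof (induction p rule: tensor_carrier_induct)
      case zero
      then show ?case
        using L.act_scale_right[OF vf_in_SN[OF two u] L.subspace_0[OF L.carrier_subspace], of 0] Jm.subspace_0[OF Qsub]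
        by simp
    next
      case (add p q)
      then show ?case
        using Q_add G.glue_add[OF add(1,2)] L.act_add_right[OF vf_in_SN[OF two u] G.glue_closed[OF add(1)] G.glue_closed[OF add(2)]]
        by simp
    next
      case (single s w)
      have wU: "\<beta> w \<in> U" and wc: "w \<in> coord d" using single W(2) \<beta>_mem by blast+
      have "\<exists>w'\<in>W. S r u (\<beta> w) = \<beta> w'"
      proof (cases "r = 0")
        case True
        then have "S r u (\<beta> w) = \<beta> (fscale (cdot u lam) w)" by (simp add: S_degree_0[OF wU] \<beta>_scale)
        then show ?thesis using fs.subspace_scale[OF W(1) single] by blast
      next
        case False
        then have "adm r u" using u by (simp add: adm_def)
        then have "mvec d (T r u) w \<in> W" using inv single by blast
        then show ?thesis using \<beta>_T[OF u wc] by metis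
      qed
      then obtain w' where w': "w' \<in> W" "S r u (\<beta> w) = \<beta> w'" by blast
      have "fscale (dot u s) w + w' \<in> W"
        by (rule fs.subspace_add[OF W(1) fs.subspace_scale[OF W(1) single] w'(1)])
      from tQ[OF this, of "r + s"] show ?case
        unfolding G.glue_single act_t_S[OF u wU] w'(2) \<beta>_add \<beta>_scale .
    qed
  qed
  have "AS_submodule ?Q J"
    unfolding AS_submodule_def
  proof (intro conjI ballI QJ Qsub)
    fix X x assume X: "X \<in> (SN :: ('n laurent \<Rightarrow> 'n laurent) set)" and x: "x \<in> ?Q"
    have xJ: "x \<in> jcarrier J" using x QJ by blast
    show "jact J X x \<in> ?Q"
    proof (rule SN_induct[OF X, where P = "\<lambda>X. jact J X x \<in> ?Q"])
      show "jact J (vf r u) x \<in> ?Q" if "dot u r = 0" for r u by (rule Q_vf[OF that x])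
      show "jact J (X + Y) x \<in> ?Q" if "X \<in> SN" "Y \<in> SN" "jact J X x \<in> ?Q" "jact J Y x \<in> ?Q" for X Y
        unfolding L.act_add_left[OF that(1,2) xJ] by (rule Q_add[OF that(3,4)])
      show "jact J (op_scale c X) x \<in> ?Q" if "X \<in> SN" "jact J X x \<in> ?Q" for c X
        unfolding L.act_scale_left[OF that(1) xJ] by (rule Q_scale[OF that(2)])
    qed
  qed
  then consider "?Q = {0}" | "?Q = jcarrier J" using irr unfolding AS_irreducible_def by blast
  then show "W = {0} \<or> W = coord d"
  proof cases
    case 1
    have "w = 0" if "w \<in> W" for w
    proof -
      have "t 0 (\<beta> w) = 0" using tQ[OF that, of 0] 1 by blast
      then show ?thesis using \<beta>_ker that W(2) by (simp add: tmon_0 subset_iff)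
    qed
    then show ?thesis using fs.subspace_0[OF W(1)] by blast
  next
    case 2
    have "f \<in> W" if f: "f \<in> coord d" for f
    proof -
      have "\<beta> f \<in> ?Q" using 2 U_carrier[OF \<beta>_mem[OF f]] by simp
      then obtain p where p: "p \<in> tensor_carrier W" "\<beta> f = G.glue p" by blast
      have "Poly_Mapping.single 0 f = p"
      proof (rule Gc.glue_inj[OF \<beta>_ker])
        show "Poly_Mapping.single 0 f \<in> tensor_carrier (coord d)"
          using f fs.tensor_carrier_single[OF Gc.C0] by blast
        show "p \<in> tensor_carrier (coord d)" using p(1) W(2) unfolding tensor_carrier_def by blast
        show "Gc.glue (Poly_Mapping.single 0 f) = Gc.glue p"
          unfolding Gc.glue_single p(2)[symmetric] by (rule t_0)
      qed
      then have "f = Poly_Mapping.lookup p 0" by (metis lookup_single_eq)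
      then show ?thesis using p(1) unfolding tensor_carrier_def by blast
    qed
    then show ?thesis using W(2) by blast
  qed
qed

text \<open>The structure theorem for the matrices \<open>T(r, u)\<close> defines the action on \<open>coord d\<close>; by Schur's lemma its central part
  is given by scalars.  The map \<open>t\<^sup>s \<otimes> f \<mapsto> t\<^sup>s \<beta>(f)\<close> is the isomorphism.\<close>

lemma irreducible_object_is_tensor:
  assumes irr: "AS_irreducible J" and card: "CARD('n) \<ge> 2"
  shows "\<exists>(V :: ('n, nat \<Rightarrow> complex) sla_module) M.
    fd_irreducible_sla_module V \<and> is_tensor_module lam V M \<and> AS_isomorphic M J"
proof -
  interpret IM: irreducible_matrices d "{T r u | r u. adm r u}" by (rule matrices_irreducible[OF irr])
  interpret TL: torus_lie mscal "mbr d" T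
  proof (rule torus_lie.intro[OF bracket_space_mbr], unfold_locales)
    show "\<exists>B. finite B \<and> (\<forall>r u. adm r u \<longrightarrow> T r u \<in> ms.span B)"
      using supported_finite_span[of d] supported_T by metis
    show "z = 0" if "adm r u" "\<And>q w. adm q w \<Longrightarrow> mbr d z (T q w) = 0" "z = mbr d (T r u) y" for r u z y
      by (rule IM.central_commutator_zero[of "T r u" z y]) (use that in auto)
    show "mbr d (T r u) z = 0"
      if "ms.subspace Z" "\<And>z z'. z \<in> Z \<Longrightarrow> z' \<in> Z \<Longrightarrow> mbr d z z' = 0"
        "\<And>q w z. adm q w \<Longrightarrow> z \<in> Z \<Longrightarrow> mbr d (T q w) z \<in> Z" "adm r u" "z \<in> Z" for Z r u z
      by (rule IM.abelian_ideal_central[of Z]) (use that in auto)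
  qed (rule mbr_jacobi T_relations; assumption)+
  obtain M and \<Phi> :: "complex ^ 'n ^ 'n \<Rightarrow> nat \<Rightarrow> nat \<Rightarrow> complex" where
    M: "\<And>a r u. adm r u \<Longrightarrow> mbr d (M a) (T r u) = 0"
    and \<Phi>: "\<And>A B. \<Phi> (A + B) = \<Phi> A + \<Phi> B" "\<And>c A. \<Phi> (mscale c A) = mscal c (\<Phi> A)"
      "\<And>A B. trace A = 0 \<Longrightarrow> trace B = 0 \<Longrightarrow> \<Phi> (A ** B - B ** A) = mbr d (\<Phi> A) (\<Phi> B)"
    and T_eq: "\<And>r u. adm r u \<Longrightarrow> T r u = (\<Sum>a\<in>UNIV. mscal (u $ a) (M a)) + \<Phi> (outer r u)"
    by (rule TL.structure_theorem[OF card]) blast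
  have "\<exists>e. \<forall>x\<in>coord d. mvec d (M a) x = fscale e x" for a
    by (rule IM.central_scalar[of "M a"]) (use M in auto)
  then obtain m where m: "\<And>a x. x \<in> coord d \<Longrightarrow> mvec d (M a) x = fscale (m a) x" by metis
  define \<mu> where "\<mu> = (\<chi> a. m a)"
  define V where "V = \<lparr>vcarrier = coord d, vscale = fscale,
      vact = (\<lambda>(A, c) f. mvec d (\<Phi> A) f + fscale (cdot c \<mu>) f)\<rparr>"
  have V: "vcarrier V = coord d" "vscale V = fscale"
    "\<And>A c f. vact V (A, c) f = mvec d (\<Phi> A) f + fscale (cdot c \<mu>) f"
    by (simp_all add: V_def)
  have mvec_T: "mvec d (T r u) f = fscale (cdot u \<mu>) f + mvec d (\<Phi> (outer r u)) f"
    if "adm r u" "f \<in> coord d" for r u f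
  proof -
    have "mvec d (\<Sum>a\<in>UNIV. mscal (u $ a) (M a)) f = fscale (cdot u \<mu>) f"
      unfolding mvec_sum mvec_scale m[OF that(2)]
      by (simp add: cdot_def \<mu>_def fs.scale_sum_left)
    then show ?thesis unfolding T_eq[OF that(1)] mvec_add by simp
  qed
  have sla: "is_sla_module V"
    unfolding is_sla_module_def
  proof (rule lie_module.intro)
    show "vector_space (vscale V)" unfolding V by (rule fs.vector_space_axioms)
    show "lie_module_axioms (vscale V) sla_carrier sla_scale sla_bracket (vcarrier V) (vact V)"
    proof
      show "module.subspace (vscale V) (vcarrier V)" unfolding V by (rule subspace_coord)
      fix X :: "'n sla" and u assume u: "u \<in> vcarrier V" and X: "X \<in> sla_carrier"
      obtain A c where Ac: "X = (A, c)" "trace A = 0" using X by (auto simp: sla_carrier_def)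
      show "vact V X u \<in> vcarrier V"
        using u unfolding Ac V by (intro coord_closed mvec_coord)
      show "vact V X (u + v) = vact V X u + vact V X v" if "v \<in> vcarrier V" for v
        unfolding Ac V by (simp add: mvec_add fs.scale_right_distrib add_ac)
      show "vact V X (vscale V k u) = vscale V k (vact V X u)" for k
        unfolding Ac V by (simp add: mvec_scale fs.scale_right_distrib fs.scale_left_commute)
      show "vact V (sla_scale k X) u = vscale V k (vact V X u)" for k
        unfolding Ac V by (simp add: V sla_scale_def mscale_def[symmetric] \<Phi> mvec_scale cdot_simps fs.scale_right_distrib)
      fix Y :: "'n sla" assume Y: "Y \<in> sla_carrier"
      obtain B e where Be: "Y = (B, e)" "trace B = 0" using Y by (auto simp: sla_carrier_def)
      show "vact V (X + Y) u = vact V X u + vact V Y u"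
        unfolding Ac Be by (simp add: V \<Phi> mvec_add cdot_simps fs.scale_left_distrib add_ac)
      show "vact V (sla_bracket X Y) u = vact V X (vact V Y u) - vact V Y (vact V X u)"
        unfolding Ac Be sla_bracket_def
        by (simp add: V \<Phi>(3)[OF Ac(2) Be(2)] mvec_mbr cdot_simps mvec_add mvec_scale fs.scale_right_distrib
            fs.scale_left_commute[of "cdot c \<mu>"] add_diff_add diff_diff_eq2)
    qed
  qed
  interpret R: sla_scalar V \<mu> lam
  proof
    show "is_sla_module V" by (rule sla)
    show "vact V (C_elem a) u = vscale V (\<mu> $ a) u" if "u \<in> vcarrier V" for a u
    proof -
      have "mscale 0 0 = (0 :: complex ^ 'n ^ 'n)" by (simp add: mscale_def vec_eq_iff)
      then have "\<Phi> 0 = 0" using \<Phi>(2)[of 0 0] by simp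
      then show ?thesis by (simp add: V C_elem_def)
    qed
  qed (rule two)
  \<comment> \<open>The element \<open>(r u\<^sup>T, u)\<close> of the direct sum acts as \<open>T(r, u)\<close>, so submodules are invariant under all of these.\<close>
  have irrV: "W = {0} \<or> W = vcarrier V" if W: "sla_submodule W V" for W
    unfolding V
  proof (rule IM.irreducible)
    show "fs.subspace W" "W \<subseteq> coord d" using W by (simp_all add: sla_submodule_def V)
    fix A w assume A: "A \<in> {T r u | r u. adm r u}" and w: "w \<in> W"
    obtain r u where ru: "A = T r u" "adm r u" using A by blast
    have "(outer r u, u) \<in> sla_carrier" using ru(2) by (simp add: sla_carrier_def trace_outer adm_def)
    then have "vact V (outer r u, u) w \<in> W" using W w unfolding sla_submodule_def by blast
    moreover have "w \<in> coord d" using W w by (auto simp: sla_submodule_def V)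
    ultimately show "mvec d A w \<in> W" using mvec_T[OF ru(2)] by (simp add: ru(1) V add.commute)
  qed
  have fd: "fd_irreducible_sla_module V"
    unfolding fd_irreducible_sla_module_def
  proof (intro conjI sla allI impI irrV)
    have "fs.span (unit_vec ` {..<d}) = coord d"
      using coord_span fs.span_minimal[OF _ subspace_coord] unit_vec_coord by (metis image_subsetI lessThan_iff subset_antisym)
    then show "\<exists>B. finite B \<and> module.span (vscale V) B = vcarrier V"
      unfolding V by (intro exI[of _ "unit_vec ` {..<d}"]) simp
    show "vcarrier V \<noteq> {0}" using IM.unit_vec_0 unfolding V by blast
  qed
  interpret TR: tensor_rep V \<mu> lam R.tensor_module
    by unfold_locales (rule R.acts_tensor_module)
  interpret G: glue_map J lam fscale "coord d" \<beta> by (rule glue_map_\<beta>[OF subspace_coord order_refl])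
  have \<beta>_ker: "f = 0" if "f \<in> coord d" "\<beta> f = 0" for f
    using \<beta>_inj[OF that(1) fs.subspace_0[OF subspace_coord]] that(2) \<beta>_0 by simp
  have surj: "\<exists>f\<in>coord d. u = \<beta> f" if "u \<in> U" for u
    using \<gamma>[OF that] by metis
  have carrier: "jcarrier R.tensor_module = tensor_carrier (coord d)" using TR.carrier by (simp add: V)
  have gen: "\<beta> (R.gen_op r u s f) = jscale J (dot u s) (\<beta> f) + S r u (\<beta> f)"
    if u: "dot u r = 0" and f: "f \<in> coord d" for r u s f
  proof (cases "r = 0")
    case True
    then have "R.gen_op r u s f = fscale (dot u s + cdot u lam) f"
      using f by (simp add: R.coef_op_def R.shift_def outer_linear R.\<phi>_zero V)
    then show ?thesis
      using True by (simp add: \<beta>_scale S_degree_0[OF \<beta>_mem[OF f]] L.scale_left_distrib)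
  next
    case False
    then have "adm r u" using u by (simp add: adm_def)
    then have "R.gen_op r u s f = fscale (dot u s) f + mvec d (T r u) f"
      using False mvec_T[of r u f] f
      by (simp add: R.coef_op_def R.shift_def R.\<phi>_def V cdot_simps fs.scale_left_distrib add.assoc)
    then show ?thesis by (simp add: \<beta>_add \<beta>_scale \<beta>_T[OF u f])
  qed
  have glue_act: "G.glue (jact R.tensor_module X p) = jact J X (G.glue p)"
    if X: "X \<in> SN" and p: "p \<in> jcarrier R.tensor_module" for X p
  proof (rule SN_induct[OF X, where P = "\<lambda>X. G.glue (jact R.tensor_module X p) = jact J X (G.glue p)"])
    fix r and u :: "complex ^ 'n" assume u: "dot u r = 0" "vf r u \<in> SN"
    show "G.glue (jact R.tensor_module (vf r u) p) = jact J (vf r u) (G.glue p)"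
      using p
    proof (induction p rule: TR.carrier_induct)
      case zero
      have "jact J (vf r u) 0 = 0"
        using L.act_scale_right[OF u(2) L.subspace_0[OF L.carrier_subspace], of 0] by simp
      then show ?case by (simp add: TR.act_zero u)
    next
      case (single s f)
      then have f: "f \<in> coord d" by (simp add: V)
      show ?case
        unfolding TR.act_vf[OF u(1) single] G.glue_single gen[OF u(1) f] act_t_S[OF u(1) \<beta>_mem[OF f]] ..
    next
      case (add p q)
      have c: "p \<in> tensor_carrier (coord d)" "q \<in> tensor_carrier (coord d)"
        "jact R.tensor_module (vf r u) p \<in> tensor_carrier (coord d)" "jact R.tensor_module (vf r u) q \<in> tensor_carrier (coord d)"
        using add(1,2) TR.J.act_closed[OF u(2)] by (simp_all only: carrier)
      show ?case
        unfolding TR.J.act_add_right[OF u(2) add(1,2)] G.glue_add[OF c(1,2)] G.glue_add[OF c(3,4)]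
          L.act_add_right[OF u(2) G.glue_closed[OF c(1)] G.glue_closed[OF c(2)]] add(3,4) ..
    qed
  next
    have pc: "p \<in> tensor_carrier (coord d)" using p by (simp only: carrier)
    have act_c: "jact R.tensor_module X p \<in> tensor_carrier (coord d)" if "X \<in> SN" for X
      using TR.J.act_closed[OF that p] by (simp only: carrier)
    note gc = G.glue_closed[OF pc]
    show "G.glue (jact R.tensor_module (X + Y) p) = jact J (X + Y) (G.glue p)"
      if "X \<in> SN" "Y \<in> SN" "G.glue (jact R.tensor_module X p) = jact J X (G.glue p)"
        "G.glue (jact R.tensor_module Y p) = jact J Y (G.glue p)" for X Y
      unfolding TR.J.act_add_left[OF that(1,2) p] L.act_add_left[OF that(1,2) gc]
        G.glue_add[OF act_c[OF that(1)] act_c[OF that(2)]] that(3,4) ..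
    show "G.glue (jact R.tensor_module (op_scale c X) p) = jact J (op_scale c X) (G.glue p)"
      if "X \<in> SN" "G.glue (jact R.tensor_module X p) = jact J X (G.glue p)" for c X
      unfolding TR.J.act_scale_left[OF that(1) p] L.act_scale_left[OF that(1) gc]
      unfolding jscale_def TR.mult V G.glue_mult[OF act_c[OF that(1)]] that(2) ..
  qed
  have "AS_isomorphic R.tensor_module J"
    unfolding AS_isomorphic_def
  proof (intro exI[of _ G.glue] conjI ballI allI)
    show "bij_betw G.glue (jcarrier R.tensor_module) (jcarrier J)"
      unfolding carrier
    proof (rule bij_betw_imageI)
      show "inj_on G.glue (tensor_carrier (coord d))"
        by (rule inj_onI) (rule G.glue_inj[OF \<beta>_ker])
      show "G.glue ` tensor_carrier (coord d) = jcarrier J"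
        using G.glue_closed G.glue_surj[OF surj] by blast
    qed
    show "G.glue (p + q) = G.glue p + G.glue q"
      if "p \<in> jcarrier R.tensor_module" "q \<in> jcarrier R.tensor_module" for p q
      using that unfolding carrier by (rule G.glue_add)
    show "G.glue (jmult R.tensor_module f p) = jmult J f (G.glue p)" if "p \<in> jcarrier R.tensor_module" for f p
      using that unfolding carrier TR.mult V by (rule G.glue_mult)
  qed (rule glue_act)
  moreover have "is_tensor_module lam V R.tensor_module"
    by (rule R.acts_is_tensor_module[OF R.acts_tensor_module])
  ultimately show ?thesis using fd by blast
qed

end


section \<open>The correspondence\<close>

lemma two_indices:
  assumes "CARD('n::finite) \<ge> 2"
  shows "\<exists>a b :: 'n. a \<noteq> b"
proof (rule ccontr)
  assume "\<not> ?thesis"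
  then have "UNIV = {undefined :: 'n}" by auto
  then have "CARD('n) = card {undefined :: 'n}" by (simp only:)
  then show False using assms by simp
qed

text \<open>The elements \<open>C\<^sub>a\<close> are central, so their eigenspaces are submodules.\<close>

lemma fd_irreducible_scalars:
  fixes V :: "('n::finite, 'v::ab_group_add) sla_module"
  assumes V: "fd_irreducible_sla_module V"
  obtains \<mu> :: "complex ^ 'n" where "\<And>a u. u \<in> vcarrier V \<Longrightarrow> vact V (C_elem a) u = vscale V (\<mu> $ a) u"
proof -
  have irr: "vcarrier V \<noteq> {0}" "\<And>W. sla_submodule W V \<Longrightarrow> W = {0} \<or> W = vcarrier V"
    using V by (simp_all add: fd_irreducible_sla_module_def)
  interpret sla_rep V using V by unfold_locales (simp add: fd_irreducible_sla_module_def)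
  obtain B where B: "finite B" "lm.span B = vcarrier V"
    using V by (auto simp: fd_irreducible_sla_module_def)
  have "\<exists>e. \<forall>u\<in>vcarrier V. vact V (C_elem a) u = vscale V e u" for a
  proof -
    have C: "C_elem a \<in> sla_carrier" by (simp add: C_elem_def sla_carrier_def)
    obtain e u where e: "u \<in> vcarrier V" "u \<noteq> 0" "vact V (C_elem a) u = vscale V e u"
      by (rule cs.eigenvector_exists[OF sub irr(1) B(1), of "vact V (C_elem a)"])
        (use B(2) C in \<open>auto intro: lm.act_closed lm.act_add_right lm.act_scale_right\<close>)
    define W where "W = {u \<in> vcarrier V. vact V (C_elem a) u = vscale V e u}"
    have "sla_submodule W V"
      unfolding sla_submodule_def
    proof (intro conjI ballI)
      show "W \<subseteq> vcarrier V" by (auto simp: W_def)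
      have "vact V (C_elem a) 0 = 0" using lm.act_scale_right[OF C zero_mem, of 0] by simp
      then show "lm.subspace W"
        using sub unfolding lm.subspace_def W_def
        by (auto simp: lm.act_add_right[OF C] lm.act_scale_right[OF C] lm.scale_right_distrib lm.scale_left_commute)
      fix X :: "'n sla" and w assume X: "X \<in> sla_carrier" and w: "w \<in> W"
      have wV: "w \<in> vcarrier V" "vact V (C_elem a) w = vscale V e w" using w by (auto simp: W_def)
      obtain A c where Ac: "X = (A, c)" by (cases X)
      have "A ** 0 = 0" "0 ** A = 0"
        by (simp_all add: vec_eq_iff matrix_matrix_mult_def)
      then have "sla_bracket (C_elem a) X = (0, 0)"
        by (simp add: Ac C_elem_def sla_bracket_def)
      moreover have "vact V (0, 0) w = 0" using \<phi>_zero(2)[OF wV(1)] by (simp add: \<phi>_def)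
      ultimately have "vact V (C_elem a) (vact V X w) = vact V X (vact V (C_elem a) w)"
        using lm.act_bracket[OF C X wV(1)] by simp
      then show "vact V X w \<in> W"
        using wV X by (simp add: W_def lm.act_closed lm.act_scale_right)
    qed
    moreover have "u \<in> W" using e by (simp add: W_def)
    ultimately have "W = vcarrier V" using irr(2)[of W] e(2) by auto
    then show ?thesis by (auto simp: W_def)
  qed
  then obtain m where "\<And>a u. u \<in> vcarrier V \<Longrightarrow> vact V (C_elem a) u = vscale V (m a) u" by metis
  then show thesis by (intro that[of "\<chi> a. m a"]) simp
qed

lemma fd_irreducible_sla_scalar:
  fixes V :: "('n::finite, 'v::ab_group_add) sla_module" and lam :: "complex ^ 'n"
  assumes V: "fd_irreducible_sla_module V" and card: "CARD('n) \<ge> 2"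
  obtains \<mu> where "sla_scalar V \<mu>"
proof -
  obtain \<mu> :: "complex ^ 'n" where "\<And>a u. u \<in> vcarrier V \<Longrightarrow> vact V (C_elem a) u = vscale V (\<mu> $ a) u"
    by (rule fd_irreducible_scalars[OF V]) blast
  then have "sla_scalar V \<mu>"
    using V two_indices[OF card]
    by unfold_locales (simp_all add: fd_irreducible_sla_module_def)
  then show thesis by (rule that)
qed

lemma tensor_rep_of_module:
  fixes V :: "('n::finite, 'v::ab_group_add) sla_module"
  assumes V: "fd_irreducible_sla_module V" and "sla_scalar V \<mu>" and M: "is_tensor_module lam V M"
  shows "tensor_rep V \<mu> lam M"
proof -
  interpret sla_scalar V \<mu> lam by fact
  show ?thesis
    by unfold_locales (rule is_tensor_module_acts[OF M], use V in \<open>simp add: fd_irreducible_sla_module_def\<close>)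
qed

theorem theorem5p2:
  fixes lam :: "complex ^ 'n::finite"
  assumes "CARD('n) \<ge> 2"
  shows
    "(\<forall>V :: ('n, 'v::ab_group_add) sla_module.
        fd_irreducible_sla_module V \<longrightarrow>
          (\<exists>M. is_tensor_module lam V M) \<and>
          (\<forall>M. is_tensor_module lam V M \<longrightarrow> category_J_at lam M \<and> AS_irreducible M)) \<and>
     (\<forall>(V :: ('n, 'v) sla_module) (W :: ('n, 'w::ab_group_add) sla_module) M M'.
        fd_irreducible_sla_module V \<and> fd_irreducible_sla_module W \<and>
        is_tensor_module lam V M \<and> is_tensor_module lam W M' \<longrightarrow>
          (sla_isomorphic V W \<longleftrightarrow> AS_isomorphic M M')) \<and>
     (\<forall>J :: ('n, 'j::ab_group_add) AS_module.
        category_J_at lam J \<and> AS_irreducible J \<longrightarrow>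
          (\<exists>(V :: ('n, nat \<Rightarrow> complex) sla_module) M.
             fd_irreducible_sla_module V \<and> is_tensor_module lam V M \<and> AS_isomorphic M J))"
proof (intro conjI allI impI)
  fix V :: "('n, 'v) sla_module" assume V: "fd_irreducible_sla_module V"
  obtain \<mu> where \<mu>: "sla_scalar V \<mu>" by (rule fd_irreducible_sla_scalar[OF V assms])
  interpret sla_scalar V \<mu> lam by (rule \<mu>)
  show "\<exists>M. is_tensor_module lam V M"
    using acts_is_tensor_module[OF acts_tensor_module] by blast
  fix M assume M: "is_tensor_module lam V M"
  interpret tensor_rep V \<mu> lam M by (rule tensor_rep_of_module[OF V \<mu> M])
  show "category_J_at lam M"
    using V in_category by (auto simp: fd_irreducible_sla_module_def)
  show "AS_irreducible M"
    using V by (intro irreducible) (auto simp: fd_irreducible_sla_module_def)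
next
  fix V :: "('n, 'v) sla_module" and W :: "('n, 'w) sla_module" and M M'
  assume a: "fd_irreducible_sla_module V \<and> fd_irreducible_sla_module W \<and>
        is_tensor_module lam V M \<and> is_tensor_module lam W M'"
  obtain \<mu> where \<mu>: "sla_scalar V \<mu>" using fd_irreducible_sla_scalar[of V] a assms by blast
  obtain \<mu>' where \<mu>': "sla_scalar W \<mu>'" using fd_irreducible_sla_scalar[of W] a assms by blast
  have "tensor_rep V \<mu> lam M" "tensor_rep W \<mu>' lam M'"
    using a \<mu> \<mu>' by (auto intro: tensor_rep_of_module)
  then interpret tensor_pair V \<mu> lam M W \<mu>' M' by (rule tensor_pair.intro)
  show "sla_isomorphic V W \<longleftrightarrow> AS_isomorphic M M'"
    using tensor_iso sla_iso a by (auto simp: fd_irreducible_sla_module_def)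
next
  fix J :: "('n, 'j) AS_module" assume J: "category_J_at lam J \<and> AS_irreducible J"
  interpret J_object J lam
    using J two_indices[OF assms] by unfold_locales auto
  obtain d and \<beta> :: "(nat \<Rightarrow> complex) \<Rightarrow> 'j" where \<beta>: "bij_betw \<beta> (coord d) U"
    "\<And>f h. \<beta> (f + h) = \<beta> f + \<beta> h" "\<And>c f. \<beta> (fscale c f) = jscale J c (\<beta> f)"
    by (rule coordinates) blast
  interpret J_coordinates J lam d \<beta>
    by unfold_locales (use \<beta> in auto)
  show "\<exists>(V :: ('n, nat \<Rightarrow> complex) sla_module) M.
      fd_irreducible_sla_module V \<and> is_tensor_module lam V M \<and> AS_isomorphic M J"
    using irreducible_object_is_tensor J assms by blast
qed

end
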